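(* Let $m,k$ be positive integers and let $\rho\in\operatorname{Der}(\mathfrak{h}_{m,k})$. Then, in the basis $\mathcal{B}_{m,k}$, the linear map $\rho$ has the matrix representation $$\begin{bmatrix} A_1+R_1+R_2 & A_2 & 0\\ A_4 & A_3+R_1+R_2 & 0\\ \ast & \ast & 2R(p)+\overline{R}(q)\end{bmatrix}$$ for some $p,q\in\mathbb{C}[t]/(t^{k+1})$, with row and column blocks of sizes $m(k+1)$, $m(k+1)$, $k+1$, such that: (a) For every $r\in\{1,2,3,4\}$ the matrix $A_r$ is an $m\times m$ block matrix $A_r=([A_r]_{ij})_{1\le i,j\le m}$ with blocks $[A_r]_{ij}\in M_{k+1,k+1}(\mathbb{C})$, where for all $i,j=1,\dots,m$: the blocks $[A_r]_{ij}$ are lower triangular Toeplitz matrices; $[A_3]_{ij}=-[A_1]_{ji}$; $[A_2]_{ij}=[A_2]_{ji}$; and $[A_4]_{ij}=[A_4]_{ji}$. (b) $R_1 = I_m\otimes R(p)$ and $R_2 = I_m\otimes\overline{R}(q)$, the block diagonal matrices with $m$ diagonal blocks equal to $R(p)$, respectively $\overline{R}(q)$ (here $\otimes$ is the Kronecker product of matrices). Moreover, the blocks of the matrices $A_r$ can be written as $[A_r]_{ij}=[B_r]_{ij}+[D_r]_{ij}$, where $[D_r]_{ij}$ is a diagonal matrix that is a multiple of the identity, in such a way that the matrices of the form $$\begin{bmatrix} D_1 & D_2 & 0\\ D_4 & D_3 & 0\\ 0&0&0\end{bmatrix}$$ form a representation of the symplectic Lie algebra $\mathfrak{sp}_{2m}(\mathbb{C})$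 and constitute a Levi factor of $\operatorname{Der}(\mathfrak{h}_{m,k})$. In fact, the block $\begin{bmatrix} D_1 & D_2 \\ D_4 & D_3 \end{bmatrix}$ equals $D\otimes I_{k+1}$ with $D\in\mathfrak{sp}_{2m}(\mathbb{C})$.
   Context: $\mathfrak{h}_m$ is the complex Heisenberg Lie algebra of dimension $2m+1$, with basis $e_1,\dots,e_m,f_1,\dots,f_m,z$ whose only nonzero brackets (up to antisymmetry) are $[e_i,f_i]=z$. The truncated current Heisenberg Lie algebra is $\mathfrak{h}_{m,k}=\mathfrak{h}_m\otimes\mathbb{C}[t]/(t^{k+1})$ with bracket $[X\otimes a,Y\otimes b]=[X,Y]\otimes ab$. Its ordered basis $\mathcal{B}_{m,k}$ is $e_{1,0},\dots,e_{1,k},\dots,e_{m,0},\dots,e_{m,k}, f_{1,0},\dots,f_{1,k},\dots,f_{m,0},\dots,f_{m,k}, z_0,\dots,z_k$, where $e_{i,j}=e_i\otimes t^j$, $f_{i,j}=f_i\otimes t^j$, $z_j=z\otimes t^j$. Matrices of linear maps have as columns the coordinates of the images of basis vectors. $\operatorname{Der}$ denotes the Lie algebra of derivations under the commutator; it is identified with a Lie algebra of matrices via $\mathcal{B}_{m,k}$. For $p=\sum_{i=0}^k a_it^i\in\mathbb{C}[t]/(t^{k+1})$, $R(p)$ is the $(k+1)\times(k+1)$ lower triangular Toeplitz matrix (rows and columns indexed by $0,\dots,k$) with $(r,c)$ entry $a_{r-c}$ for $r\ge c$ and $0$ otherwise, i.e. the matrix of multiplication by $p$ in the basis $1,t,\dots,t^k$.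 For $q=\sum_{i=0}^k b_it^i$, $\overline{R}(q)$ is the $(k+1)\times(k+1)$ lower triangular matrix with $(r,c)$ entry $c\,b_{r-c+1}$ for $r\ge c\geq 1$ and $0$ otherwise (so column $0$ is zero, the diagonal is $0,b_1,2b_1,\dots,kb_1$, and the last row is $0,b_k,2b_{k-1},\dots,(k-1)b_2,kb_1$). $\mathfrak{sp}_{2m}(\mathbb{C})$ is the Lie algebra of $2m\times 2m$ complex matrices $\begin{bmatrix} X_1 & X_2 \\ X_3 & X_4 \end{bmatrix}$ ($m\times m$ blocks) with $X_4=-X_1^t$, $X_2=X_2^t$, $X_3=X_3^t$. A Levi factor of a finite dimensional Lie algebra is a semisimple subalgebra complementary to the solvable radical. The symbols $\ast$ denote unspecified matrices of size $(k+1)\times m(k+1)$. *)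

theory Defs
  imports
    "Jordan_Normal_Form.VS_Connect"
    "HOL-Computational_Algebra.Polynomial"
begin

section \<open>Complex Lie algebras as carrier-based structures\<close>

record ('k, 'a) lie_struct = "('k, 'a) module" +
  lie_bracket :: "'a \<Rightarrow> 'a \<Rightarrow> 'a"

type_synonym 'a complex_lie = "(complex, 'a) lie_struct"

locale lie_algebra = vectorspace class_ring L
  for L :: "'a complex_lie" (structure) +
  assumes bracket_closed:
      "\<lbrakk>x \<in> carrier L; y \<in> carrier L\<rbrakk> \<Longrightarrow> lie_bracket L x y \<in> carrier L"
    and bracket_add_left:
      "\<lbrakk>x \<in> carrier L; y \<in> carrier L; w \<in> carrier L\<rbrakk> \<Longrightarrow>
        lie_bracket L (x \<oplus> y) w = lie_bracket L x w \<oplus> lie_bracket L y w"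
    and bracket_smult_left:
      "\<lbrakk>x \<in> carrier L; y \<in> carrier L\<rbrakk> \<Longrightarrow>
        lie_bracket L (c \<odot> x) y = c \<odot> lie_bracket L x y"
    and bracket_self: "x \<in> carrier L \<Longrightarrow> lie_bracket L x x = \<zero>"
    and bracket_add_right:
      "\<lbrakk>x \<in> carrier L; y \<in> carrier L; w \<in> carrier L\<rbrakk> \<Longrightarrow>
        lie_bracket L w (x \<oplus> y) = lie_bracket L w x \<oplus> lie_bracket L w y"
    and bracket_smult_right:
      "\<lbrakk>x \<in> carrier L; y \<in> carrier L\<rbrakk> \<Longrightarrow>
        lie_bracket L x (c \<odot> y) = c \<odot> lie_bracket L x y"
    and jacobi:
      "\<lbrakk>x \<in> carrier L; y \<in> carrier L; w \<in> carrier L\<rbrakk> \<Longrightarrow>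
        lie_bracket L x (lie_bracket L y w) \<oplus> lie_bracket L y (lie_bracket L w x)
          \<oplus> lie_bracket L w (lie_bracket L x y) = \<zero>"

definition lie_subalgebra :: "'a complex_lie \<Rightarrow> 'a set \<Rightarrow> bool" where
  "lie_subalgebra L S \<longleftrightarrow> subspace class_ring S L \<and>
     (\<forall>x\<in>S. \<forall>y\<in>S. lie_bracket L x y \<in> S)"

definition lie_ideal :: "'a complex_lie \<Rightarrow> 'a set \<Rightarrow> bool" where
  "lie_ideal L I \<longleftrightarrow> subspace class_ring I L \<and>
     (\<forall>x\<in>carrier L. \<forall>y\<in>I. lie_bracket L x y \<in> I)"

definition lie_derived :: "'a complex_lie \<Rightarrow> 'a set \<Rightarrow> 'a set" where
  "lie_derived L U =
     LinearCombinations.module.span class_ring L {lie_bracket L x y | x y. x \<in> U \<and> y \<in> U}"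

definition lie_solvable :: "'a complex_lie \<Rightarrow> 'a set \<Rightarrow> bool" where
  "lie_solvable L U \<longleftrightarrow> (\<exists>n. (lie_derived L ^^ n) U = {\<zero>\<^bsub>L\<^esub>})"

definition is_solvable_radical :: "'a complex_lie \<Rightarrow> 'a set \<Rightarrow> bool" where
  "is_solvable_radical L R \<longleftrightarrow> lie_ideal L R \<and> lie_solvable L R \<and>
     (\<forall>I. lie_ideal L I \<and> lie_solvable L I \<longrightarrow> I \<subseteq> R)"

definition lie_semisimple :: "'a complex_lie \<Rightarrow> bool" where
  "lie_semisimple L \<longleftrightarrow> is_solvable_radical L {\<zero>\<^bsub>L\<^esub>}"

definition levi_factor :: "'a complex_lie \<Rightarrow> 'a set \<Rightarrow> bool" where
  "levi_factor L S \<longleftrightarrow> lie_subalgebra L S \<and> lie_semisimple (L\<lparr>carrier := S\<rparr>) \<and>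
     (\<exists>R. is_solvable_radical L R \<and> S \<inter> R = {\<zero>\<^bsub>L\<^esub>} \<and> carrier L = {x \<oplus>\<^bsub>L\<^esub> y | x y. x \<in> S \<and> y \<in> R})"

definition lie_hom :: "'a complex_lie \<Rightarrow> 'b complex_lie \<Rightarrow> ('a \<Rightarrow> 'b) set" where
  "lie_hom L M = {\<phi> \<in> LinearCombinations.module_hom class_ring L M.
     \<forall>x\<in>carrier L. \<forall>y\<in>carrier L. \<phi> (lie_bracket L x y) = lie_bracket M (\<phi> x) (\<phi> y)}"

text \<open>The maps are arbitrary (not extensional) outside the carrier.\<close>

definition derivations :: "'a complex_lie \<Rightarrow> ('a \<Rightarrow> 'a) set" where
  "derivations L = {\<rho> \<in> LinearCombinations.module_hom class_ring L L.
     \<forall>x\<in>carrier L. \<forall>y\<in>carrier L.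
       \<rho> (lie_bracket L x y) = lie_bracket L (\<rho> x) y \<oplus>\<^bsub>L\<^esub> lie_bracket L x (\<rho> y)}"

definition gl :: "nat \<Rightarrow> complex mat complex_lie" where
  "gl n = module.extend (module_mat TYPE(complex) n n)
            (lie_struct.fields (\<lambda>A B. A * B - B * A))"

lemma lie_algebra_gl: "lie_algebra (gl n)"
proof -
  have "abelian_group (gl n)"
    by (rule abelian_groupI)
      (auto simp: gl_def lie_struct.defs module.defs module_mat_simps
        intro: comm_add_mat bexI[of _ "- x" for x] uminus_l_inv_mat)
  then have vs: "vectorspace class_ring (gl n)"
    by (intro vectorspace.intro Module.module.intro module_axioms.intro class_field class_cring.is_cring)
      (auto simp: gl_def lie_struct.defs module.defs module_mat_simps
        add_smult_distrib_left_mat add_smult_distrib_right_mat)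
  have jac: "x * (y * w - w * y) - (y * w - w * y) * x + (y * (w * x - x * w) - (w * x - x * w) * y) +
      (w * (x * y - y * x) - (x * y - y * x) * w) = 0\<^sub>m n n"
    if "x \<in> carrier_mat n n" "y \<in> carrier_mat n n" "w \<in> carrier_mat n n" for x y w :: "complex mat"
  proof -
    have distrib: "a * (b * c - c * b) - (b * c - c * b) * a =
        (a * b * c - a * c * b) - (b * c * a - c * b * a)"
      if "a \<in> carrier_mat n n" "b \<in> carrier_mat n n" "c \<in> carrier_mat n n" for a b c :: "complex mat"
      using that by (simp add: mult_minus_distrib_mat[of _ n n _ n] minus_mult_distrib_mat[of _ n n _ _ n]
          assoc_mult_mat[of _ n n _ n _ n])
    have cancel: "(a1 - a2) - (a3 - a4) + ((a3 - a5) - (a6 - a2)) + ((a6 - a4) - (a1 - a5)) = 0\<^sub>m n n"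
      if "a1 \<in> carrier_mat n n" "a2 \<in> carrier_mat n n" "a3 \<in> carrier_mat n n"
        "a4 \<in> carrier_mat n n" "a5 \<in> carrier_mat n n" "a6 \<in> carrier_mat n n"
      for a1 a2 a3 a4 a5 a6 :: "complex mat"
      using that by (intro eq_matI) auto
    show ?thesis
      using that unfolding distrib[OF that] distrib[OF that(2,3,1)] distrib[OF that(3,1,2)]
      by (intro cancel) auto
  qed
  show ?thesis
    by (intro lie_algebra.intro lie_algebra_axioms.intro vs)
      (auto simp: jac gl_def lie_struct.defs module.defs module_mat_simps
        mult_smult_distrib[of _ n n _ n] algebra_simps)
qed

definition sp :: "nat \<Rightarrow> complex mat complex_lie" where
  "sp m = (gl (2 * m)) \<lparr>carrier := {four_block_mat X1 X2 X3 X4 | X1 X2 X3 X4.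
      X1 \<in> carrier_mat m m \<and> X2 \<in> carrier_mat m m \<and> X3 \<in> carrier_mat m m \<and>
      X4 = - transpose_mat X1 \<and> X2 = transpose_mat X2 \<and> X3 = transpose_mat X3}\<rparr>"


section \<open>The truncated current Heisenberg Lie algebra\<close>

text \<open>Coordinates with respect to \<open>e\<^sub>1, \<dots>, e\<^sub>m, f\<^sub>1, \<dots>, f\<^sub>m, z\<close>; indices are shifted to start at 0.\<close>

definition heisenberg :: "nat \<Rightarrow> complex vec complex_lie" where
  "heisenberg m = module.extend (module_vec TYPE(complex) (2 * m + 1))
     (lie_struct.fields (\<lambda>x y.
        (\<Sum>i<m. x $ i * y $ (m + i) - x $ (m + i) * y $ i) \<cdot>\<^sub>v unit_vec (2 * m + 1) (2 * m)))"

lemma lie_algebra_heisenberg: "lie_algebra (heisenberg m)"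
proof -
  have "abelian_group (heisenberg m)"
    by (rule abelian_groupI)
      (auto simp: heisenberg_def lie_struct.defs module.defs module_vec_simps
        intro: comm_add_vec bexI[of _ "- x" for x] uminus_l_inv_vec)
  then have "vectorspace class_ring (heisenberg m)"
    by (intro vectorspace.intro Module.module.intro module_axioms.intro class_field class_cring.is_cring)
      (auto simp: heisenberg_def lie_struct.defs module.defs module_vec_simps
        add_smult_distrib_vec smult_add_distrib_vec)
  then show ?thesis
    by (intro lie_algebra.intro lie_algebra_axioms.intro)
      (auto simp: heisenberg_def lie_struct.defs module.defs module_vec_simps
        vec_eq_iff unit_vec_def algebra_simps sum.distrib sum_subtractf sum_distrib_left)
qed

text \<open>An element of the tensor product of \<open>L\<close> with the polynomials in \<open>t\<close> modulo \<open>t ^ (k + 1)\<close> is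
  uniquely a sum of terms of the form \<open>x\<^sub>j\<close> tensor \<open>t ^ j\<close> with \<open>j \<le> k\<close>; it is represented by the
  sequence of its coefficients \<open>x\<^sub>j\<close>, continued by zero.\<close>

definition truncated_current :: "'a complex_lie \<Rightarrow> nat \<Rightarrow> (nat \<Rightarrow> 'a) complex_lie" where
  "truncated_current L k =
     \<lparr>carrier = {x. (\<forall>j\<le>k. x j \<in> carrier L) \<and> (\<forall>j>k. x j = \<zero>\<^bsub>L\<^esub>)},
      mult = undefined, one = undefined,
      zero = (\<lambda>j. \<zero>\<^bsub>L\<^esub>), add = (\<lambda>x y j. x j \<oplus>\<^bsub>L\<^esub> y j),
      smult = (\<lambda>c x j. c \<odot>\<^bsub>L\<^esub> x j),
      lie_bracket = (\<lambda>x y j. if j \<le> k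
        then (\<Oplus>\<^bsub>L\<^esub> i \<in> {..j}. lie_bracket L (x i) (y (j - i))) else \<zero>\<^bsub>L\<^esub>)\<rparr>"

abbreviation heisenberg_current :: "nat \<Rightarrow> nat \<Rightarrow> (nat \<Rightarrow> complex vec) complex_lie" where
  "heisenberg_current m k \<equiv> truncated_current (heisenberg m) k"

definition pure_tensor :: "'a complex_lie \<Rightarrow> nat \<Rightarrow> 'a \<Rightarrow> complex poly \<Rightarrow> nat \<Rightarrow> 'a" where
  "pure_tensor L k X p = (\<lambda>j. if j \<le> k then coeff p j \<odot>\<^bsub>L\<^esub> X else \<zero>\<^bsub>L\<^esub>)"

lemma (in lie_algebra) truncated_current_bracket_pure_tensor:
  assumes "X \<in> carrier L" "Y \<in> carrier L"
  shows "lie_bracket (truncated_current L k) (pure_tensor L k X p) (pure_tensor L k Y q) =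
    pure_tensor L k (lie_bracket L X Y) (p * q)"
proof
  fix j
  have c: "lie_bracket L X Y \<in> carrier L"
    using assms by (rule bracket_closed)
  have "(\<Oplus>\<^bsub>L\<^esub> i \<in> {..j}. lie_bracket L (pure_tensor L k X p i) (pure_tensor L k Y q (j - i))) =
      coeff (p * q) j \<odot>\<^bsub>L\<^esub> lie_bracket L X Y" if "j \<le> k"
  proof -
    have "(\<Oplus>\<^bsub>L\<^esub> i \<in> {..j}. lie_bracket L (pure_tensor L k X p i) (pure_tensor L k Y q (j - i))) =
      (\<Oplus>\<^bsub>L\<^esub> i \<in> {..j}. (coeff p i * coeff q (j - i)) \<odot>\<^bsub>L\<^esub> lie_bracket L X Y)"
    proof (rule finsum_cong')
      show "lie_bracket L (pure_tensor L k X p i) (pure_tensor L k Y q (j - i)) =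
        (coeff p i * coeff q (j - i)) \<odot>\<^bsub>L\<^esub> lie_bracket L X Y" if "i \<in> {..j}" for i
        using that \<open>j \<le> k\<close> le_trans[OF diff_le_self \<open>j \<le> k\<close>] assms c
          smult_assoc1[of "coeff q (j - i)" "coeff p i" "lie_bracket L X Y"]
        by (simp add: pure_tensor_def bracket_smult_left bracket_smult_right mult.commute)
    qed (use c in auto)
    also have "\<dots> = finsum class_ring (\<lambda>i. coeff p i * coeff q (j - i)) {..j} \<odot>\<^bsub>L\<^esub> lie_bracket L X Y"
      using c by (subst finsum_smult_r) auto
    finally show ?thesis
      by (simp add: class_ring_simps coeff_mult)
  qed
  then show "lie_bracket (truncated_current L k) (pure_tensor L k X p) (pure_tensor L k Y q) j =
      pure_tensor L k (lie_bracket L X Y) (p * q) j"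
    by (simp add: truncated_current_def) (simp add: pure_tensor_def)
qed

definition hc_basis :: "nat \<Rightarrow> nat \<Rightarrow> (nat \<Rightarrow> complex vec) list" where
  "hc_basis m k =
     (let e = (\<lambda>i. unit_vec (2 * m + 1) i);
          f = (\<lambda>i. unit_vec (2 * m + 1) (m + i));
          z = unit_vec (2 * m + 1) (2 * m);
          tensor = (\<lambda>X j. pure_tensor (heisenberg m) k X (monom 1 j))
      in [tensor (e i) j. i \<leftarrow> [0..<m], j \<leftarrow> [0..<k+1]] @
         [tensor (f i) j. i \<leftarrow> [0..<m], j \<leftarrow> [0..<k+1]] @
         [tensor z j. j \<leftarrow> [0..<k+1]])"

definition hc_dim :: "nat \<Rightarrow> nat \<Rightarrow> nat" where
  "hc_dim m k = (2 * m + 1) * (k + 1)"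

text \<open>In the ordered basis, position \<open>n\<close> is the basis vector of the Heisenberg algebra with index
  \<open>n div (k + 1)\<close>, tensored with \<open>t ^ (n mod (k + 1))\<close>; \<open>hc_coord_basis\<close> below confirms that these
  are the coordinates.\<close>

definition hc_coord :: "nat \<Rightarrow> (nat \<Rightarrow> complex vec) \<Rightarrow> nat \<Rightarrow> complex" where
  "hc_coord k x n = x (n mod (k + 1)) $ (n div (k + 1))"

lemma hc_basis_eq:
  "hc_basis m k = map (\<lambda>n. pure_tensor (heisenberg m) k
     (unit_vec (2 * m + 1) (n div (k + 1))) (monom 1 (n mod (k + 1)))) [0..<hc_dim m k]"
proof -
  have upt_shift: "[0..<a + b] = [0..<a] @ map (\<lambda>i. a + i) [0..<b]" for a b
    by (rule nth_equalityI) (auto simp: nth_append)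
  have concat_eq: "concat (map (\<lambda>i. map (g i) [0..<k + 1]) [0..<M]) =
      map (\<lambda>n. g (n div (k + 1)) (n mod (k + 1))) [0..<M * (k + 1)]" for g :: "nat \<Rightarrow> nat \<Rightarrow> 'b" and M
  proof (induction M)
    case (Suc M)
    have "map (\<lambda>n. g (n div (k + 1)) (n mod (k + 1))) (map (\<lambda>i. M * (k + 1) + i) [0..<k + 1]) =
        map (g M) [0..<k + 1]"
      by (simp del: upt_Suc mult_Suc_right)
    moreover have "[0..<Suc M * (k + 1)] = [0..<M * (k + 1)] @ map (\<lambda>i. M * (k + 1) + i) [0..<k + 1]"
      using upt_shift[of "M * (k + 1)" "k + 1"] by (simp only: mult_Suc add.commute)
    moreover have "[0..<Suc M] = [0..<M] @ [M]" by simp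
    ultimately show ?case
      by (simp only: Suc.IH map_append concat_append list.map concat.simps append_Nil2)
  qed simp
  have "[0..<2 * m + 1] = [0..<m] @ map (\<lambda>i. m + i) [0..<m] @ [2 * m]"
    using upt_shift[of m m] by (simp add: mult_2)
  then have "hc_basis m k = concat (map (\<lambda>i. map (\<lambda>j. pure_tensor (heisenberg m) k
      (unit_vec (2 * m + 1) i) (monom 1 j)) [0..<k + 1]) [0..<2 * m + 1])"
    by (simp add: hc_basis_def Let_def comp_def del: upt_Suc)
  then show ?thesis
    unfolding concat_eq hc_dim_def .
qed

lemma hc_coord_basis:
  assumes "r < hc_dim m k" "c < hc_dim m k"
  shows "hc_coord k (hc_basis m k ! c) r = (if r = c then 1 else 0)"
proof -
  have "n div (k + 1) < 2 * m + 1" if "n < hc_dim m k" for n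
    using that by (simp add: hc_dim_def less_mult_imp_div_less)
  moreover have "r = c \<longleftrightarrow> r div (k + 1) = c div (k + 1) \<and> r mod (k + 1) = c mod (k + 1)"
    by (metis div_mult_mod_eq)
  moreover have "r mod (k + 1) \<le> k"
    using mod_less_divisor[of "k + 1" r] by simp
  ultimately show ?thesis
    using assms
    by (auto simp: hc_coord_def hc_basis_eq pure_tensor_def heisenberg_def module_vec_simps
        lie_struct.defs module.defs)
qed

definition hc_matrix ::
    "nat \<Rightarrow> nat \<Rightarrow> ((nat \<Rightarrow> complex vec) \<Rightarrow> (nat \<Rightarrow> complex vec)) \<Rightarrow> complex mat" where
  "hc_matrix m k \<rho> = mat (hc_dim m k) (hc_dim m k)
     (\<lambda>(r, c). hc_coord k (\<rho> (hc_basis m k ! c)) r)"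

definition Der_hc :: "nat \<Rightarrow> nat \<Rightarrow> complex mat complex_lie" where
  "Der_hc m k = (gl (hc_dim m k))
     \<lparr>carrier := hc_matrix m k ` derivations (heisenberg_current m k)\<rparr>"


section \<open>Block matrices\<close>

definition block_mat_3x3 :: "'a::zero mat \<Rightarrow> 'a mat \<Rightarrow> 'a mat \<Rightarrow> 'a mat \<Rightarrow> 'a mat \<Rightarrow> 'a mat \<Rightarrow>
    'a mat \<Rightarrow> 'a mat \<Rightarrow> 'a mat \<Rightarrow> 'a mat" where
  "block_mat_3x3 A11 A12 A13 A21 A22 A23 A31 A32 A33 =
     four_block_mat
       (four_block_mat A11 A12 A21 A22) (A13 @\<^sub>r A23)
       (four_block_mat A31 A32 (0\<^sub>m 0 (dim_col A31)) (0\<^sub>m 0 (dim_col A32))) A33"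

definition mat_block :: "nat \<Rightarrow> 'a mat \<Rightarrow> nat \<Rightarrow> nat \<Rightarrow> 'a mat" where
  "mat_block n A i j = mat n n (\<lambda>(r, c). A $$ (i * n + r, j * n + c))"

definition kronecker :: "'a::times mat \<Rightarrow> 'a mat \<Rightarrow> 'a mat" where
  "kronecker A B = mat (dim_row A * dim_row B) (dim_col A * dim_col B)
     (\<lambda>(r, c). A $$ (r div dim_row B, c div dim_col B) * B $$ (r mod dim_row B, c mod dim_col B))"

definition lower_triangular_toeplitz :: "nat \<Rightarrow> 'a::zero mat \<Rightarrow> bool" where
  "lower_triangular_toeplitz n T \<longleftrightarrow>
     (\<exists>a. T = mat n n (\<lambda>(r, c). if c \<le> r then a (r - c) else 0))"

text \<open>A class modulo \<open>t ^ (k + 1)\<close> is given by its representative of degree at most \<open>k\<close>.\<close>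

definition R_mat :: "nat \<Rightarrow> complex poly \<Rightarrow> complex mat" where
  "R_mat k p = mat (k + 1) (k + 1) (\<lambda>(r, c). if c \<le> r then coeff p (r - c) else 0)"

definition Rbar_mat :: "nat \<Rightarrow> complex poly \<Rightarrow> complex mat" where
  "Rbar_mat k q = mat (k + 1) (k + 1)
     (\<lambda>(r, c). if 1 \<le> c \<and> c \<le> r then of_nat c * coeff q (r - c + 1) else 0)"

definition levi_block :: "nat \<Rightarrow> nat \<Rightarrow> complex mat \<Rightarrow> complex mat \<Rightarrow> complex mat \<Rightarrow> complex mat
    \<Rightarrow> complex mat" where
  "levi_block m k D1 D2 D3 D4 = block_mat_3x3
     D1 D2 (0\<^sub>m (m * (k + 1)) (k + 1))
     D4 D3 (0\<^sub>m (m * (k + 1)) (k + 1))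
     (0\<^sub>m (k + 1) (m * (k + 1))) (0\<^sub>m (k + 1) (m * (k + 1))) (0\<^sub>m (k + 1) (k + 1))"

end

(* Let z be the center of the Heisenberg algebra. A derivation preserves the center, and comparing
   coefficients in its Leibniz rule on pairs of basis vectors shows that it acts on the center by a
   map delta with delta(ab) = delta(a) b + a delta(b) - ab delta(1); hence delta is multiplication by
   2p = delta(1) plus the vector field q d/dt, and the remaining part on the span of the e_i and f_i is
   linear over C[t]/(t^(k+1)) and symplectic. Reading off the constant term of the symplectic part is a
   Lie algebra homomorphism onto sp_{2m}, split by D |-> D tensor I. Its kernel is solvable because its
   elements become triangular once the basis is ordered by powers of t, with the center last; every
   solvable ideal is mapped to 0 because a nonzero ideal of sp_{2m} contains an sl_2-triple. *)

theory Submission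
  imports Defs
begin

section \<open>Derivations of the current Heisenberg algebra\<close>

text \<open>The factor 2 on the center comes from \<open>[e_i, f_i] = z\<close>: the scalar p acts
  on e_i and on f_i, and the Leibniz rule adds both contributions. So p is half of delta(1), and
  this half must be removed before the rest lies in the symplectic algebra. The field q d/dt kills
  1, hence leaves delta(1) and the columns of t^0 alone; but on t^i it has the diagonal entry i *
  q_1. The kernel of the projection is therefore not nilpotent: strict triangularity starts only
  with its first derived algebra.

  The obstacle is that both halves of the Levi claim quantify over all solvable ideals. One argument
  covers them. If a matrix Lie algebra maps onto the symplectic algebra, an ideal with nonzero image
  contains elements over an sl_2-triple; brackets within the triple return nonzero multiples of all
  its members, so no term of the derived series vanishes. For the derivation algebra this confines
  every solvable ideal to the kernel; for the image of the splitting, where the projection is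
  injective, it gives semisimplicity.\<close>

lemma gl_simps:
  "carrier (gl n) = carrier_mat n n" "add (gl n) = (+)" "zero (gl n) = 0\<^sub>m n n"
  "smult (gl n) = (\<cdot>\<^sub>m)" "lie_bracket (gl n) = (\<lambda>A B. A * B - B * A)"
  by (auto simp: gl_def lie_struct.defs module.defs module_mat_simps)

lemma heisenberg_simps:
  "carrier (heisenberg m) = carrier_vec (2 * m + 1)" "add (heisenberg m) = (+)"
  "zero (heisenberg m) = 0\<^sub>v (2 * m + 1)" "smult (heisenberg m) = (\<cdot>\<^sub>v)"
  by (auto simp: heisenberg_def lie_struct.defs module.defs module_vec_simps)

text \<open>Only coordinates below \<open>2 * m\<close> enter, so the same form serves elements of
  the Heisenberg algebra, of length \<open>2 * m + 1\<close>, and the vectors of length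
  \<open>2 * m\<close> on which \<open>sp m\<close> acts.\<close>

definition sympl_form :: "nat \<Rightarrow> complex vec \<Rightarrow> complex vec \<Rightarrow> complex" where
  "sympl_form m x y = (\<Sum>i<m. x $ i * y $ (m + i) - x $ (m + i) * y $ i)"

lemma heisenberg_bracket:
  "lie_bracket (heisenberg m) x y = sympl_form m x y \<cdot>\<^sub>v unit_vec (2 * m + 1) (2 * m)"
  by (auto simp: heisenberg_def lie_struct.defs module.defs sympl_form_def)

lemma truncated_current_simps:
  "carrier (truncated_current L k) = {x. (\<forall>j\<le>k. x j \<in> carrier L) \<and> (\<forall>j>k. x j = \<zero>\<^bsub>L\<^esub>)}"
  "zero (truncated_current L k) = (\<lambda>j. \<zero>\<^bsub>L\<^esub>)"
  "add (truncated_current L k) = (\<lambda>x y j. x j \<oplus>\<^bsub>L\<^esub> y j)"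
  "smult (truncated_current L k) = (\<lambda>c x j. c \<odot>\<^bsub>L\<^esub> x j)"
  by (auto simp: truncated_current_def)

text \<open>Every term of the convolution is a multiple of the central vector, so the sum in the
  algebra becomes a sum of scalars.\<close>

lemma heisenberg_current_bracket:
  "lie_bracket (heisenberg_current m k) x y = (\<lambda>j. if j \<le> k
     then (\<Sum>i\<le>j. sympl_form m (x i) (y (j - i))) \<cdot>\<^sub>v unit_vec (2 * m + 1) (2 * m)
     else 0\<^sub>v (2 * m + 1))"
proof -
  interpret lie_algebra "heisenberg m" by (rule lie_algebra_heisenberg)
  have "(\<Oplus>\<^bsub>heisenberg m\<^esub> i \<in> {..j}. lie_bracket (heisenberg m) (x i) (y (j - i))) =
      finsum class_ring (\<lambda>i. sympl_form m (x i) (y (j - i))) {..j} \<odot>\<^bsub>heisenberg m\<^esub>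
        unit_vec (2 * m + 1) (2 * m)" for j
    by (subst finsum_smult_r) (auto simp: heisenberg_simps heisenberg_bracket)
  then show ?thesis
    by (auto simp: truncated_current_def heisenberg_simps class_ring_simps)
qed

section \<open>The symplectic form and the Lie algebra axioms of the current algebra\<close>

lemma sympl_form_add_left:
  "x \<in> carrier_vec n \<Longrightarrow> y \<in> carrier_vec n \<Longrightarrow> 2 * m \<le> n \<Longrightarrow>
   sympl_form m (x + y) w = sympl_form m x w + sympl_form m y w"
  by (auto simp: sympl_form_def algebra_simps sum.distrib sum_subtractf)

lemma sympl_form_add_right:
  "x \<in> carrier_vec n \<Longrightarrow> y \<in> carrier_vec n \<Longrightarrow> 2 * m \<le> n \<Longrightarrow>
   sympl_form m w (x + y) = sympl_form m w x + sympl_form m w y"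
  by (auto simp: sympl_form_def algebra_simps sum.distrib sum_subtractf)

lemma sympl_form_smult_left:
  "x \<in> carrier_vec n \<Longrightarrow> 2 * m \<le> n \<Longrightarrow> sympl_form m (c \<cdot>\<^sub>v x) w = c * sympl_form m x w"
  by (auto simp: sympl_form_def algebra_simps sum_distrib_left)

lemma sympl_form_smult_right:
  "x \<in> carrier_vec n \<Longrightarrow> 2 * m \<le> n \<Longrightarrow> sympl_form m w (c \<cdot>\<^sub>v x) = c * sympl_form m w x"
  by (auto simp: sympl_form_def algebra_simps sum_distrib_left)

lemma sympl_form_swap: "sympl_form m x y = - sympl_form m y x"
  by (simp add: sympl_form_def sum_negf [symmetric] mult.commute)

lemma sympl_form_center [simp]:
  "sympl_form m x (c \<cdot>\<^sub>v unit_vec (2 * m + 1) (2 * m)) = 0"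
  "sympl_form m (c \<cdot>\<^sub>v unit_vec (2 * m + 1) (2 * m)) x = 0"
  "sympl_form m x (0\<^sub>v (2 * m + 1)) = 0"
  "sympl_form m (0\<^sub>v (2 * m + 1)) x = 0"
  by (auto simp: sympl_form_def)

lemma lie_algebra_heisenberg_current: "lie_algebra (heisenberg_current m k)"
proof -
  let ?L = "heisenberg_current m k"
  note simps = truncated_current_simps heisenberg_simps
  have "abelian_group ?L"
  proof (rule abelian_groupI)
    fix x assume "x \<in> carrier ?L"
    then show "\<exists>y\<in>carrier ?L. y \<oplus>\<^bsub>?L\<^esub> x = \<zero>\<^bsub>?L\<^esub>"
      by (intro bexI [of _ "\<lambda>j. - x j"]) (auto simp: simps fun_eq_iff, metis not_le uminus_l_inv_vec zero_carrier_vec)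
  next
    fix x y assume "x \<in> carrier ?L" "y \<in> carrier ?L"
    then show "x \<oplus>\<^bsub>?L\<^esub> y = y \<oplus>\<^bsub>?L\<^esub> x"
      by (auto simp: simps fun_eq_iff) (metis comm_add_vec not_le)
  next
    fix x y z assume "x \<in> carrier ?L" "y \<in> carrier ?L" "z \<in> carrier ?L"
    then show "(x \<oplus>\<^bsub>?L\<^esub> y) \<oplus>\<^bsub>?L\<^esub> z = x \<oplus>\<^bsub>?L\<^esub> (y \<oplus>\<^bsub>?L\<^esub> z)"
      by (auto simp: simps fun_eq_iff) (metis assoc_add_vec not_le zero_carrier_vec)
  next
    fix x assume "x \<in> carrier ?L"
    then show "\<zero>\<^bsub>?L\<^esub> \<oplus>\<^bsub>?L\<^esub> x = x"
      by (auto simp: simps fun_eq_iff) (metis left_zero_vec not_le zero_carrier_vec)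
  qed (auto simp: simps)
  have car: "x j \<in> carrier_vec (2 * m + 1)" if "x \<in> carrier ?L" for x j
    using that by (cases "j \<le> k") (auto simp: simps)
  have vs: "vectorspace class_ring ?L"
  proof (intro vectorspace.intro Module.module.intro module_axioms.intro class_field class_cring.is_cring)
    show "abelian_group ?L" by fact
  next
    fix c x y assume "x \<in> carrier ?L" "y \<in> carrier ?L"
    then show "c \<odot>\<^bsub>?L\<^esub> (x \<oplus>\<^bsub>?L\<^esub> y) = c \<odot>\<^bsub>?L\<^esub> x \<oplus>\<^bsub>?L\<^esub> c \<odot>\<^bsub>?L\<^esub> y"
      using smult_add_distrib_vec [OF car car, of x y] by (simp only: simps)
  qed (auto simp: simps fun_eq_iff add_smult_distrib_vec)
  show ?thesis
  proof (intro lie_algebra.intro lie_algebra_axioms.intro vs)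
    fix x y w c assume xy: "x \<in> carrier ?L" "y \<in> carrier ?L"
    show "lie_bracket ?L x y \<in> carrier ?L"
      by (auto simp: heisenberg_current_bracket simps)
    show "lie_bracket ?L (x \<oplus>\<^bsub>?L\<^esub> y) w = lie_bracket ?L x w \<oplus>\<^bsub>?L\<^esub> lie_bracket ?L y w"
      using sympl_form_add_left [OF car car, OF xy]
      by (auto simp: heisenberg_current_bracket simps sum.distrib add_smult_distrib_vec)
    show "lie_bracket ?L w (x \<oplus>\<^bsub>?L\<^esub> y) = lie_bracket ?L w x \<oplus>\<^bsub>?L\<^esub> lie_bracket ?L w y"
      using sympl_form_add_right [OF car car, OF xy]
      by (auto simp: heisenberg_current_bracket simps sum.distrib add_smult_distrib_vec)
    show "lie_bracket ?L (c \<odot>\<^bsub>?L\<^esub> x) y = c \<odot>\<^bsub>?L\<^esub> lie_bracket ?L x y"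
      using sympl_form_smult_left [OF car, OF xy(1)]
      by (auto simp: heisenberg_current_bracket simps fun_eq_iff sum_distrib_left smult_smult_assoc)
    show "lie_bracket ?L x (c \<odot>\<^bsub>?L\<^esub> y) = c \<odot>\<^bsub>?L\<^esub> lie_bracket ?L x y"
      using sympl_form_smult_right [OF car, OF xy(2)]
      by (auto simp: heisenberg_current_bracket simps fun_eq_iff sum_distrib_left smult_smult_assoc)
  next
    fix x assume "x \<in> carrier ?L"
    have "(\<Sum>i\<le>j. sympl_form m (x i) (x (j - i))) = 0" for j
    proof -
      \<comment> \<open>Reversing the order of summation swaps the arguments of the antisymmetric
        form, so the sum equals its own negative.\<close>
      have "(\<Sum>i\<le>j. sympl_form m (x i) (x (j - i))) = (\<Sum>i\<le>j. sympl_form m (x (j - i)) (x i))"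
        by (rule sum.reindex_bij_witness [of _ "\<lambda>i. j - i" "\<lambda>i. j - i"]) auto
      also have "\<dots> = - (\<Sum>i\<le>j. sympl_form m (x i) (x (j - i)))"
        by (subst sympl_form_swap) (simp add: sum_negf)
      finally show ?thesis by simp
    qed
    then show "lie_bracket ?L x x = \<zero>\<^bsub>?L\<^esub>"
      by (auto simp: heisenberg_current_bracket simps fun_eq_iff)
  next
    fix x y w
    have "sympl_form m u (if b then c \<cdot>\<^sub>v unit_vec (2 * m + 1) (2 * m) else 0\<^sub>v (2 * m + 1)) = 0"
      for u b c
      by (cases b) (simp_all only: sympl_form_center if_True if_False)
    \<comment> \<open>The algebra is two-step nilpotent: an inner bracket is central, hence each of
      the three Jacobi terms vanishes by itself.\<close>
    then have zero: "lie_bracket ?L x (lie_bracket ?L y w) = \<zero>\<^bsub>?L\<^esub>" for x y w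
      by (auto simp: heisenberg_current_bracket simps fun_eq_iff)
    show "lie_bracket ?L x (lie_bracket ?L y w) \<oplus>\<^bsub>?L\<^esub> lie_bracket ?L y (lie_bracket ?L w x)
        \<oplus>\<^bsub>?L\<^esub> lie_bracket ?L w (lie_bracket ?L x y) = \<zero>\<^bsub>?L\<^esub>"
      unfolding zero by (simp add: simps)
  qed
qed

section \<open>Derivations form a Lie algebra under the commutator\<close>

lemma (in lie_algebra) derivations_zero: "(\<lambda>_. \<zero>\<^bsub>L\<^esub>) \<in> derivations L"
proof -
  have 0: "0 \<odot> x = \<zero>" if "x \<in> carrier L" for x
    using lmult_0 [OF that] by (simp add: class_ring_simps)
  have "lie_bracket L x \<zero>\<^bsub>L\<^esub> = \<zero>\<^bsub>L\<^esub>" "lie_bracket L \<zero>\<^bsub>L\<^esub> x = \<zero>\<^bsub>L\<^esub>" if "x \<in> carrier L" for x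
    using that bracket_smult_left [of x x 0] bracket_smult_right [of x x 0]
      bracket_smult_left [of "\<zero>" x 0] bracket_smult_right [of x "\<zero>" 0]
    by (simp_all add: 0 bracket_closed)
  then show ?thesis
    by (auto simp: derivations_def LinearCombinations.module_hom_def)
qed

lemma derivationsD:
  assumes "\<rho> \<in> derivations L"
  shows "x \<in> carrier L \<Longrightarrow> \<rho> x \<in> carrier L"
    and "x \<in> carrier L \<Longrightarrow> y \<in> carrier L \<Longrightarrow> \<rho> (x \<oplus>\<^bsub>L\<^esub> y) = \<rho> x \<oplus>\<^bsub>L\<^esub> \<rho> y"
    and "x \<in> carrier L \<Longrightarrow> \<rho> (c \<odot>\<^bsub>L\<^esub> x) = c \<odot>\<^bsub>L\<^esub> \<rho> x"
    and "x \<in> carrier L \<Longrightarrow> y \<in> carrier L \<Longrightarrow>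
      \<rho> (lie_bracket L x y) = lie_bracket L (\<rho> x) y \<oplus>\<^bsub>L\<^esub> lie_bracket L x (\<rho> y)"
  using assms by (auto simp: derivations_def LinearCombinations.module_hom_def)

lemma derivationsI:
  assumes "\<And>x. x \<in> carrier L \<Longrightarrow> \<rho> x \<in> carrier L"
    and "\<And>x y. x \<in> carrier L \<Longrightarrow> y \<in> carrier L \<Longrightarrow> \<rho> (x \<oplus>\<^bsub>L\<^esub> y) = \<rho> x \<oplus>\<^bsub>L\<^esub> \<rho> y"
    and "\<And>c x. x \<in> carrier L \<Longrightarrow> \<rho> (c \<odot>\<^bsub>L\<^esub> x) = c \<odot>\<^bsub>L\<^esub> \<rho> x"
    and "\<And>x y. x \<in> carrier L \<Longrightarrow> y \<in> carrier L \<Longrightarrow>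
      \<rho> (lie_bracket L x y) = lie_bracket L (\<rho> x) y \<oplus>\<^bsub>L\<^esub> lie_bracket L x (\<rho> y)"
  shows "\<rho> \<in> derivations L"
  using assms by (auto simp: derivations_def LinearCombinations.module_hom_def)

lemma (in lie_algebra) derivations_add:
  assumes "\<rho> \<in> derivations L" "\<sigma> \<in> derivations L"
  shows "(\<lambda>x. \<rho> x \<oplus> \<sigma> x) \<in> derivations L"
proof (rule derivationsI)
  note d = derivationsD [OF assms(1)] derivationsD [OF assms(2)]
  show "\<rho> (lie_bracket L x y) \<oplus> \<sigma> (lie_bracket L x y) =
      lie_bracket L (\<rho> x \<oplus> \<sigma> x) y \<oplus> lie_bracket L x (\<rho> y \<oplus> \<sigma> y)"
    if "x \<in> carrier L" "y \<in> carrier L" for x y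
    using that by (simp add: d bracket_closed bracket_add_left bracket_add_right M.add.m_ac)
qed (auto simp: derivationsD [OF assms(1)] derivationsD [OF assms(2)] smult_r_distr M.add.m_ac)

lemma (in lie_algebra) derivations_smult:
  assumes "\<rho> \<in> derivations L"
  shows "(\<lambda>x. c \<odot> \<rho> x) \<in> derivations L"
proof -
  have "c \<odot> (d \<odot> x) = d \<odot> (c \<odot> x)" if "x \<in> carrier L" for d x
    using that smult_assoc1 [of c d x] smult_assoc1 [of d c x] by (simp add: mult.commute)
  then show ?thesis
    by (intro derivationsI) (auto simp: derivationsD [OF assms] smult_r_distr bracket_closed
        bracket_smult_left bracket_smult_right)
qed

lemma (in lie_algebra) derivations_commutator:
  assumes "\<rho> \<in> derivations L" "\<sigma> \<in> derivations L"
  shows "(\<lambda>x. \<rho> (\<sigma> x) \<oplus> (-1) \<odot> \<sigma> (\<rho> x)) \<in> derivations L"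
proof (rule derivationsI)
  note d = derivationsD [OF assms(1)] derivationsD [OF assms(2)]
  fix x y assume xy: "x \<in> carrier L" "y \<in> carrier L"
  show "\<rho> (\<sigma> (x \<oplus> y)) \<oplus> (-1) \<odot> \<sigma> (\<rho> (x \<oplus> y)) =
      (\<rho> (\<sigma> x) \<oplus> (-1) \<odot> \<sigma> (\<rho> x)) \<oplus> (\<rho> (\<sigma> y) \<oplus> (-1) \<odot> \<sigma> (\<rho> y))"
    using xy by (simp add: d smult_r_distr M.add.m_ac)
  \<comment> \<open>Here \<open>b\<close> and \<open>c\<close> stand for the mixed brackets of
    \<open>\<sigma> x\<close> with \<open>\<rho> y\<close> and of \<open>\<rho> x\<close> with
    \<open>\<sigma> y\<close>, which occur in both composites.\<close>
  have cancel: "(a \<oplus> b \<oplus> (c \<oplus> e)) \<oplus> (-1) \<odot> (a' \<oplus> c \<oplus> (b \<oplus> e')) =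
      (a \<oplus> (-1) \<odot> a') \<oplus> (e \<oplus> (-1) \<odot> e')"
    if "a \<in> carrier L" "b \<in> carrier L" "c \<in> carrier L" "e \<in> carrier L"
      "a' \<in> carrier L" "e' \<in> carrier L" for a b c e a' e'
  proof -
    have n: "(-1) \<odot> z = \<ominus> z" if "z \<in> carrier L" for z
      using that smult_minus_1 by (simp add: class_ring_simps)
    have "(a \<oplus> b \<oplus> (c \<oplus> e)) \<oplus> \<ominus> (a' \<oplus> c \<oplus> (b \<oplus> e')) =
        (b \<oplus> \<ominus> b) \<oplus> ((c \<oplus> \<ominus> c) \<oplus> ((a \<oplus> \<ominus> a') \<oplus> (e \<oplus> \<ominus> e')))"
      using that by (simp add: M.minus_add M.add.m_ac del: M.r_neg M.r_neg1 M.r_neg2)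
    then show ?thesis
      using that by (simp add: n M.r_neg)
  qed
  show "\<rho> (\<sigma> (lie_bracket L x y)) \<oplus> (-1) \<odot> \<sigma> (\<rho> (lie_bracket L x y)) =
      lie_bracket L (\<rho> (\<sigma> x) \<oplus> (-1) \<odot> \<sigma> (\<rho> x)) y \<oplus>
      lie_bracket L x (\<rho> (\<sigma> y) \<oplus> (-1) \<odot> \<sigma> (\<rho> y))"
    using xy by (simp add: d bracket_closed bracket_add_left bracket_add_right
        bracket_smult_left bracket_smult_right cancel)
next
  note d = derivationsD [OF assms(1)] derivationsD [OF assms(2)]
  fix c x assume x: "x \<in> carrier L"
  then have "c \<odot> ((-1) \<odot> \<sigma> (\<rho> x)) = (-1) \<odot> (c \<odot> \<sigma> (\<rho> x))"
    using smult_assoc1 [of c "-1" "\<sigma> (\<rho> x)"] smult_assoc1 [of "-1" c "\<sigma> (\<rho> x)"]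
    by (simp add: d)
  with x show "\<rho> (\<sigma> (c \<odot> x)) \<oplus> (-1) \<odot> \<sigma> (\<rho> (c \<odot> x)) = c \<odot> (\<rho> (\<sigma> x) \<oplus> (-1) \<odot> \<sigma> (\<rho> x))"
    by (simp add: d smult_r_distr)
qed (auto simp: derivationsD [OF assms(1)] derivationsD [OF assms(2)])

section \<open>Matrices of derivations\<close>

lemma block_index_less: "a < M \<Longrightarrow> i \<le> k \<Longrightarrow> a * (k + 1) + i < M * (k + 1)" for a :: nat
  using mult_le_mono1 [of "Suc a" M "k + 1"] by simp

lemma block_index_div_mod [simp]:
  "i \<le> k \<Longrightarrow> (a * (k + 1) + i) div (k + 1) = a" "i \<le> k \<Longrightarrow> (a * (k + 1) + i) mod (k + 1) = i"
  for a :: nat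
  by (auto simp del: mult_Suc_right)

lemma block_indexE:
  fixes n M k :: nat
  assumes "n < M * (k + 1)"
  obtains a i where "a < M" "i \<le> k" "n = a * (k + 1) + i"
proof
  show "n div (k + 1) < M" using assms by (simp add: less_mult_imp_div_less)
  show "n mod (k + 1) \<le> k" using mod_less_divisor [of "k + 1" n] by simp
  show "n = n div (k + 1) * (k + 1) + n mod (k + 1)" by (rule div_mult_mod_eq [symmetric])
qed

lemma sum_block_index:
  "(\<Sum>n<M * (k + 1). f n) = (\<Sum>a<M. \<Sum>i\<le>k. f (a * (k + 1) + i))" for f :: "nat \<Rightarrow> 'a::comm_monoid_add"
proof -
  have "sum f {a * (k + 1)..<a * (k + 1) + (k + 1)} = (\<Sum>i\<le>k. f (a * (k + 1) + i))" for a
    by (rule sum.reindex_bij_witness [of _ "\<lambda>i. a * (k + 1) + i" "\<lambda>n. n - a * (k + 1)"]) auto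
  then show ?thesis
    using sum.nat_group [of f "k + 1" M] by simp
qed

text \<open>This is x_a tensor t^i, with e, f and z numbered by the single index \<open>a\<close>,
  so that \<open>2 * m\<close> stands for z.\<close>

definition hc_elem :: "nat \<Rightarrow> nat \<Rightarrow> nat \<Rightarrow> nat \<Rightarrow> complex vec" where
  "hc_elem m a i = (\<lambda>j. if j = i then unit_vec (2 * m + 1) a else 0\<^sub>v (2 * m + 1))"

lemma hc_basis_nth:
  assumes "a < 2 * m + 1" "i \<le> k"
  shows "hc_basis m k ! (a * (k + 1) + i) = hc_elem m a i"
proof -
  have "a * (k + 1) + i < hc_dim m k"
    unfolding hc_dim_def by (rule block_index_less [OF assms])
  then have "hc_basis m k ! (a * (k + 1) + i) =
      pure_tensor (heisenberg m) k (unit_vec (2 * m + 1) a) (monom 1 i)"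
    unfolding hc_basis_eq by (simp only: nth_map_upt diff_zero add_0 block_index_div_mod [OF assms(2)])
  also have "\<dots> = hc_elem m a i"
    using assms by (auto simp: pure_tensor_def hc_elem_def heisenberg_simps fun_eq_iff)
  finally show ?thesis .
qed

lemma hc_elem_carrier: "i \<le> k \<Longrightarrow> hc_elem m a i \<in> carrier (heisenberg_current m k)"
  by (auto simp: hc_elem_def truncated_current_simps heisenberg_simps)

lemma hc_basis_carrier:
  assumes "n < hc_dim m k"
  shows "hc_basis m k ! n \<in> carrier (heisenberg_current m k)"
proof -
  obtain a i where "a < 2 * m + 1" "i \<le> k" "n = a * (k + 1) + i"
    using assms unfolding hc_dim_def by (rule block_indexE)
  then show ?thesis using hc_basis_nth hc_elem_carrier by metis
qed

lemma hc_coord_block: "i \<le> k \<Longrightarrow> hc_coord k x (a * (k + 1) + i) = x i $ a"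
  unfolding hc_coord_def by (simp only: block_index_div_mod)

lemma hc_coord_index:
  assumes "n < hc_dim m k"
  shows "n div (k + 1) < 2 * m + 1" "n mod (k + 1) \<le> k"
  using assms mod_less_divisor [of "k + 1" n]
  by (simp_all add: hc_dim_def less_mult_imp_div_less)

lemma hc_coord_add:
  assumes "x \<in> carrier (heisenberg_current m k)" "y \<in> carrier (heisenberg_current m k)" "n < hc_dim m k"
  shows "hc_coord k (x \<oplus>\<^bsub>heisenberg_current m k\<^esub> y) n = hc_coord k x n + hc_coord k y n"
proof -
  have "y (n mod (k + 1)) \<in> carrier_vec (2 * m + 1)"
    using hc_coord_index [OF assms(3)] assms(2) by (simp add: truncated_current_simps heisenberg_simps)
  then show ?thesis
    using hc_coord_index [OF assms(3)]
    by (simp add: hc_coord_def truncated_current_simps heisenberg_simps)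
qed

lemma hc_coord_smult:
  assumes "x \<in> carrier (heisenberg_current m k)" "n < hc_dim m k"
  shows "hc_coord k (c \<odot>\<^bsub>heisenberg_current m k\<^esub> x) n = c * hc_coord k x n"
proof -
  have "x (n mod (k + 1)) \<in> carrier_vec (2 * m + 1)"
    using hc_coord_index [OF assms(2)] assms(1) by (simp add: truncated_current_simps heisenberg_simps)
  then show ?thesis
    using hc_coord_index [OF assms(2)]
    by (simp add: hc_coord_def truncated_current_simps heisenberg_simps)
qed

lemma hc_coord_eqI:
  assumes "x \<in> carrier (heisenberg_current m k)" "y \<in> carrier (heisenberg_current m k)"
    and "\<And>n. n < hc_dim m k \<Longrightarrow> hc_coord k x n = hc_coord k y n"
  shows "x = y"
proof
  fix j
  show "x j = y j"
  proof (cases "j \<le> k")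
    case True
    have "x j $ a = y j $ a" if "a < 2 * m + 1" for a
    proof -
      have "hc_coord k x (a * (k + 1) + j) = hc_coord k y (a * (k + 1) + j)"
        by (rule assms(3)) (unfold hc_dim_def, rule block_index_less [OF that True])
      then show ?thesis by (simp only: hc_coord_block [OF True])
    qed
    with True show ?thesis using assms(1,2)
      by (intro eq_vecI) (auto simp: truncated_current_simps heisenberg_simps)
  qed (use assms in \<open>auto simp: truncated_current_simps\<close>)
qed

lemma hc_matrix_carrier [simp]: "hc_matrix m k \<rho> \<in> carrier_mat (hc_dim m k) (hc_dim m k)"
  by (simp add: hc_matrix_def)

text \<open>Linearity, by induction on a bound \<open>l\<close> for the positions of nonzero
  coordinates: a step subtracts the right multiple of the basis vector at position
  \<open>l\<close>.\<close>

lemma hc_coord_expand: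
  assumes \<rho>: "\<rho> \<in> derivations (heisenberg_current m k)"
    and x: "x \<in> carrier (heisenberg_current m k)" and r: "r < hc_dim m k"
  shows "hc_coord k (\<rho> x) r = (\<Sum>n<hc_dim m k. hc_matrix m k \<rho> $$ (r, n) * hc_coord k x n)"
proof -
  let ?L = "heisenberg_current m k"
  interpret lie_algebra ?L by (rule lie_algebra_heisenberg_current)
  note d = derivationsD [OF \<rho>]
  have "hc_coord k (\<rho> x) r = (\<Sum>n<l. hc_matrix m k \<rho> $$ (r, n) * hc_coord k x n)"
    if "l \<le> hc_dim m k" "x \<in> carrier ?L" "\<And>n. l \<le> n \<Longrightarrow> n < hc_dim m k \<Longrightarrow> hc_coord k x n = 0" for l x
    using that
  proof (induction l arbitrary: x)
    case 0
    \<comment> \<open>Without nonzero coordinates \<open>x\<close> is zero; the form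
      \<open>0 \<odot> x = x\<close> lets homogeneity of \<open>\<rho>\<close> show that its image
      is zero too.\<close>
    have "0 \<odot>\<^bsub>?L\<^esub> x = x"
      using 0 by (intro hc_coord_eqI [of _ m k]) (auto simp: hc_coord_smult)
    from arg_cong [OF this, of \<rho>] have "\<rho> x = 0 \<odot>\<^bsub>?L\<^esub> \<rho> x"
      unfolding d(3) [OF 0(2)] by (rule sym)
    from arg_cong [OF this, of "\<lambda>x. hc_coord k x r"] show ?case
      unfolding hc_coord_smult [OF d(1) [OF 0(2)] r] by simp
  next
    case (Suc l)
    define b where "b = hc_basis m k ! l"
    have b: "b \<in> carrier ?L" using Suc.prems(1) unfolding b_def by (intro hc_basis_carrier) auto
    define c where "c = hc_coord k x l"
    define y where "y = x \<oplus>\<^bsub>?L\<^esub> (- c) \<odot>\<^bsub>?L\<^esub> b"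
    have b': "(c') \<odot>\<^bsub>?L\<^esub> z \<in> carrier ?L" if "z \<in> carrier ?L" for z c'
      by (rule smult_closed [OF _ that]) (simp only: class_ring_simps UNIV_I)
    have y: "y \<in> carrier ?L" unfolding y_def using Suc.prems(2) b' [OF b] by (rule M.a_closed)
    have cb: "hc_coord k b n = (if n = l then 1 else 0)" if "n < hc_dim m k" for n
      unfolding b_def using Suc.prems(1) that by (simp add: hc_coord_basis)
    have cy: "hc_coord k y n = (if n = l then 0 else hc_coord k x n)" if "n < hc_dim m k" for n
      unfolding y_def hc_coord_add [OF Suc.prems(2) b' [OF b] that] hc_coord_smult [OF b that] cb [OF that]
      by (simp add: c_def)
    have IH: "hc_coord k (\<rho> y) r = (\<Sum>n<l. hc_matrix m k \<rho> $$ (r, n) * hc_coord k y n)"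
    proof (rule Suc.IH [OF _ y])
      show "l \<le> hc_dim m k" using Suc.prems(1) by simp
      show "hc_coord k y n = 0" if "l \<le> n" "n < hc_dim m k" for n
        unfolding cy [OF that(2)] using Suc.prems(3) [of n] that by (cases "n = l") simp_all
    qed
    have "hc_coord k (\<rho> y) r = hc_coord k (\<rho> x) r - c * hc_coord k (\<rho> b) r"
      unfolding y_def d(2) [OF Suc.prems(2) b' [OF b]] d(3) [OF b]
        hc_coord_add [OF d(1) [OF Suc.prems(2)] b' [OF d(1) [OF b]] r]
        hc_coord_smult [OF d(1) [OF b] r] by simp
    moreover have "hc_coord k (\<rho> b) r = hc_matrix m k \<rho> $$ (r, l)"
      using r Suc.prems(1) by (simp add: hc_matrix_def b_def)
    ultimately have "hc_coord k (\<rho> x) r = (\<Sum>n<l. hc_matrix m k \<rho> $$ (r, n) * hc_coord k y n) +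
        hc_matrix m k \<rho> $$ (r, l) * c"
      unfolding IH by (simp add: mult.commute)
    also have "(\<Sum>n<l. hc_matrix m k \<rho> $$ (r, n) * hc_coord k y n) =
        (\<Sum>n<l. hc_matrix m k \<rho> $$ (r, n) * hc_coord k x n)"
      using Suc.prems(1) cy by (intro sum.cong) auto
    finally show ?case by (simp add: c_def)
  qed
  from this [OF order_refl x] show ?thesis by simp
qed

lemma hc_matrix_zero: "hc_matrix m k (\<lambda>_. \<zero>\<^bsub>heisenberg_current m k\<^esub>) = 0\<^sub>m (hc_dim m k) (hc_dim m k)"
  using hc_coord_index
  by (intro eq_matI) (auto simp: hc_matrix_def hc_coord_def truncated_current_simps heisenberg_simps)

lemma hc_matrix_smult:
  assumes \<rho>: "\<rho> \<in> derivations (heisenberg_current m k)"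
  shows "hc_matrix m k (\<lambda>x. c \<odot>\<^bsub>heisenberg_current m k\<^esub> \<rho> x) = c \<cdot>\<^sub>m hc_matrix m k \<rho>"
  using derivationsD(1) [OF \<rho>]
  by (intro eq_matI) (auto simp: hc_matrix_def hc_coord_smult hc_basis_carrier)

context
  fixes m k \<rho> \<sigma>
  assumes \<rho>: "\<rho> \<in> derivations (heisenberg_current m k)"
    and \<sigma>: "\<sigma> \<in> derivations (heisenberg_current m k)"
begin

interpretation lie_algebra "heisenberg_current m k" by (rule lie_algebra_heisenberg_current)

lemma hc_matrix_add:
  "hc_matrix m k (\<lambda>x. \<rho> x \<oplus>\<^bsub>heisenberg_current m k\<^esub> \<sigma> x) = hc_matrix m k \<rho> + hc_matrix m k \<sigma>"
  using derivationsD(1) [OF \<rho>] derivationsD(1) [OF \<sigma>]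
  by (intro eq_matI) (auto simp: hc_matrix_def hc_coord_add hc_basis_carrier)

lemma hc_coord_comp:
  assumes "r < hc_dim m k" "c < hc_dim m k"
  shows "hc_coord k (\<rho> (\<sigma> (hc_basis m k ! c))) r = (hc_matrix m k \<rho> * hc_matrix m k \<sigma>) $$ (r, c)"
proof -
  have "\<sigma> (hc_basis m k ! c) \<in> carrier (heisenberg_current m k)"
    using assms by (intro derivationsD(1) [OF \<sigma>] hc_basis_carrier)
  moreover have "hc_coord k (\<sigma> (hc_basis m k ! c)) n = hc_matrix m k \<sigma> $$ (n, c)"
    if "n < hc_dim m k" for n
    using that assms by (simp add: hc_matrix_def)
  ultimately have "hc_coord k (\<rho> (\<sigma> (hc_basis m k ! c))) r =
      (\<Sum>n<hc_dim m k. hc_matrix m k \<rho> $$ (r, n) * hc_matrix m k \<sigma> $$ (n, c))"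
    using assms by (simp add: hc_coord_expand [OF \<rho>])
  also have "\<dots> = (hc_matrix m k \<rho> * hc_matrix m k \<sigma>) $$ (r, c)"
    using assms hc_matrix_carrier [of m k \<rho>] hc_matrix_carrier [of m k \<sigma>]
    by (auto simp: scalar_prod_def atLeast0LessThan simp del: hc_matrix_carrier)
  finally show ?thesis .
qed

end

lemma hc_matrix_commutator:
  assumes \<rho>: "\<rho> \<in> derivations (heisenberg_current m k)"
    and \<sigma>: "\<sigma> \<in> derivations (heisenberg_current m k)"
  shows "hc_matrix m k (\<lambda>x. \<rho> (\<sigma> x) \<oplus>\<^bsub>heisenberg_current m k\<^esub> (-1) \<odot>\<^bsub>heisenberg_current m k\<^esub> \<sigma> (\<rho> x)) =
    hc_matrix m k \<rho> * hc_matrix m k \<sigma> - hc_matrix m k \<sigma> * hc_matrix m k \<rho>" (is "?l = ?r")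
proof (rule eq_matI)
  interpret lie_algebra "heisenberg_current m k" by (rule lie_algebra_heisenberg_current)
  have dims: "dim_row (hc_matrix m k \<tau>) = hc_dim m k" "dim_col (hc_matrix m k \<tau>) = hc_dim m k" for \<tau>
    by (auto simp: hc_matrix_def)
  fix r c assume "r < dim_row ?r" "c < dim_col ?r"
  then have rc: "r < hc_dim m k" "c < hc_dim m k"
    by (auto simp: dims)
  let ?b = "hc_basis m k ! c"
  have b: "?b \<in> carrier (heisenberg_current m k)" by (rule hc_basis_carrier [OF rc(2)])
  have "?l $$ (r, c) = hc_coord k (\<rho> (\<sigma> ?b)) r - hc_coord k (\<sigma> (\<rho> ?b)) r"
    using rc b derivationsD(1) [OF \<rho>] derivationsD(1) [OF \<sigma>]
    by (simp add: hc_matrix_def hc_coord_add hc_coord_smult)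
  also have "\<dots> = ?r $$ (r, c)"
    unfolding hc_coord_comp [OF \<rho> \<sigma> rc] hc_coord_comp [OF \<sigma> \<rho> rc] using rc by (simp add: dims)
  finally show "?l $$ (r, c) = ?r $$ (r, c)" .
qed (auto simp: hc_matrix_def)

text \<open>Closure conditions that do not mention an ambient carrier, so that ideals, kernels and
  images in different matrix algebras can be compared; \<open>subspace_gl_sub\<close> translates
  them into \<open>subspace\<close>.\<close>

definition lin_closed :: "nat \<Rightarrow> complex mat set \<Rightarrow> bool" where
  "lin_closed n S \<longleftrightarrow> S \<subseteq> carrier_mat n n \<and> 0\<^sub>m n n \<in> S \<and>
     (\<forall>A\<in>S. \<forall>B\<in>S. A + B \<in> S) \<and> (\<forall>c. \<forall>A\<in>S. c \<cdot>\<^sub>m A \<in> S)"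

lemma vectorspace_gl_sub:
  assumes "lin_closed n S"
  shows "vectorspace class_ring ((gl n)\<lparr>carrier := S\<rparr>)"
proof -
  interpret lie_algebra "gl n" by (rule lie_algebra_gl)
  have "Module.module class_ring (gl n)"
    using vectorspace_axioms by (simp add: vectorspace_def)
  then have "submodule class_ring S (gl n)"
    using assms by (auto simp: lin_closed_def gl_simps submodule_def)
  then show ?thesis
    using subspace_is_vs vectorspace_axioms by (simp only: subspace_def)
qed

lemma subspace_gl_sub:
  assumes "lin_closed n T"
  shows "subspace class_ring S ((gl n)\<lparr>carrier := T\<rparr>) \<longleftrightarrow> lin_closed n S \<and> S \<subseteq> T"
proof -
  have vectorspace_axioms: "vectorspace class_ring ((gl n)\<lparr>carrier := T\<rparr>)"
    by (rule vectorspace_gl_sub [OF assms])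
  then have module_axioms: "Module.module class_ring ((gl n)\<lparr>carrier := T\<rparr>)"
    by (simp add: vectorspace_def)
  have "subspace class_ring S ((gl n)\<lparr>carrier := T\<rparr>) \<longleftrightarrow>
      submodule class_ring S ((gl n)\<lparr>carrier := T\<rparr>)"
    using vectorspace_axioms by (auto simp: subspace_def)
  also have "\<dots> \<longleftrightarrow> lin_closed n S \<and> S \<subseteq> T"
    using module_axioms assms unfolding submodule_def lin_closed_def
    by (auto simp: gl_simps)
  finally show ?thesis .
qed

lemma carrier_Der_hc: "carrier (Der_hc m k) = hc_matrix m k ` derivations (heisenberg_current m k)"
  by (simp add: Der_hc_def)

lemma Der_hc_closed:
  shows "lin_closed (hc_dim m k) (carrier (Der_hc m k))"
    and "A \<in> carrier (Der_hc m k) \<Longrightarrow> B \<in> carrier (Der_hc m k) \<Longrightarrow>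
      A * B - B * A \<in> carrier (Der_hc m k)"
proof -
  interpret lie_algebra "heisenberg_current m k" by (rule lie_algebra_heisenberg_current)
  let ?D = "derivations (heisenberg_current m k)"
  show "lin_closed (hc_dim m k) (carrier (Der_hc m k))"
    unfolding lin_closed_def carrier_Der_hc
  proof (intro conjI ballI allI)
    show "0\<^sub>m (hc_dim m k) (hc_dim m k) \<in> hc_matrix m k ` ?D"
      unfolding hc_matrix_zero [symmetric] by (intro imageI derivations_zero)
  next
    fix A B assume "A \<in> hc_matrix m k ` ?D" "B \<in> hc_matrix m k ` ?D"
    then obtain \<rho> \<sigma> where d: "\<rho> \<in> ?D" "\<sigma> \<in> ?D" and AB: "A = hc_matrix m k \<rho>" "B = hc_matrix m k \<sigma>"
      by auto
    show "A + B \<in> hc_matrix m k ` ?D"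
      unfolding AB hc_matrix_add [OF d, symmetric] by (intro imageI derivations_add d)
  next
    fix c A assume "A \<in> hc_matrix m k ` ?D"
    then obtain \<rho> where d: "\<rho> \<in> ?D" and A: "A = hc_matrix m k \<rho>"
      by auto
    show "c \<cdot>\<^sub>m A \<in> hc_matrix m k ` ?D"
      unfolding A hc_matrix_smult [OF d, symmetric] by (intro imageI derivations_smult d)
  qed auto
  assume "A \<in> carrier (Der_hc m k)" "B \<in> carrier (Der_hc m k)"
  then obtain \<rho> \<sigma> where d: "\<rho> \<in> ?D" "\<sigma> \<in> ?D" and AB: "A = hc_matrix m k \<rho>" "B = hc_matrix m k \<sigma>"
    by (auto simp: carrier_Der_hc)
  show "A * B - B * A \<in> carrier (Der_hc m k)"
    unfolding AB carrier_Der_hc hc_matrix_commutator [OF d, symmetric]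
    by (intro imageI derivations_commutator d)
qed

section \<open>Entries of a derivation\<close>

lemma sympl_form_unit_right:
  assumes "b < 2 * m + 1"
  shows "sympl_form m x (unit_vec (2 * m + 1) b) =
    (if b < m then - x $ (m + b) else if b < 2 * m then x $ (b - m) else 0)"
proof -
  have "sympl_form m x (unit_vec (2 * m + 1) b) =
      (\<Sum>i<m. if i = b - m then if m \<le> b then x $ i else 0 else 0) - (\<Sum>i<m. if i = b then x $ (m + i) else 0)"
    using assms unfolding sympl_form_def sum_subtractf
    by (intro arg_cong2 [of _ _ _ _ "(-)"] sum.cong) auto
  also have "\<dots> = (if b < m then - x $ (m + b) else if b < 2 * m then x $ (b - m) else 0)"
    by (simp only: sum.delta' sum.delta finite_lessThan) auto
  finally show ?thesis .
qed

lemma sympl_form_unit_left: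
  assumes "a < 2 * m + 1"
  shows "sympl_form m (unit_vec (2 * m + 1) a) x =
    (if a < m then x $ (m + a) else if a < 2 * m then - x $ (a - m) else 0)"
  by (subst sympl_form_swap) (simp add: sympl_form_unit_right assms del: One_nat_def)

lemma heisenberg_current_bracket_elem_right:
  assumes "s \<le> k"
  shows "lie_bracket (heisenberg_current m k) x (hc_elem m b j) s =
    (if j \<le> s then sympl_form m (x (s - j)) (unit_vec (2 * m + 1) b) else 0) \<cdot>\<^sub>v unit_vec (2 * m + 1) (2 * m)"
proof -
  have "(\<Sum>l\<le>s. sympl_form m (x l) (hc_elem m b j (s - l))) =
      (\<Sum>l\<le>s. if l = s - j then (if j \<le> s then sympl_form m (x l) (unit_vec (2 * m + 1) b) else 0) else 0)"
    by (intro sum.cong) (auto simp: hc_elem_def sympl_form_center(3) simp del: One_nat_def)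
  then show ?thesis
    using assms by (simp add: heisenberg_current_bracket)
qed

lemma heisenberg_current_bracket_elem_left:
  assumes "s \<le> k"
  shows "lie_bracket (heisenberg_current m k) (hc_elem m a i) y s =
    (if i \<le> s then sympl_form m (unit_vec (2 * m + 1) a) (y (s - i)) else 0) \<cdot>\<^sub>v unit_vec (2 * m + 1) (2 * m)"
proof -
  have "(\<Sum>l\<le>s. sympl_form m (hc_elem m a i l) (y (s - l))) =
      (\<Sum>l\<le>s. if l = i then sympl_form m (unit_vec (2 * m + 1) a) (y (s - l)) else 0)"
    by (intro sum.cong) (auto simp: hc_elem_def sympl_form_center(4) simp del: One_nat_def)
  then show ?thesis
    using assms by (simp add: heisenberg_current_bracket)
qed

text \<open>If \<open>i + j > k\<close>, the scalar is 0, and the second \<open>if\<close> only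
  picks an index that keeps \<open>hc_elem\<close> inside the carrier.\<close>

lemma heisenberg_current_bracket_elems:
  assumes "i \<le> k" "j \<le> k" "a < 2 * m + 1" "b < 2 * m + 1"
  shows "lie_bracket (heisenberg_current m k) (hc_elem m a i) (hc_elem m b j) =
    (if i + j \<le> k then sympl_form m (unit_vec (2 * m + 1) a) (unit_vec (2 * m + 1) b) else 0)
      \<odot>\<^bsub>heisenberg_current m k\<^esub> hc_elem m (2 * m) (if i + j \<le> k then i + j else 0)"
    (is "?l = ?r")
proof
  fix s
  show "?l s = ?r s"
  proof (cases "s \<le> k")
    case True
    have W: "sympl_form m (unit_vec (2 * m + 1) a) (hc_elem m b j (s - i)) =
        (if s - i = j then sympl_form m (unit_vec (2 * m + 1) a) (unit_vec (2 * m + 1) b) else 0)"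
      by (simp add: hc_elem_def sympl_form_center(3) del: One_nat_def add_Suc_right Suc_eq_plus1 add.right_neutral Nat.add_0_right)
    have "?l s = (if i \<le> s \<and> s - i = j then sympl_form m (unit_vec (2 * m + 1) a) (unit_vec (2 * m + 1) b)
        else 0) \<cdot>\<^sub>v unit_vec (2 * m + 1) (2 * m)"
      unfolding heisenberg_current_bracket_elem_left [OF True] W
      by (cases "i \<le> s"; cases "s - i = j") (simp_all only: if_True if_False simp_thms)
    also have "\<dots> = ?r s"
      using True by (auto simp: truncated_current_simps heisenberg_simps hc_elem_def)
    finally show ?thesis .
  qed (auto simp: heisenberg_current_bracket truncated_current_simps heisenberg_simps hc_elem_def)
qed

text \<open>Brackets are central, so the right side lives at \<open>c = 2 * m\<close> alone. Other
  values of \<open>c\<close> show that the center is preserved; \<open>c = 2 * m\<close> relates the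
  entries of the matrix to each other.\<close>

lemma derivation_eq:
  assumes \<rho>: "\<rho> \<in> derivations (heisenberg_current m k)"
    and "i \<le> k" "j \<le> k" "s \<le> k" "a < 2 * m + 1" "b < 2 * m + 1" "c < 2 * m + 1"
  shows "(if i + j \<le> k then sympl_form m (unit_vec (2 * m + 1) a) (unit_vec (2 * m + 1) b) *
      \<rho> (hc_elem m (2 * m) (i + j)) s $ c else 0) =
    (if c = 2 * m then
      (if j \<le> s then sympl_form m (\<rho> (hc_elem m a i) (s - j)) (unit_vec (2 * m + 1) b) else 0) +
      (if i \<le> s then sympl_form m (unit_vec (2 * m + 1) a) (\<rho> (hc_elem m b j) (s - i)) else 0) else 0)"
proof -
  let ?L = "heisenberg_current m k" and ?w = "sympl_form m (unit_vec (2 * m + 1) a) (unit_vec (2 * m + 1) b)"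
  define l where "l = (if i + j \<le> k then i + j else 0)"
  have l: "l \<le> k" by (simp add: l_def)
  note d = derivationsD [OF \<rho>]
  have E: "hc_elem m a i \<in> carrier ?L" "hc_elem m b j \<in> carrier ?L" "hc_elem m (2 * m) l \<in> carrier ?L"
    using assms l by (auto intro: hc_elem_carrier)
  have "\<rho> (hc_elem m (2 * m) l) s \<in> carrier_vec (2 * m + 1)"
    using d(1) [OF E(3)] assms(4) by (simp add: truncated_current_simps heisenberg_simps)
  then have "(if i + j \<le> k then ?w * \<rho> (hc_elem m (2 * m) (i + j)) s $ c else 0) =
      ((if i + j \<le> k then ?w else 0) \<odot>\<^bsub>?L\<^esub> \<rho> (hc_elem m (2 * m) l)) s $ c"
    using assms(7) by (auto simp: truncated_current_simps heisenberg_simps l_def)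
  also have "\<dots> = \<rho> (lie_bracket ?L (hc_elem m a i) (hc_elem m b j)) s $ c"
    unfolding heisenberg_current_bracket_elems [OF assms(2,3,5,6)] l_def [symmetric] d(3) [OF E(3)] by (rule refl)
  also have "\<dots> = (lie_bracket ?L (\<rho> (hc_elem m a i)) (hc_elem m b j) s +
      lie_bracket ?L (hc_elem m a i) (\<rho> (hc_elem m b j)) s) $ c"
    unfolding d(4) [OF E(1,2)] by (simp add: truncated_current_simps heisenberg_simps)
  finally show ?thesis
    using assms(7)
    unfolding heisenberg_current_bracket_elem_left [OF assms(4)] heisenberg_current_bracket_elem_right [OF assms(4)]
    by simp
qed

text \<open>The number \<open>\<mu> a s c i\<close> is the coordinate at \<open>x\<^sub>a t\<^sup>s\<close> of the image of \<open>x\<^sub>c t\<^sup>i\<close>, where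
  \<open>x\<^sub>0, \<dots>, x\<^bsub>2m\<^esub>\<close> is the basis \<open>e\<^sub>1, \<dots>, e\<^sub>m, f\<^sub>1, \<dots>, f\<^sub>m, z\<close>.\<close>

locale hc_derivation_entries =
  fixes m k :: nat and \<mu> :: "nat \<Rightarrow> nat \<Rightarrow> nat \<Rightarrow> nat \<Rightarrow> complex"
  assumes k_pos: "0 < k" and m_pos: "0 < m"
  and center_out: "\<And>c s i. c < 2 * m \<Longrightarrow> s \<le> k \<Longrightarrow> i \<le> k \<Longrightarrow> \<mu> c s (2 * m) i = 0"
  and eq_ee: "\<And>a b i j s. a < m \<Longrightarrow> b < m \<Longrightarrow> i \<le> k \<Longrightarrow> j \<le> k \<Longrightarrow> s \<le> k \<Longrightarrow>
    (if j \<le> s then \<mu> (m + b) (s - j) a i else 0) = (if i \<le> s then \<mu> (m + a) (s - i) b j else 0)"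
  and eq_ff: "\<And>a b i j s. a < m \<Longrightarrow> b < m \<Longrightarrow> i \<le> k \<Longrightarrow> j \<le> k \<Longrightarrow> s \<le> k \<Longrightarrow>
    (if j \<le> s then \<mu> b (s - j) (m + a) i else 0) = (if i \<le> s then \<mu> a (s - i) (m + b) j else 0)"
  and eq_ef: "\<And>a b i j s. a < m \<Longrightarrow> b < m \<Longrightarrow> i \<le> k \<Longrightarrow> j \<le> k \<Longrightarrow> s \<le> k \<Longrightarrow>
    (if a = b \<and> i + j \<le> k then \<mu> (2 * m) s (2 * m) (i + j) else 0) =
    (if j \<le> s then \<mu> b (s - j) a i else 0) + (if i \<le> s then \<mu> (m + a) (s - i) (m + b) j else 0)"

lemma hc_derivation_entries:
  assumes "0 < k" "0 < m" and \<rho>: "\<rho> \<in> derivations (heisenberg_current m k)"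
  shows "hc_derivation_entries m k (\<lambda>a s c i. \<rho> (hc_elem m c i) s $ a)"
proof
  note eq = derivation_eq [OF \<rho>]
  note U = sympl_form_unit_left sympl_form_unit_right
  show "\<rho> (hc_elem m (2 * m) i) s $ c = 0" if "c < 2 * m" "s \<le> k" "i \<le> k" for c s i
    \<comment> \<open>Since z t^i is the bracket of e_0 t^i and f_0, its image is a sum of brackets,
      hence central; such a pair exists because \<open>0 < m\<close>.\<close>
    using eq [of i 0 s 0 m c] that \<open>0 < m\<close> by (simp add: U del: One_nat_def)
  fix a b i j s assume h: "a < m" "b < m" "i \<le> k" "j \<le> k" "s \<le> k"
  show "(if j \<le> s then \<rho> (hc_elem m a i) (s - j) $ (m + b) else 0) =
      (if i \<le> s then \<rho> (hc_elem m b j) (s - i) $ (m + a) else 0)"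
    using eq [of i j s a b "2 * m"] h by (simp add: U del: One_nat_def split: if_splits)
  show "(if j \<le> s then \<rho> (hc_elem m (m + a) i) (s - j) $ b else 0) =
      (if i \<le> s then \<rho> (hc_elem m (m + b) j) (s - i) $ a else 0)"
    using eq [of i j s "m + a" "m + b" "2 * m"] h by (simp add: U del: One_nat_def split: if_splits)
  show "(if a = b \<and> i + j \<le> k then \<rho> (hc_elem m (2 * m) (i + j)) s $ (2 * m) else 0) =
    (if j \<le> s then \<rho> (hc_elem m a i) (s - j) $ b else 0) +
    (if i \<le> s then \<rho> (hc_elem m (m + b) j) (s - i) $ (m + a) else 0)"
    using eq [of i j s a "m + b" "2 * m"] h by (simp add: U del: One_nat_def split: if_splits)
qed (use assms in auto)

context hc_derivation_entries
begin

definition center_entry :: "nat \<Rightarrow> nat \<Rightarrow> complex" where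
  "center_entry s i = \<mu> (2 * m) s (2 * m) i"

text \<open>For \<open>n \<ge> 1\<close> this is the coefficient of t^n in delta(t) - t delta(1),
  that is, in q. At 0 the truncated subtraction gives a meaningless value; below, the argument is
  always \<open>s - i + 1\<close>.\<close>

definition vector_field :: "nat \<Rightarrow> complex" where
  "vector_field n = center_entry n 1 - center_entry (n - 1) 0"

text \<open>The relations for pairs of degree 0: at each degree \<open>s\<close>, the image of t^0
  is given by a symplectic matrix plus half of \<open>center_entry s 0\<close> times the
  identity.\<close>

lemma sp_relations:
  assumes "a < m" "b < m" "s \<le> k"
  shows "\<mu> (m + a) s (m + b) 0 = (if a = b then center_entry s 0 else 0) - \<mu> b s a 0"
    and "\<mu> (m + a) s b 0 = \<mu> (m + b) s a 0"
    and "\<mu> a s (m + b) 0 = \<mu> b s (m + a) 0"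
  using eq_ef [of a b 0 0 s] eq_ee [of a b 0 0 s] eq_ff [of a b 0 0 s] assms
  by (auto simp: center_entry_def algebra_simps eq_neg_iff_add_eq_0)

text \<open>Subtracting from \<open>\<delta>\<close>, the action on the center, the multiplication by \<open>\<delta>(1)\<close> leaves a
  derivation of the truncated polynomial ring.\<close>

definition center_defect :: "nat \<Rightarrow> nat \<Rightarrow> complex" where
  "center_defect s i = center_entry s i - (if i \<le> s then center_entry (s - i) 0 else 0)"

text \<open>Let A and F be the diagonal actions on e_0 and f_0, so delta(ab) = A(a) b + a F(b).
  Setting b = 1 gives A(a) = delta(a) - a F(1), setting a = 1 gives F(b) = delta(b) - b A(1). Since
  A(1) + F(1) = delta(1), both can be eliminated.\<close>

lemma center_defect_leibniz:
  assumes "i \<le> k" "j \<le> k" "s \<le> k"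
  shows "(if i + j \<le> k then center_defect s (i + j) else 0) =
    (if j \<le> s then center_defect (s - j) i else 0) + (if i \<le> s then center_defect (s - i) j else 0)"
proof -
  have \<alpha>: "\<mu> 0 t 0 l = center_entry t l - (if l \<le> t then \<mu> m (t - l) m 0 else 0)" if "t \<le> k" "l \<le> k" for t l
    using eq_ef [of 0 0 l 0 t] that m_pos by (simp add: center_entry_def)
  have \<zeta>: "\<mu> m t m l = center_entry t l - (if l \<le> t then \<mu> 0 (t - l) 0 0 else 0)" if "t \<le> k" "l \<le> k" for t l
    using eq_ef [of 0 0 0 l t] that m_pos by (simp add: center_entry_def)
  have "(if i + j \<le> k then center_entry s (i + j) else 0) =
      (if j \<le> s then \<mu> 0 (s - j) 0 i else 0) + (if i \<le> s then \<mu> m (s - i) m j else 0)"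
    using eq_ef [OF m_pos m_pos assms] unfolding center_entry_def by (simp only: simp_thms add_0_right)
  moreover have "\<mu> 0 (s - i - j) 0 0 + \<mu> m (s - i - j) m 0 = center_entry (s - i - j) 0"
    using \<alpha> [of "s - i - j" 0] assms by simp
  moreover have "\<mu> 0 (s - j) 0 i = center_entry (s - j) i - (if i + j \<le> s then \<mu> m (s - i - j) m 0 else 0)"
    if "j \<le> s"
    using \<alpha> [of "s - j" i] that assms by (simp add: le_diff_conv2 add.commute)
  moreover have "\<mu> m (s - i) m j = center_entry (s - i) j - (if i + j \<le> s then \<mu> 0 (s - i - j) 0 0 else 0)"
    if "i \<le> s"
    using \<zeta> [of "s - i" j] that assms by (simp add: le_diff_conv2 add.commute)
  ultimately show ?thesis
    using assms unfolding center_defect_def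
    by (cases "i \<le> s"; cases "j \<le> s"; cases "i + j \<le> s"; cases "i + j \<le> k")
      (simp_all add: le_diff_conv2 algebra_simps)
qed

text \<open>A derivation of polynomials satisfies D(t^i) = i t^(i-1) D(t). The bound
  \<open>i \<le> s + 1\<close> still admits the constant term of D(t), which is not yet known to
  vanish.\<close>

lemma center_defect_eq_mult:
  assumes "1 \<le> i" "i \<le> k" "s \<le> k"
  shows "center_defect s i = (if i \<le> s + 1 then of_nat i * center_defect (s + 1 - i) 1 else 0)"
  using assms
proof (induction i arbitrary: s rule: dec_induct)
  case (step i)
  then have "center_defect s (Suc i) = (if 1 \<le> s then center_defect (s - 1) i else 0) +
      (if i \<le> s then center_defect (s - i) 1 else 0)"
    using center_defect_leibniz [of i 1 s] by simp
  also have "(if 1 \<le> s then center_defect (s - 1) i else 0) =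
      (if i \<le> s then of_nat i * center_defect (s - i) 1 else 0)"
    using step.IH [of "s - 1"] step.prems step.hyps by auto
  finally show ?case
    by (simp add: algebra_simps)
qed simp

text \<open>The relation \<open>t ^ (k + 1) = 0\<close> forces the vector field to vanish at the origin.\<close>

lemma center_defect_0_1: "center_defect 0 1 = 0"
proof -
  \<comment> \<open>The coefficient of t^k in the Leibniz rule for the product of t^k and t, which
    is zero; the first summand is \<open>k\<close> times the second.\<close>
  have "0 = center_defect (k - 1) k + center_defect 0 1"
    using center_defect_leibniz [of k 1 k] k_pos by simp
  also have "\<dots> = of_nat (k + 1) * center_defect 0 1"
    using center_defect_eq_mult [of k "k - 1"] k_pos by (simp add: algebra_simps)
  finally show ?thesis
    by (simp del: of_nat_Suc of_nat_add)
qed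

lemma center_defect_eq:
  assumes "i \<le> k" "s \<le> k"
  shows "center_defect s i = (if 1 \<le> i \<and> i \<le> s then of_nat i * vector_field (s - i + 1) else 0)"
proof (cases "i = 0")
  case True
  then show ?thesis by (simp add: center_defect_def)
next
  case False
  then have *: "center_defect s i = (if i \<le> s + 1 then of_nat i * center_defect (s + 1 - i) 1 else 0)"
    using assms by (intro center_defect_eq_mult) auto
  have "center_defect (s + 1 - i) 1 = vector_field (s - i + 1)" if "i \<le> s"
    using that by (simp add: center_defect_def vector_field_def Suc_diff_le)
  moreover have "center_defect (s + 1 - i) 1 = 0" if "i = s + 1"
    using that center_defect_0_1 by simp
  ultimately show ?thesis
    unfolding * using False by (auto simp: le_Suc_eq)
qed

lemma center_entry_eq:
  assumes "i \<le> k" "s \<le> k"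
  shows "center_entry s i = (if i \<le> s then center_entry (s - i) 0 else 0) +
    (if 1 \<le> i \<and> i \<le> s then of_nat i * vector_field (s - i + 1) else 0)"
  using center_defect_eq [OF assms] by (simp add: center_defect_def algebra_simps split: if_splits)

text \<open>Pairing x_c t^i with a vector of degree 0 expresses column \<open>i\<close> through the
  center and the columns of degree 0. Outside the vector field the map is thus linear over the
  truncated polynomials, which is the Toeplitz property.\<close>

lemma entry_eq:
  assumes "a < 2 * m" "c < 2 * m" "i \<le> k" "s \<le> k"
  shows "\<mu> a s c i = (if i \<le> s then \<mu> a (s - i) c 0 else 0) +
    (if a = c \<and> 1 \<le> i \<and> i \<le> s then of_nat i * vector_field (s - i + 1) else 0)"
proof -
  define P where "P a c \<longleftrightarrow> \<mu> a s c i = (if i \<le> s then \<mu> a (s - i) c 0 else 0) +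
    (if a = c \<and> 1 \<le> i \<and> i \<le> s then of_nat i * vector_field (s - i + 1) else 0)" for a c
  have ee: "P (m + b) a" and ff: "P a (m + b)" if "a < m" "b < m" for a b
    using eq_ee [of a b i 0 s] eq_ff [of b a i 0 s] sp_relations(2,3) [of b a "s - i"]
      sp_relations(3) [of a b "s - i"] that assms
    by (auto simp: P_def)
  have ef: "P b a" and fe: "P (m + a) (m + b)" if "a < m" "b < m" for a b
  proof -
    have "(if a = b then center_entry s i else 0) =
        \<mu> b s a i + (if i \<le> s then \<mu> (m + a) (s - i) (m + b) 0 else 0)"
      using eq_ef [of a b i 0 s] that assms by (cases "a = b"; cases "i \<le> s") (simp_all add: center_entry_def)
    then have "\<mu> b s a i = (if a = b then ((if i \<le> s then center_entry (s - i) 0 else 0) +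
        (if 1 \<le> i \<and> i \<le> s then of_nat i * vector_field (s - i + 1) else 0)) else 0) -
        (if i \<le> s then \<mu> (m + a) (s - i) (m + b) 0 else 0)"
      by (simp only: add_diff_cancel_right' flip: center_entry_eq [OF assms(3,4)])
    then show "P b a"
      using that assms sp_relations(1) [of a b "s - i"] by (cases "a = b"; cases "i \<le> s") (simp_all add: P_def)
    have "(if a = b then center_entry s i else 0) =
        (if i \<le> s then \<mu> b (s - i) a 0 else 0) + \<mu> (m + a) s (m + b) i"
      using eq_ef [of a b 0 i s] that assms by (cases "a = b"; cases "i \<le> s") (simp_all add: center_entry_def)
    then have "\<mu> (m + a) s (m + b) i = (if a = b then ((if i \<le> s then center_entry (s - i) 0 else 0) +
        (if 1 \<le> i \<and> i \<le> s then of_nat i * vector_field (s - i + 1) else 0)) else 0) -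
        (if i \<le> s then \<mu> b (s - i) a 0 else 0)"
      by (simp only: add_diff_cancel_left' flip: center_entry_eq [OF assms(3,4)])
    then show "P (m + a) (m + b)"
      using that assms sp_relations(1) [of a b "s - i"] by (cases "a = b"; cases "i \<le> s") (simp_all add: P_def)
  qed
  have "P a c"
  proof (cases "a < m"; cases "c < m")
    assume "\<not> a < m" "c < m"
    then show ?thesis using ee [of c "a - m"] assms by simp
  next
    assume "a < m" "\<not> c < m"
    then show ?thesis using ff [of a "c - m"] assms by simp
  next
    assume "\<not> a < m" "\<not> c < m"
    then show ?thesis using fe [of "a - m" "c - m"] assms by simp
  qed (rule ef)
  then show ?thesis by (simp only: P_def)
qed

end

section \<open>Solvable ideals and the symplectic algebra\<close>

lemma carrier_sp:
  "carrier (sp m) = {four_block_mat X1 X2 X3 X4 | X1 X2 X3 X4.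
      X1 \<in> carrier_mat m m \<and> X2 \<in> carrier_mat m m \<and> X3 \<in> carrier_mat m m \<and>
      X4 = - transpose_mat X1 \<and> X2 = transpose_mat X2 \<and> X3 = transpose_mat X3}"
  by (simp add: sp_def)

lemma carrier_sp_iff:
  "X \<in> carrier (sp m) \<longleftrightarrow> X \<in> carrier_mat (2 * m) (2 * m) \<and>
    (\<forall>i<m. \<forall>j<m. X $$ (m + i, m + j) = - X $$ (j, i) \<and> X $$ (i, m + j) = X $$ (j, m + i) \<and>
      X $$ (m + i, j) = X $$ (m + j, i))"
    (is "?l \<longleftrightarrow> ?r")
proof
  assume ?l
  then obtain X1 X2 X3 where X: "X1 \<in> carrier_mat m m" "X2 \<in> carrier_mat m m" "X3 \<in> carrier_mat m m"
    "X = four_block_mat X1 X2 X3 (- transpose_mat X1)"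
    and sym: "X2 = transpose_mat X2" "X3 = transpose_mat X3"
    unfolding carrier_sp by blast
  have "X2 $$ (i, j) = X2 $$ (j, i)" "X3 $$ (i, j) = X3 $$ (j, i)" if "i < m" "j < m" for i j
    using arg_cong [OF sym(1), of "\<lambda>A. A $$ (i, j)"] arg_cong [OF sym(2), of "\<lambda>A. A $$ (i, j)"] that X(1-3)
    by simp_all
  then show ?r
    using X(1-3) unfolding X(4) by (auto simp: mult_2)
next
  assume r: ?r
  define X1 where "X1 = mat m m (\<lambda>(i, j). X $$ (i, j))"
  define X2 where "X2 = mat m m (\<lambda>(i, j). X $$ (i, m + j))"
  define X3 where "X3 = mat m m (\<lambda>(i, j). X $$ (m + i, j))"
  have eq: "X = four_block_mat X1 X2 X3 (- transpose_mat X1)"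
  proof (rule eq_matI)
    fix a b assume "a < dim_row (four_block_mat X1 X2 X3 (- transpose_mat X1))"
      "b < dim_col (four_block_mat X1 X2 X3 (- transpose_mat X1))"
    then have ab: "a < 2 * m" "b < 2 * m" by (auto simp: X1_def)
    obtain i where i: "i < m" "a = i \<or> a = m + i"
      using ab by (intro that [of "if a < m then a else a - m"]) auto
    obtain j where j: "j < m" "b = j \<or> b = m + j"
      using ab by (intro that [of "if b < m then b else b - m"]) auto
    show "X $$ (a, b) = four_block_mat X1 X2 X3 (- transpose_mat X1) $$ (a, b)"
      using r i j by (auto simp: X1_def X2_def X3_def)
  qed (use r in \<open>auto simp: X1_def\<close>)
  have sym: "X2 = transpose_mat X2" "X3 = transpose_mat X3"
    using r by (auto simp: X2_def X3_def)
  have "X1 \<in> carrier_mat m m" "X2 \<in> carrier_mat m m" "X3 \<in> carrier_mat m m"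
    by (auto simp: X1_def X2_def X3_def)
  then show ?l
    unfolding carrier_sp mem_Collect_eq
    by (intro exI conjI) (rule eq refl sym | assumption)+
qed

text \<open>The rank one map sending \<open>x\<close> to \<open>\<omega>(w, x) u\<close>.\<close>

definition outer :: "nat \<Rightarrow> complex vec \<Rightarrow> complex vec \<Rightarrow> complex mat" where
  "outer m u w = mat (2 * m) (2 * m) (\<lambda>(a, c). u $ a * (if c < m then - w $ (m + c) else w $ (c - m)))"

lemma outer_carrier [simp]: "outer m u w \<in> carrier_mat (2 * m) (2 * m)"
  by (simp add: outer_def)

lemma sum_double: "(\<Sum>d<2 * m. f d) = (\<Sum>d<m. f d + f (m + d))" for f :: "nat \<Rightarrow> 'a::comm_monoid_add"
proof -
  have "(\<Sum>d<2 * m. f d) = (\<Sum>d<m. f d) + sum f {m..<m + m}"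
    by (simp add: atLeast0LessThan [symmetric] sum.atLeastLessThan_concat mult_2)
  also have "sum f {m..<m + m} = (\<Sum>d<m. f (m + d))"
    by (rule sum.reindex_bij_witness [of _ "\<lambda>i. m + i" "\<lambda>n. n - m"]) auto
  finally show ?thesis by (simp add: sum.distrib)
qed

lemma mult_outer:
  assumes "X \<in> carrier_mat (2 * m) (2 * m)" "u \<in> carrier_vec (2 * m)"
  shows "X * outer m u w = outer m (X *\<^sub>v u) w"
  using assms by (intro eq_matI) (auto simp: outer_def scalar_prod_def sum_distrib_right mult.assoc)

text \<open>Elements of \<open>sp m\<close> are skew for the form: \<omega>(w, X x) = - \<omega>(X
  w, x).\<close>

lemma outer_mult:
  assumes "X \<in> carrier (sp m)" "w \<in> carrier_vec (2 * m)"
  shows "outer m u w * X = - outer m u (X *\<^sub>v w)"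
proof (rule eq_matI)
  have X: "X \<in> carrier_mat (2 * m) (2 * m)" and
    rel: "X $$ (m + i, m + j) = - X $$ (j, i)" "X $$ (i, m + j) = X $$ (j, m + i)"
      "X $$ (m + i, j) = X $$ (m + j, i)" if "i < m" "j < m" for i j
    using assms(1) that by (auto simp: carrier_sp_iff)
  fix a c assume "a < dim_row (- outer m u (X *\<^sub>v w))" "c < dim_col (- outer m u (X *\<^sub>v w))"
  then have ac: "a < 2 * m" "c < 2 * m" by (auto simp: outer_def)
  have m: "0 < m" using ac by simp
  have Xw: "(X *\<^sub>v w) $ r = (\<Sum>d<m. X $$ (r, d) * w $ d + X $$ (r, m + d) * w $ (m + d))" if "r < 2 * m" for r
    using that assms(2) X [OF m m]
    by (auto simp: scalar_prod_def atLeast0LessThan sum_double)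
  have "(outer m u w * X) $$ (a, c) = u $ a * (\<Sum>d<m. w $ d * X $$ (m + d, c) - w $ (m + d) * X $$ (d, c))"
    using ac X [OF m m]
    by (simp add: outer_def scalar_prod_def atLeast0LessThan sum_double)
      (simp add: sum_distrib_left algebra_simps)
  also have "(\<Sum>d<m. w $ d * X $$ (m + d, c) - w $ (m + d) * X $$ (d, c)) =
      - (if c < m then - (X *\<^sub>v w) $ (m + c) else (X *\<^sub>v w) $ (c - m))"
  proof (cases "c < m")
    case True
    then show ?thesis
      by (auto simp: Xw rel(1) [of c] rel(3) [of c] intro!: sum.cong)
  next
    case False
    then have "c - m < m" "m + (c - m) = c" using ac by auto
    then show ?thesis
      using rel(1) [of _ "c - m"] rel(2) [of _ "c - m"] False
      by (simp add: Xw sum.distrib sum_subtractf sum_negf mult.commute)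
  qed
  also have "u $ a * \<dots> = (- outer m u (X *\<^sub>v w)) $$ (a, c)"
    using ac by (simp add: outer_def)
  finally show "(outer m u w * X) $$ (a, c) = (- outer m u (X *\<^sub>v w)) $$ (a, c)" .
qed (use assms in \<open>auto simp: outer_def carrier_sp_iff\<close>)

text \<open>The image of the product u w under the isomorphism of the symmetric square of the
  defining representation with the adjoint one.\<close>

definition sym_outer :: "nat \<Rightarrow> complex vec \<Rightarrow> complex vec \<Rightarrow> complex mat" where
  "sym_outer m u w = outer m u w + outer m w u"

lemma sym_outer_carrier [simp]: "sym_outer m u w \<in> carrier_mat (2 * m) (2 * m)"
  by (simp add: sym_outer_def)

lemma sym_outer_sp: "sym_outer m u w \<in> carrier (sp m)"
  by (auto simp: carrier_sp_iff sym_outer_def) (auto simp: outer_def)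

lemma sym_outer_commute: "sym_outer m u w = sym_outer m w u"
  by (simp add: sym_outer_def comm_add_mat [of _ "2 * m" "2 * m"])

lemma sym_outer_smult:
  assumes "u \<in> carrier_vec (2 * m)"
  shows "sym_outer m (c \<cdot>\<^sub>v u) w = c \<cdot>\<^sub>m sym_outer m u w" "sym_outer m w (c \<cdot>\<^sub>v u) = c \<cdot>\<^sub>m sym_outer m w u"
  using assms by (auto simp: sym_outer_def outer_def algebra_simps intro!: eq_matI)

lemma sym_outer_mult_vec:
  assumes "u \<in> carrier_vec (2 * m)" "w \<in> carrier_vec (2 * m)" "x \<in> carrier_vec (2 * m)"
  shows "sym_outer m u w *\<^sub>v x = sympl_form m w x \<cdot>\<^sub>v u + sympl_form m u x \<cdot>\<^sub>v w"
proof -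
  have outer: "outer m u w *\<^sub>v x = sympl_form m w x \<cdot>\<^sub>v u"
    if "u \<in> carrier_vec (2 * m)" for u w
    using that assms(3)
    by (intro eq_vecI) (simp_all add: outer_def scalar_prod_def atLeast0LessThan sum_double sympl_form_def,
      simp add: sum_distrib_left algebra_simps)
  show ?thesis
    using assms unfolding sym_outer_def
    by (subst add_mult_distrib_mat_vec [of _ "2 * m" "2 * m"]) (auto simp: outer)
qed

text \<open>The adjoint action becomes the derivation action on the symmetric square, so brackets
  below reduce to matrix times vector.\<close>

lemma commutator_sym_outer:
  assumes "X \<in> carrier (sp m)" "u \<in> carrier_vec (2 * m)" "w \<in> carrier_vec (2 * m)"
  shows "X * sym_outer m u w - sym_outer m u w * X = sym_outer m (X *\<^sub>v u) w + sym_outer m u (X *\<^sub>v w)"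
proof -
  have X: "X \<in> carrier_mat (2 * m) (2 * m)" using assms(1) by (simp add: carrier_sp_iff)
  have "X * sym_outer m u w = outer m (X *\<^sub>v u) w + outer m (X *\<^sub>v w) u"
    using X assms by (simp add: sym_outer_def mult_add_distrib_mat [OF X outer_carrier outer_carrier] mult_outer)
  moreover have "sym_outer m u w * X = - outer m u (X *\<^sub>v w) + - outer m w (X *\<^sub>v u)"
    using X assms by (simp add: sym_outer_def add_mult_distrib_mat [OF outer_carrier outer_carrier X] outer_mult)
  ultimately show ?thesis
    by (simp add: sym_outer_def) (auto intro!: eq_matI simp: outer_def)
qed

lemma sympl_form_self [simp]: "sympl_form m v v = 0"
  by (simp add: sympl_form_def mult.commute)

text \<open>For \<open>X\<close> in \<open>sp m\<close> the bilinear form \<omega>(x, X y) is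
  symmetric, and it is nonzero with \<open>X\<close>; by polarization so is its quadratic
  form.\<close>

lemma sp_quadratic_form_nonzero:
  assumes X: "X \<in> carrier (sp m)" and "X \<noteq> 0\<^sub>m (2 * m) (2 * m)"
  obtains v where "v \<in> carrier_vec (2 * m)" "sympl_form m v (X *\<^sub>v v) \<noteq> 0"
proof -
  have Xc: "X \<in> carrier_mat (2 * m) (2 * m)" using X by (simp add: carrier_sp_iff)
  let ?e = "unit_vec (2 * m) :: nat \<Rightarrow> complex vec"
  define g where "g a b = sympl_form m (?e a) (X *\<^sub>v ?e b)" for a b
  have Xe: "(X *\<^sub>v ?e b) $ a = X $$ (a, b)" if "a < 2 * m" "b < 2 * m" for a b
    using that Xc by auto
  have form: "sympl_form m (?e a) y = (if a < m then y $ (m + a) else - y $ (a - m))" if "a < 2 * m" for a y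
  proof -
    have "sympl_form m (?e a) y =
        (\<Sum>i<m. if i = a then y $ (m + i) else 0) - (\<Sum>i<m. if i = a - m then if m \<le> a then y $ i else 0 else 0)"
      using that unfolding sympl_form_def sum_subtractf
      by (intro arg_cong2 [of _ _ _ _ "(-)"] sum.cong) auto
    then show ?thesis using that by (simp only: sum.delta' sum.delta finite_lessThan) auto
  qed
  have g: "g a b = (if a < m then X $$ (m + a, b) else - X $$ (a - m, b))" if "a < 2 * m" "b < 2 * m" for a b
    using that by (simp add: g_def form Xe)
  have sym: "g a b = g b a" if "a < 2 * m" "b < 2 * m" for a b
  proof -
    have rel: "X $$ (m + i, m + j) = - X $$ (j, i)" "X $$ (i, m + j) = X $$ (j, m + i)"
      "X $$ (m + i, j) = X $$ (m + j, i)" if "i < m" "j < m" for i j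
      using X that by (auto simp: carrier_sp_iff)
    show ?thesis
      using that rel(3) [of a b] rel(1) [of a "b - m"] rel(1) [of b "a - m"] rel(2) [of "a - m" "b - m"]
      by (auto simp: g)
  qed
  obtain r b where rb: "r < 2 * m" "b < 2 * m" "X $$ (r, b) \<noteq> 0"
    using assms(2) Xc by (metis carrier_matD eq_matI index_zero_mat)
  \<comment> \<open>\<open>a\<close> is the index paired with \<open>r\<close> by the form, so that
    \<open>g a b\<close> is the nonzero entry of \<open>X\<close> up to sign.\<close>
  define a where "a = (if r < m then m + r else r - m)"
  have a: "a < 2 * m" and gab: "g a b \<noteq> 0"
    using rb by (auto simp: a_def g)
  have "sympl_form m (?e a + ?e b) (X *\<^sub>v (?e a + ?e b)) = g a a + g a b + (g b a + g b b)"
    using a rb Xc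
    by (simp add: mult_add_distrib_mat_vec [of X "2 * m" "2 * m"] g_def
        sympl_form_add_left [of _ "2 * m"] sympl_form_add_right [of _ "2 * m"])
  then have "sympl_form m (?e a + ?e b) (X *\<^sub>v (?e a + ?e b)) = g a a + g b b + 2 * g a b"
    using sym [OF a rb(2)] by simp
  \<comment> \<open>The three values differ by \<open>2 * g a b\<close>, so they cannot all
    vanish.\<close>
  then consider "g a a \<noteq> 0" | "g b b \<noteq> 0" | "sympl_form m (?e a + ?e b) (X *\<^sub>v (?e a + ?e b)) \<noteq> 0"
    using gab by fastforce
  then show ?thesis
    using that [of "?e a"] that [of "?e b"] that [of "?e a + ?e b"]
    by cases (simp_all only: g_def unit_vec_carrier add_carrier_vec simp_thms)
qed

section \<open>Derived algebras of matrix Lie algebras\<close>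

lemma
  assumes "lin_closed n T" "U \<subseteq> T" and "\<And>A B. A \<in> U \<Longrightarrow> B \<in> U \<Longrightarrow> A * B - B * A \<in> T"
  shows lie_derived_mem:
      "A \<in> U \<Longrightarrow> B \<in> U \<Longrightarrow> c \<cdot>\<^sub>m (A * B - B * A) \<in> lie_derived ((gl n)\<lparr>carrier := T\<rparr>) U"
    and lie_derived_lin_closed: "lin_closed n (lie_derived ((gl n)\<lparr>carrier := T\<rparr>) U)"
    and lie_derived_subset: "lin_closed n W \<Longrightarrow> W \<subseteq> T \<Longrightarrow>
      (\<And>A B. A \<in> U \<Longrightarrow> B \<in> U \<Longrightarrow> A * B - B * A \<in> W) \<Longrightarrow> lie_derived ((gl n)\<lparr>carrier := T\<rparr>) U \<subseteq> W"
proof -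
  let ?L = "(gl n)\<lparr>carrier := T\<rparr>" and ?B = "{A * B - B * A | A B. A \<in> U \<and> B \<in> U}"
  have vs: "vectorspace class_ring ?L" by (rule vectorspace_gl_sub [OF assms(1)])
  interpret V: Module.module class_ring ?L using vs by (simp add: vectorspace_def)
  have B: "?B \<subseteq> carrier ?L" using assms(3) by auto
  have d: "lie_derived ?L U = V.span ?B"
    by (simp add: lie_derived_def gl_simps)
  have sub: "subspace class_ring (V.span ?B) ?L"
    using V.span_is_submodule [OF B] vs by (simp add: subspace_def)
  then show lc: "lin_closed n (lie_derived ?L U)"
    using subspace_gl_sub [OF assms(1)] d by simp
  show "c \<cdot>\<^sub>m (A * B - B * A) \<in> lie_derived ?L U" if "A \<in> U" "B \<in> U"
  proof -
    have "A * B - B * A \<in> V.span ?B"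
      using V.in_own_span [OF B] that by blast
    then show ?thesis using lc unfolding d lin_closed_def by blast
  qed
  show "lie_derived ?L U \<subseteq> W" if W: "lin_closed n W" "W \<subseteq> T" "\<And>A B. A \<in> U \<Longrightarrow> B \<in> U \<Longrightarrow> A * B - B * A \<in> W"
  proof -
    have "submodule class_ring W ?L"
      using W subspace_gl_sub [OF assms(1), of W] by (simp add: subspace_def)
    then show ?thesis
      unfolding d using W(3) by (intro V.span_is_subset) auto
  qed
qed

lemma smult_smult_mat: "a \<cdot>\<^sub>m (b \<cdot>\<^sub>m A) = (a * b) \<cdot>\<^sub>m A" for A :: "'a::semigroup_mult mat"
  by (intro eq_matI) (auto simp: mult.assoc)

lemma one_smult_mat [simp]: "1 \<cdot>\<^sub>m A = A" for A :: "'a::monoid_mult mat"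
  by (intro eq_matI) auto

text \<open>Kept abstract because it is interpreted at two algebras: all derivations, and, inside
  \<open>levi_factor_section\<close>, the image of the section with the same
  \<open>\<pi>\<close>.\<close>

locale sp_projection =
  fixes n m :: nat and T :: "complex mat set" and \<pi> :: "complex mat \<Rightarrow> complex mat"
  assumes lin_closed: "lin_closed n T"
    and bracket_closed: "A \<in> T \<Longrightarrow> B \<in> T \<Longrightarrow> A * B - B * A \<in> T"
    and proj_sp: "A \<in> T \<Longrightarrow> \<pi> A \<in> carrier (sp m)"
    and proj_add: "A \<in> T \<Longrightarrow> B \<in> T \<Longrightarrow> \<pi> (A + B) = \<pi> A + \<pi> B"
    and proj_smult: "A \<in> T \<Longrightarrow> \<pi> (c \<cdot>\<^sub>m A) = c \<cdot>\<^sub>m \<pi> A"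
    and proj_bracket: "A \<in> T \<Longrightarrow> B \<in> T \<Longrightarrow> \<pi> (A * B - B * A) = \<pi> A * \<pi> B - \<pi> B * \<pi> A"
    and proj_surj: "X \<in> carrier (sp m) \<Longrightarrow> \<exists>A\<in>T. \<pi> A = X"
begin

definition lie :: "complex mat complex_lie" where
  "lie = (gl n)\<lparr>carrier := T\<rparr>"

lemma lie_simps:
  "carrier lie = T" "add lie = (+)" "zero lie = 0\<^sub>m n n"
  "smult lie = (\<cdot>\<^sub>m)" "lie_bracket lie = (\<lambda>A B. A * B - B * A)"
  by (auto simp: lie_def gl_simps)

lemma carrier_T: "A \<in> T \<Longrightarrow> A \<in> carrier_mat n n"
  using lin_closed by (auto simp: lin_closed_def)

lemma smult_T: "A \<in> T \<Longrightarrow> c \<cdot>\<^sub>m A \<in> T"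
  using lin_closed by (auto simp: lin_closed_def)

lemma proj_carrier: "A \<in> T \<Longrightarrow> \<pi> A \<in> carrier_mat (2 * m) (2 * m)"
  using proj_sp by (auto simp: carrier_sp_iff)

lemma proj_zero: "\<pi> (0\<^sub>m n n) = 0\<^sub>m (2 * m) (2 * m)"
proof -
  have 0: "0\<^sub>m n n \<in> T" using lin_closed by (simp add: lin_closed_def)
  have "0\<^sub>m n n = (0 :: complex) \<cdot>\<^sub>m 0\<^sub>m n n" by (intro eq_matI) auto
  then have "\<pi> (0\<^sub>m n n) = 0 \<cdot>\<^sub>m \<pi> (0\<^sub>m n n)"
    using proj_smult [OF 0, of 0] by metis
  also have "\<dots> = 0\<^sub>m (2 * m) (2 * m)"
    using proj_carrier [OF 0] by (intro eq_matI) auto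
  finally show ?thesis .
qed

text \<open>A nonzero element \<open>X\<close> of the symplectic algebra satisfies \<open>\<omega>(v, X v) \<noteq> 0\<close> for some \<open>v\<close>.
  Bracketing twice with \<open>E = sym_outer v v\<close> sends \<open>X\<close> to a nonzero multiple of \<open>E\<close>, so an ideal
  that meets the preimage of \<open>X\<close> contains lifts of an \<open>sl\<^sub>2\<close>-triple. Such lifts persist in every
  term of the derived series.\<close>

lemma solvable_ideal_proj_zero:
  assumes I: "lie_ideal lie I" and solv: "lie_solvable lie I" and A: "A \<in> I"
  shows "\<pi> A = 0\<^sub>m (2 * m) (2 * m)"
proof (rule ccontr)
  assume nz: "\<pi> A \<noteq> 0\<^sub>m (2 * m) (2 * m)"
  have IT: "lin_closed n I" "I \<subseteq> T" and ideal: "\<And>B C. B \<in> T \<Longrightarrow> C \<in> I \<Longrightarrow> B * C - C * B \<in> I"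
    using I subspace_gl_sub [OF lin_closed] by (auto simp: lie_ideal_def lie_simps lie_def [symmetric])
  have smultI: "c \<cdot>\<^sub>m B \<in> I" if "B \<in> I" for c B
    using IT that by (auto simp: lin_closed_def)
  define X where "X = \<pi> A"
  have X: "X \<in> carrier (sp m)" and Xc: "X \<in> carrier_mat (2 * m) (2 * m)"
    using A IT proj_sp proj_carrier by (auto simp: X_def)
  obtain v where v: "v \<in> carrier_vec (2 * m)" and q: "sympl_form m v (X *\<^sub>v v) \<noteq> 0"
    using sp_quadratic_form_nonzero [OF X] nz X_def by metis
  define \<kappa> where "\<kappa> = sympl_form m v (X *\<^sub>v v)"
  \<comment> \<open>The scaling gives \<omega>(v, w) = 1, so v and w span a hyperbolic plane, and E,
    F, H span the symplectic algebra of that plane.\<close>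
  define w where "w = (1 / \<kappa>) \<cdot>\<^sub>v (X *\<^sub>v v)"
  have w: "w \<in> carrier_vec (2 * m)" using v Xc by (simp add: w_def)
  have vw: "sympl_form m v w = 1"
    using q v Xc by (simp add: w_def \<kappa>_def sympl_form_smult_right [of _ "2 * m"])
  have wv: "sympl_form m w v = -1"
    using sympl_form_swap [of m w v] vw by simp
  define E F H where "E = sym_outer m v v" and "F = sym_outer m w w" and "H = sym_outer m v w"
  have sp: "E \<in> carrier (sp m)" "F \<in> carrier (sp m)" "H \<in> carrier (sp m)"
    by (auto simp: E_def F_def H_def sym_outer_sp)
  have car: "E \<in> carrier_mat (2 * m) (2 * m)" "F \<in> carrier_mat (2 * m) (2 * m)"
      "H \<in> carrier_mat (2 * m) (2 * m)"
    by (auto simp: E_def F_def H_def)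
  have Ev: "E *\<^sub>v v = 0 \<cdot>\<^sub>v v" and Ew: "E *\<^sub>v w = 2 \<cdot>\<^sub>v v"
    and EX: "E *\<^sub>v (X *\<^sub>v v) = (2 * \<kappa>) \<cdot>\<^sub>v v" and Fv: "F *\<^sub>v v = (-2) \<cdot>\<^sub>v w" and Fw: "F *\<^sub>v w = 0 \<cdot>\<^sub>v w"
    using v w Xc vw wv
    by (auto simp: E_def F_def sym_outer_mult_vec \<kappa>_def add_smult_distrib_vec [symmetric])
  \<comment> \<open>The three constants come from \<open>E w = 2 v\<close>, \<open>E v = 0\<close>
    and \<open>F v = -2 w\<close>, \<open>F w = 0\<close>; what matters later is that they are
    nonzero.\<close>
  have EH: "E * H - H * E = 2 \<cdot>\<^sub>m E"
    unfolding H_def commutator_sym_outer [OF sp(1) v w] Ev Ew sym_outer_smult [OF v]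
    using v w by (intro eq_matI) (auto simp: E_def sym_outer_def outer_def)
  have FH: "F * H - H * F = (-2) \<cdot>\<^sub>m F"
    unfolding H_def commutator_sym_outer [OF sp(2) v w] Fv Fw sym_outer_smult [OF w]
    using v w by (intro eq_matI) (auto simp: F_def sym_outer_def outer_def)
  have FE: "F * E - E * F = (-4) \<cdot>\<^sub>m H"
    unfolding E_def commutator_sym_outer [OF sp(2) v v] Fv sym_outer_smult [OF w]
      sym_outer_commute [of m w v]
    using v w by (intro eq_matI) (auto simp: H_def sym_outer_def outer_def)
  \<comment> \<open>The inner bracket is -2 times the product of v and X v. Since E kills v and
    sends X v to \<open>2 * \<kappa>\<close> times v, the outer bracket leaves
    \<open>-4 * \<kappa>\<close> times E.\<close>
  have EXE: "E * (E * X - X * E) - (E * X - X * E) * E = (-4 * \<kappa>) \<cdot>\<^sub>m E"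
  proof -
    have Xv: "X *\<^sub>v v \<in> carrier_vec (2 * m)" using Xc v by simp
    have "E * X - X * E = - (X * E - E * X)"
      using car(1) Xc by (intro eq_matI) auto
    also have "X * E - E * X = sym_outer m (X *\<^sub>v v) v + sym_outer m v (X *\<^sub>v v)"
      unfolding E_def by (rule commutator_sym_outer [OF X v v])
    also have "- \<dots> = (-2) \<cdot>\<^sub>m sym_outer m v (X *\<^sub>v v)"
      unfolding sym_outer_commute [of m "X *\<^sub>v v" v] by (intro eq_matI) auto
    finally have 1: "E * X - X * E = (-2) \<cdot>\<^sub>m sym_outer m v (X *\<^sub>v v)" .
    have smult_diff: "c \<cdot>\<^sub>m B - c \<cdot>\<^sub>m C = c \<cdot>\<^sub>m (B - C)"
      if "B \<in> carrier_mat (2 * m) (2 * m)" "C \<in> carrier_mat (2 * m) (2 * m)" for c and B C :: "complex mat"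
      using that by (intro eq_matI) (auto simp: right_diff_distrib)
    have "E * ((-2) \<cdot>\<^sub>m sym_outer m v (X *\<^sub>v v)) - ((-2) \<cdot>\<^sub>m sym_outer m v (X *\<^sub>v v)) * E =
        (-2) \<cdot>\<^sub>m (E * sym_outer m v (X *\<^sub>v v) - sym_outer m v (X *\<^sub>v v) * E)"
      unfolding mult_smult_distrib [OF car(1) sym_outer_carrier] mult_smult_assoc_mat [OF sym_outer_carrier car(1)]
      by (rule smult_diff [OF mult_carrier_mat [OF car(1) sym_outer_carrier]
            mult_carrier_mat [OF sym_outer_carrier car(1)]])
    also have "E * sym_outer m v (X *\<^sub>v v) - sym_outer m v (X *\<^sub>v v) * E = (2 * \<kappa>) \<cdot>\<^sub>m E"
      unfolding commutator_sym_outer [OF sp(1) v Xv] Ev EX sym_outer_smult [OF v]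
      using v by (intro eq_matI) (auto simp: E_def sym_outer_def outer_def)
    finally show ?thesis
      unfolding 1 using car(1) by (simp add: smult_smult_mat mult.assoc [symmetric])
  qed
  define triple where "triple U \<longleftrightarrow> (\<exists>e\<in>U. \<exists>f\<in>U. \<exists>h\<in>U. \<pi> e = E \<and> \<pi> f = F \<and> \<pi> h = H)" for U
  have "triple I"
  proof -
    \<comment> \<open>These lifts lie in \<open>T\<close> but not necessarily in \<open>I\<close>.
      Every bracket below has one factor in the ideal, and the scalars undo the constants in
      \<open>EXE\<close>, \<open>FE\<close> and \<open>FH\<close>.\<close>
    obtain e0 f0 where e0: "e0 \<in> T" "\<pi> e0 = E" and f0: "f0 \<in> T" "\<pi> f0 = F"
      using proj_surj sp by metis
    define y where "y = e0 * A - A * e0"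
    define e where "e = (1 / (-4 * \<kappa>)) \<cdot>\<^sub>m (e0 * y - y * e0)"
    define h where "h = (1 / (-4)) \<cdot>\<^sub>m (f0 * e - e * f0)"
    define f where "f = (1 / (-2)) \<cdot>\<^sub>m (f0 * h - h * f0)"
    have y: "y \<in> I" unfolding y_def by (rule ideal [OF e0(1) A])
    have e: "e \<in> I" unfolding e_def by (intro smultI ideal e0 y)
    have h: "h \<in> I" unfolding h_def by (intro smultI ideal f0 e)
    have f: "f \<in> I" unfolding f_def by (intro smultI ideal f0 h)
    note T = IT(2) [THEN subsetD]
    have "\<pi> y = E * X - X * E"
      unfolding y_def proj_bracket [OF e0(1) T [OF A]] e0(2) X_def ..
    then have "\<pi> e = E"
      unfolding e_def proj_smult [OF bracket_closed [OF e0(1) T [OF y]]] proj_bracket [OF e0(1) T [OF y]] e0(2)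
      using q by (simp add: EXE smult_smult_mat \<kappa>_def)
    moreover from this have "\<pi> h = H"
      unfolding h_def proj_smult [OF bracket_closed [OF f0(1) T [OF e]]] proj_bracket [OF f0(1) T [OF e]] f0(2)
      by (simp add: FE smult_smult_mat)
    moreover from this have "\<pi> f = F"
      unfolding f_def proj_smult [OF bracket_closed [OF f0(1) T [OF h]]] proj_bracket [OF f0(1) T [OF h]] f0(2)
      by (simp add: FH smult_smult_mat)
    ultimately show ?thesis
      unfolding triple_def using e f h by blast
  qed
  \<comment> \<open>A derived algebra admits only brackets of elements of \<open>U\<close>, so here
    the lifts themselves are bracketed with one another.\<close>
  have step: "lie_derived lie U \<subseteq> T \<and> triple (lie_derived lie U)" if U: "U \<subseteq> T" "triple U" for U
  proof
    have closed: "\<And>A B. A \<in> U \<Longrightarrow> B \<in> U \<Longrightarrow> A * B - B * A \<in> T"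
      using U bracket_closed by blast
    note mem = lie_derived_mem [OF lin_closed U(1) closed, folded lie_def]
    show "lie_derived lie U \<subseteq> T"
      unfolding lie_def by (rule lie_derived_subset [OF lin_closed U(1) closed lin_closed order_refl closed])
    obtain e f h where efh: "e \<in> U" "f \<in> U" "h \<in> U" "\<pi> e = E" "\<pi> f = F" "\<pi> h = H"
      using U(2) unfolding triple_def by blast
    note T = U(1) [THEN subsetD]
    have br: "\<pi> (c \<cdot>\<^sub>m (a * b - b * a)) = c \<cdot>\<^sub>m (\<pi> a * \<pi> b - \<pi> b * \<pi> a)" if "a \<in> U" "b \<in> U" for a b c
      using T that by (simp add: proj_smult proj_bracket bracket_closed)
    have "\<pi> ((1 / 2) \<cdot>\<^sub>m (e * h - h * e)) = E"
      using br [OF efh(1,3)] by (simp add: efh EH smult_smult_mat)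
    moreover have "\<pi> ((1 / (-2)) \<cdot>\<^sub>m (f * h - h * f)) = F"
      using br [OF efh(2,3)] by (simp add: efh FH smult_smult_mat)
    moreover have "\<pi> ((1 / (-4)) \<cdot>\<^sub>m (f * e - e * f)) = H"
      using br [OF efh(2,1)] by (simp add: efh FE smult_smult_mat)
    ultimately show "triple (lie_derived lie U)"
      unfolding triple_def using mem efh(1-3) by blast
  qed
  have all: "(lie_derived lie ^^ i) I \<subseteq> T \<and> triple ((lie_derived lie ^^ i) I)" for i
    using step IT(2) \<open>triple I\<close> by (induction i) auto
  obtain i where "(lie_derived lie ^^ i) I = {0\<^sub>m n n}"
    using solv by (auto simp: lie_solvable_def lie_simps)
  \<comment> \<open>A triple inside the zero algebra forces \<open>E = \<pi> 0 = 0\<close>,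
    contradicting \<open>E w = 2 v\<close> with v nonzero.\<close>
  with all [of i] have E0: "E = 0\<^sub>m (2 * m) (2 * m)"
    by (auto simp: triple_def proj_zero)
  have "2 \<cdot>\<^sub>v v = 0\<^sub>v (2 * m)"
  proof -
    have "0\<^sub>m (2 * m) (2 * m) *\<^sub>v w = 0\<^sub>v (2 * m)"
      using w by (intro eq_vecI) auto
    with Ew E0 show ?thesis by simp
  qed
  then have "v = 0\<^sub>v (2 * m)"
    using v by (auto simp: vec_eq_iff)
  then show False
    using q Xc by (auto simp: sympl_form_def)
qed

lemma semisimple_if_inj:
  assumes "\<And>A. A \<in> T \<Longrightarrow> \<pi> A = 0\<^sub>m (2 * m) (2 * m) \<Longrightarrow> A = 0\<^sub>m n n"
  shows "lie_semisimple lie"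
proof -
  have "lin_closed n {0\<^sub>m n n}" "0\<^sub>m n n \<in> T"
    using lin_closed by (auto simp: lin_closed_def)
  then have "lie_ideal lie {0\<^sub>m n n}"
    using subspace_gl_sub [OF lin_closed, of "{0\<^sub>m n n}"]
    by (auto simp: lie_ideal_def lie_simps lie_def [symmetric] dest: carrier_T)
  moreover have "lie_solvable lie {0\<^sub>m n n}"
    by (auto simp: lie_solvable_def lie_simps intro: exI [of _ 0])
  moreover have "I \<subseteq> {0\<^sub>m n n}" if "lie_ideal lie I" "lie_solvable lie I" for I
  proof
    fix A assume "A \<in> I"
    moreover have "I \<subseteq> T"
      using that(1) subspace_gl_sub [OF lin_closed] by (auto simp: lie_ideal_def lie_def [symmetric])
    ultimately show "A \<in> {0\<^sub>m n n}"
      using assms solvable_ideal_proj_zero [OF that] by blast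
  qed
  ultimately show ?thesis
    unfolding lie_semisimple_def is_solvable_radical_def by (simp add: lie_simps)
qed

definition kernel :: "complex mat set" where
  "kernel = {A \<in> T. \<pi> A = 0\<^sub>m (2 * m) (2 * m)}"

lemma lin_closed_kernel: "lin_closed n kernel"
  using lin_closed by (auto simp: lin_closed_def kernel_def proj_zero proj_add proj_smult)

lemma kernel_radical:
  assumes "lie_solvable lie kernel"
  shows "is_solvable_radical lie kernel"
  unfolding is_solvable_radical_def
proof (intro conjI allI impI)
  have "kernel \<subseteq> T" by (auto simp: kernel_def)
  moreover have "A * B - B * A \<in> kernel" if "A \<in> T" "B \<in> kernel" for A B
    using that proj_carrier [of A] by (auto simp: kernel_def bracket_closed proj_bracket)
  ultimately show "lie_ideal lie kernel"
    using subspace_gl_sub [OF lin_closed] lin_closed_kernel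
    by (auto simp: lie_ideal_def lie_simps lie_def [symmetric])
  show "lie_solvable lie kernel" by fact
  fix I assume I: "lie_ideal lie I \<and> lie_solvable lie I"
  then have "I \<subseteq> T"
    using subspace_gl_sub [OF lin_closed] by (auto simp: lie_ideal_def lie_def [symmetric])
  then show "I \<subseteq> kernel"
    using I solvable_ideal_proj_zero by (auto simp: kernel_def)
qed

text \<open>The composite of \<open>\<pi>\<close> and \<open>\<phi>\<close> is a projection of
  \<open>T\<close> onto the image of \<open>\<phi>\<close> along \<open>kernel\<close>, which yields
  the complement; the kernel is the radical by \<open>kernel_radical\<close>.\<close>

lemma levi_factor_section:
  fixes \<phi> :: "complex mat \<Rightarrow> complex mat"
  assumes kernel: "lie_solvable lie kernel"
    and \<phi>: "\<And>X. X \<in> carrier (sp m) \<Longrightarrow> \<phi> X \<in> T" "\<And>X. X \<in> carrier (sp m) \<Longrightarrow> \<pi> (\<phi> X) = X"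
    and hom: "\<And>X Y. X \<in> carrier_mat (2 * m) (2 * m) \<Longrightarrow> Y \<in> carrier_mat (2 * m) (2 * m) \<Longrightarrow>
        \<phi> (X + Y) = \<phi> X + \<phi> Y"
      "\<And>c X. X \<in> carrier_mat (2 * m) (2 * m) \<Longrightarrow> \<phi> (c \<cdot>\<^sub>m X) = c \<cdot>\<^sub>m \<phi> X"
      "\<And>X Y. X \<in> carrier_mat (2 * m) (2 * m) \<Longrightarrow> Y \<in> carrier_mat (2 * m) (2 * m) \<Longrightarrow>
        \<phi> (X * Y - Y * X) = \<phi> X * \<phi> Y - \<phi> Y * \<phi> X"
  shows "levi_factor lie (\<phi> ` carrier (sp m))"
proof -
  let ?S = "\<phi> ` carrier (sp m)"
  have spc: "X \<in> carrier_mat (2 * m) (2 * m)" if "X \<in> carrier (sp m)" for X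
    using that by (simp add: carrier_sp_iff)
  have zero_sp: "0\<^sub>m (2 * m) (2 * m) \<in> carrier (sp m)"
    by (auto simp: carrier_sp_iff)
  have \<phi>0: "\<phi> (0\<^sub>m (2 * m) (2 * m)) = 0\<^sub>m n n"
  proof -
    have "\<phi> (0 \<cdot>\<^sub>m 0\<^sub>m (2 * m) (2 * m)) = 0 \<cdot>\<^sub>m \<phi> (0\<^sub>m (2 * m) (2 * m))"
      by (rule hom(2)) simp
    moreover have "0 \<cdot>\<^sub>m 0\<^sub>m (2 * m) (2 * m) = (0\<^sub>m (2 * m) (2 * m) :: complex mat)"
      by (intro eq_matI) auto
    moreover have "0 \<cdot>\<^sub>m \<phi> (0\<^sub>m (2 * m) (2 * m)) = 0\<^sub>m n n"
      using carrier_T [OF \<phi>(1) [OF zero_sp]] by (intro eq_matI) auto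
    ultimately show ?thesis by simp
  qed
  have sp_add: "X + Y \<in> carrier (sp m)" if "X \<in> carrier (sp m)" "Y \<in> carrier (sp m)" for X Y
    using that by (auto simp: carrier_sp_iff)
  have sp_smult: "c \<cdot>\<^sub>m X \<in> carrier (sp m)" if "X \<in> carrier (sp m)" for c X
    using that by (auto simp: carrier_sp_iff)
  \<comment> \<open>Closure of \<open>sp m\<close> under brackets is inherited: bracket the lifts
    inside \<open>T\<close> and project back.\<close>
  have sp_bracket: "X * Y - Y * X \<in> carrier (sp m)" if "X \<in> carrier (sp m)" "Y \<in> carrier (sp m)" for X Y
    using proj_sp [OF bracket_closed [OF \<phi>(1) [OF that(1)] \<phi>(1) [OF that(2)]]] that
    by (simp add: proj_bracket \<phi>)
  have ST: "?S \<subseteq> T" using \<phi>(1) by auto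
  have S: "lin_closed n ?S"
    unfolding lin_closed_def
  proof (intro conjI ballI allI)
    show "?S \<subseteq> carrier_mat n n" using ST carrier_T by blast
    show "0\<^sub>m n n \<in> ?S" using \<phi>0 zero_sp by (metis imageI)
    show "A + B \<in> ?S" if "A \<in> ?S" "B \<in> ?S" for A B
      using that sp_add spc hom(1) [symmetric] by auto
    show "c \<cdot>\<^sub>m A \<in> ?S" if "A \<in> ?S" for c A
      using that sp_smult spc hom(2) [symmetric] by auto
  qed
  have S_bracket: "A * B - B * A \<in> ?S" if "A \<in> ?S" "B \<in> ?S" for A B
    using that sp_bracket spc hom(3) [symmetric] by auto
  \<comment> \<open>On the image of the section \<open>\<pi>\<close> is injective, so
    \<open>semisimple_if_inj\<close> will apply to this instance.\<close>
  interpret S: sp_projection n m ?S \<pi>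
    using S S_bracket ST \<phi> proj_sp proj_add proj_smult proj_bracket
    by unfold_locales (auto simp: subset_iff)
  have "lie_subalgebra lie ?S"
    using S ST S_bracket subspace_gl_sub [OF lin_closed]
    by (auto simp: lie_subalgebra_def lie_simps lie_def [symmetric])
  moreover have "lie_semisimple (lie\<lparr>carrier := ?S\<rparr>)"
  proof -
    have "lie_semisimple S.lie"
      using \<phi> \<phi>0 by (intro S.semisimple_if_inj) auto
    then show ?thesis by (simp add: S.lie_def lie_def)
  qed
  moreover have "?S \<inter> kernel = {0\<^sub>m n n}"
    using \<phi> \<phi>0 zero_sp by (force simp: kernel_def)
  moreover have "T = {A + B | A B. A \<in> ?S \<and> B \<in> kernel}"
  proof (intro equalityI subsetI)
    fix A assume A: "A \<in> T"
    let ?B = "\<phi> (\<pi> A)"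
    have B: "?B \<in> ?S" "?B \<in> T" using \<phi>(1) proj_sp [OF A] by auto
    have "A + (-1) \<cdot>\<^sub>m ?B \<in> T"
      using A B(2) lin_closed by (simp add: lin_closed_def)
    moreover have "\<pi> (A + (-1) \<cdot>\<^sub>m ?B) = 0\<^sub>m (2 * m) (2 * m)"
      using proj_carrier [OF A]
      by (simp add: proj_add proj_smult A B smult_T \<phi> proj_sp) (auto intro!: eq_matI)
    moreover have "A = ?B + (A + (-1) \<cdot>\<^sub>m ?B)"
      using carrier_T [OF A] carrier_T [OF B(2)] by (intro eq_matI) auto
    ultimately show "A \<in> {A + B | A B. A \<in> ?S \<and> B \<in> kernel}"
      using B(1) by (auto simp: kernel_def)
  next
    fix A assume "A \<in> {A + B | A B. A \<in> ?S \<and> B \<in> kernel}"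
    then show "A \<in> T"
      using ST lin_closed by (auto simp: kernel_def lin_closed_def)
  qed
  ultimately show ?thesis
    unfolding levi_factor_def using kernel_radical [OF kernel]
    by (auto simp: lie_simps)
qed

end

section \<open>The Levi factor\<close>

definition entry :: "nat \<Rightarrow> complex mat \<Rightarrow> nat \<Rightarrow> nat \<Rightarrow> nat \<Rightarrow> nat \<Rightarrow> complex" where
  "entry k M a s c i = M $$ (a * (k + 1) + s, c * (k + 1) + i)"

lemma hc_index_less: "a < 2 * m + 1 \<Longrightarrow> s \<le> k \<Longrightarrow> a * (k + 1) + s < hc_dim m k"
  unfolding hc_dim_def by (rule block_index_less)

lemma entry_hc_matrix:
  assumes "a < 2 * m + 1" "c < 2 * m + 1" "s \<le> k" "i \<le> k"
  shows "entry k (hc_matrix m k \<rho>) a s c i = \<rho> (hc_elem m c i) s $ a"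
  using hc_index_less [OF assms(1,3)] hc_index_less [OF assms(2,4)]
  unfolding entry_def hc_matrix_def
  by (simp only: index_mat split hc_basis_nth [OF assms(2,4)] hc_coord_block [OF assms(3)])

lemma entry_add:
  assumes "B \<in> carrier_mat (hc_dim m k) (hc_dim m k)"
    "a < 2 * m + 1" "c < 2 * m + 1" "s \<le> k" "i \<le> k"
  shows "entry k (A + B) a s c i = entry k A a s c i + entry k B a s c i"
  using assms(1) hc_index_less [OF assms(2,4)] hc_index_less [OF assms(3,5)]
  unfolding entry_def by (intro index_add_mat) auto

lemma entry_minus:
  assumes "B \<in> carrier_mat (hc_dim m k) (hc_dim m k)"
    "a < 2 * m + 1" "c < 2 * m + 1" "s \<le> k" "i \<le> k"
  shows "entry k (A - B) a s c i = entry k A a s c i - entry k B a s c i"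
  using assms(1) hc_index_less [OF assms(2,4)] hc_index_less [OF assms(3,5)]
  unfolding entry_def by (intro index_minus_mat) auto

lemma entry_smult:
  assumes "A \<in> carrier_mat (hc_dim m k) (hc_dim m k)"
    "a < 2 * m + 1" "c < 2 * m + 1" "s \<le> k" "i \<le> k"
  shows "entry k (x \<cdot>\<^sub>m A) a s c i = x * entry k A a s c i"
  using assms(1) hc_index_less [OF assms(2,4)] hc_index_less [OF assms(3,5)]
  unfolding entry_def by (intro index_smult_mat) auto

lemma entry_mult:
  assumes "A \<in> carrier_mat (hc_dim m k) (hc_dim m k)" "B \<in> carrier_mat (hc_dim m k) (hc_dim m k)"
    "a < 2 * m + 1" "c < 2 * m + 1" "s \<le> k" "i \<le> k"
  shows "entry k (A * B) a s c i = (\<Sum>b<2 * m + 1. \<Sum>j\<le>k. entry k A a s b j * entry k B b j c i)"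
proof -
  have "entry k (A * B) a s c i =
      (\<Sum>n<(2 * m + 1) * (k + 1). A $$ (a * (k + 1) + s, n) * B $$ (n, c * (k + 1) + i))"
    using assms(1,2) hc_index_less [OF assms(3,5)] hc_index_less [OF assms(4,6)]
    unfolding entry_def hc_dim_def [symmetric]
    by (simp add: scalar_prod_def atLeast0LessThan del: mult_Suc_right mult_Suc add_Suc_right)
  then show ?thesis
    unfolding sum_block_index entry_def .
qed

lemma mat_eq_entI:
  assumes "A \<in> carrier_mat (hc_dim m k) (hc_dim m k)" "B \<in> carrier_mat (hc_dim m k) (hc_dim m k)"
    and "\<And>a s c i. a < 2 * m + 1 \<Longrightarrow> s \<le> k \<Longrightarrow> c < 2 * m + 1 \<Longrightarrow> i \<le> k \<Longrightarrow> entry k A a s c i = entry k B a s c i"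
  shows "A = B"
proof (rule eq_matI)
  fix r c assume "r < dim_row B" "c < dim_col B"
  then have rc: "r < (2 * m + 1) * (k + 1)" "c < (2 * m + 1) * (k + 1)"
    using assms(2) by (auto simp: hc_dim_def)
  obtain a s where 1: "a < 2 * m + 1" "s \<le> k" "r = a * (k + 1) + s"
    using rc(1) by (rule block_indexE)
  obtain b i where 2: "b < 2 * m + 1" "i \<le> k" "c = b * (k + 1) + i"
    using rc(2) by (rule block_indexE)
  show "A $$ (r, c) = B $$ (r, c)"
    unfolding 1 2 using assms(3) [OF 1(1,2) 2(1,2)] by (simp only: entry_def)
qed (use assms in auto)

lemma Der_hc_entries:
  assumes "0 < m" "0 < k" "M \<in> carrier (Der_hc m k)"
  shows "hc_derivation_entries m k (entry k M)"
proof -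
  obtain \<rho> where \<rho>: "\<rho> \<in> derivations (heisenberg_current m k)" and M: "M = hc_matrix m k \<rho>"
    using assms(3) by (auto simp: carrier_Der_hc)
  interpret D: hc_derivation_entries m k "\<lambda>a s c i. \<rho> (hc_elem m c i) s $ a"
    by (rule hc_derivation_entries [OF assms(2,1) \<rho>])
  show ?thesis
  proof
    show "entry k M c s (2 * m) i = 0" if "c < 2 * m" "s \<le> k" "i \<le> k" for c s i
      using that D.center_out by (simp add: M entry_hc_matrix)
    fix a b i j s assume h: "a < m" "b < m" "i \<le> k" "j \<le> k" "s \<le> k"
    then have 1: "entry k M (m + b) (s - j) a i = \<rho> (hc_elem m a i) (s - j) $ (m + b)"
      "entry k M (m + a) (s - i) b j = \<rho> (hc_elem m b j) (s - i) $ (m + a)"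
      "entry k M b (s - j) (m + a) i = \<rho> (hc_elem m (m + a) i) (s - j) $ b"
      "entry k M a (s - i) (m + b) j = \<rho> (hc_elem m (m + b) j) (s - i) $ a"
      "entry k M b (s - j) a i = \<rho> (hc_elem m a i) (s - j) $ b"
      "entry k M (m + a) (s - i) (m + b) j = \<rho> (hc_elem m (m + b) j) (s - i) $ (m + a)"
      by (simp_all add: M entry_hc_matrix)
    have 2: "(if a = b \<and> i + j \<le> k then entry k M (2 * m) s (2 * m) (i + j) else 0) =
        (if a = b \<and> i + j \<le> k then \<rho> (hc_elem m (2 * m) (i + j)) s $ (2 * m) else 0)"
      using h by (simp add: M entry_hc_matrix)
    show "(if j \<le> s then entry k M (m + b) (s - j) a i else 0) = (if i \<le> s then entry k M (m + a) (s - i) b j else 0)"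
      unfolding 1 by (rule D.eq_ee [OF h])
    show "(if j \<le> s then entry k M b (s - j) (m + a) i else 0) = (if i \<le> s then entry k M a (s - i) (m + b) j else 0)"
      unfolding 1 by (rule D.eq_ff [OF h])
    show "(if a = b \<and> i + j \<le> k then entry k M (2 * m) s (2 * m) (i + j) else 0) =
      (if j \<le> s then entry k M b (s - j) a i else 0) + (if i \<le> s then entry k M (m + a) (s - i) (m + b) j else 0)"
      unfolding 1 2 by (rule D.eq_ef [OF h])
  qed (use assms in auto)
qed

text \<open>The constant term after removal of p(0), which is half of the constant term on the
  center. The vector field needs no correction, since its columns of degree 0 vanish.\<close>

definition sp_part :: "nat \<Rightarrow> nat \<Rightarrow> complex mat \<Rightarrow> complex mat" where
  "sp_part m k M = mat (2 * m) (2 * m)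
     (\<lambda>(a, c). entry k M a 0 c 0 - (if a = c then entry k M (2 * m) 0 (2 * m) 0 / 2 else 0))"

definition sp_embed :: "nat \<Rightarrow> nat \<Rightarrow> complex mat \<Rightarrow> complex mat" where
  "sp_embed m k X = four_block_mat (kronecker X (1\<^sub>m (k + 1))) (0\<^sub>m (2 * m * (k + 1)) (k + 1))
     (0\<^sub>m (k + 1) (2 * m * (k + 1))) (0\<^sub>m (k + 1) (k + 1))"

lemma sp_embed_carrier:
  assumes "X \<in> carrier_mat (2 * m) (2 * m)"
  shows "sp_embed m k X \<in> carrier_mat (hc_dim m k) (hc_dim m k)"
proof -
  have "kronecker X (1\<^sub>m (k + 1)) \<in> carrier_mat (2 * m * (k + 1)) (2 * m * (k + 1))"
    using assms by (auto simp: kronecker_def)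
  then have "sp_embed m k X \<in> carrier_mat (2 * m * (k + 1) + (k + 1)) (2 * m * (k + 1) + (k + 1))"
    unfolding sp_embed_def by (intro four_block_carrier_mat) auto
  then show ?thesis by (simp add: hc_dim_def algebra_simps)
qed

lemma entry_sp_embed:
  assumes "X \<in> carrier_mat (2 * m) (2 * m)" "a < 2 * m + 1" "c < 2 * m + 1" "s \<le> k" "i \<le> k"
  shows "entry k (sp_embed m k X) a s c i = (if a < 2 * m \<and> c < 2 * m \<and> s = i then X $$ (a, c) else 0)"
proof -
  have dim: "dim_row (kronecker X (1\<^sub>m (k + 1))) = 2 * m * (k + 1)" "dim_col (kronecker X (1\<^sub>m (k + 1))) = 2 * m * (k + 1)"
    using assms(1) by (auto simp: kronecker_def)
  have less: "a * (k + 1) + s < 2 * m * (k + 1) + (k + 1)" "c * (k + 1) + i < 2 * m * (k + 1) + (k + 1)"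
    using block_index_less [OF assms(2,4)] block_index_less [OF assms(3,5)] by (simp_all add: algebra_simps)
  have iff: "a * (k + 1) + s < 2 * m * (k + 1) \<longleftrightarrow> a < 2 * m" if "s \<le> k" for a s
  proof
    show "a < 2 * m" if "a * (k + 1) + s < 2 * m * (k + 1)"
      using that mult_le_mono1 [of "2 * m" a "k + 1"] by (meson leD leI trans_le_add1)
  qed (rule block_index_less [OF _ that])
  have kron: "kronecker X (1\<^sub>m (k + 1)) $$ (a * (k + 1) + s, c * (k + 1) + i) = (if s = i then X $$ (a, c) else 0)"
    if "a < 2 * m" "c < 2 * m"
  proof -
    have "a * (k + 1) + s < dim_row X * (k + 1)" "c * (k + 1) + i < dim_col X * (k + 1)"
      using that assms block_index_less by auto
    then have "kronecker X (1\<^sub>m (k + 1)) $$ (a * (k + 1) + s, c * (k + 1) + i) =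
       X $$ (a, c) * 1\<^sub>m (k + 1) $$ (s, i)"
      unfolding kronecker_def by (simp only: index_mat split index_one_mat block_index_div_mod [OF assms(4)] block_index_div_mod [OF assms(5)])
    then show ?thesis using assms by simp
  qed
  have "entry k (sp_embed m k X) a s c i = (if a < 2 * m
      then if c < 2 * m then kronecker X (1\<^sub>m (k + 1)) $$ (a * (k + 1) + s, c * (k + 1) + i)
        else 0\<^sub>m (2 * m * (k + 1)) (k + 1) $$ (a * (k + 1) + s, c * (k + 1) + i - 2 * m * (k + 1))
      else if c < 2 * m then 0\<^sub>m (k + 1) (2 * m * (k + 1)) $$ (a * (k + 1) + s - 2 * m * (k + 1), c * (k + 1) + i)
        else 0\<^sub>m (k + 1) (k + 1) $$ (a * (k + 1) + s - 2 * m * (k + 1), c * (k + 1) + i - 2 * m * (k + 1)))"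
    unfolding entry_def sp_embed_def using less
    by (subst index_mat_four_block) (simp_all only: dim index_zero_mat iff [OF assms(4)] iff [OF assms(5)])
  also have "\<dots> = (if a < 2 * m \<and> c < 2 * m \<and> s = i then X $$ (a, c) else 0)"
  proof -
    have sub: "x - y < k + 1" if "x < y + (k + 1)" for x y :: nat
      using that by arith
    note r = iff [OF assms(4), THEN iffD2, of a] and c = iff [OF assms(5), THEN iffD2, of c]
    note z = index_zero_mat(1) [OF r sub [OF less(2)]] index_zero_mat(1) [OF sub [OF less(1)] c]
      index_zero_mat(1) [OF sub [OF less(1)] sub [OF less(2)]]
    show ?thesis
      by (cases "a < 2 * m"; cases "c < 2 * m") (simp_all only: kron z if_True if_False simp_thms)
  qed
  finally show ?thesis .
qed

lemma sp_embed_add: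
  assumes "X \<in> carrier_mat (2 * m) (2 * m)" "Y \<in> carrier_mat (2 * m) (2 * m)"
  shows "sp_embed m k (X + Y) = sp_embed m k X + sp_embed m k Y"
  by (rule mat_eq_entI [of _ m k]) (use assms sp_embed_carrier in \<open>auto simp: entry_add [of _ m] entry_sp_embed\<close>)

lemma sp_embed_smult:
  assumes "X \<in> carrier_mat (2 * m) (2 * m)"
  shows "sp_embed m k (c \<cdot>\<^sub>m X) = c \<cdot>\<^sub>m sp_embed m k X"
  by (rule mat_eq_entI [of _ m k]) (use assms sp_embed_carrier in \<open>auto simp: entry_smult [of _ m] entry_sp_embed\<close>)

lemma sp_embed_mult:
  assumes "X \<in> carrier_mat (2 * m) (2 * m)" "Y \<in> carrier_mat (2 * m) (2 * m)"
  shows "sp_embed m k (X * Y) = sp_embed m k X * sp_embed m k Y"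
proof (rule mat_eq_entI [of _ m k])
  fix a s c i assume h: "a < 2 * m + 1" "s \<le> k" "c < 2 * m + 1" "i \<le> k"
  have "entry k (sp_embed m k X * sp_embed m k Y) a s c i =
      (\<Sum>b<2 * m + 1. \<Sum>j\<le>k. entry k (sp_embed m k X) a s b j * entry k (sp_embed m k Y) b j c i)"
    using h by (intro entry_mult sp_embed_carrier assms)
  also have "\<dots> = (\<Sum>b<2 * m + 1. \<Sum>j\<le>k.
      if j = s then (if a < 2 * m \<and> b < 2 * m then X $$ (a, b) else 0) *
        (if b < 2 * m \<and> c < 2 * m \<and> j = i then Y $$ (b, c) else 0) else 0)"
    using assms h by (intro sum.cong refl) (auto simp: entry_sp_embed)
  also have "\<dots> = (\<Sum>b<2 * m. (if a < 2 * m \<and> b < 2 * m then X $$ (a, b) else 0) *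
        (if b < 2 * m \<and> c < 2 * m \<and> s = i then Y $$ (b, c) else 0))"
    using h by simp
  also have "\<dots> = (if a < 2 * m \<and> c < 2 * m \<and> s = i then (X * Y) $$ (a, c) else 0)"
    using assms by (auto simp: scalar_prod_def atLeast0LessThan intro!: sum.cong)
  finally show "entry k (sp_embed m k (X * Y)) a s c i = entry k (sp_embed m k X * sp_embed m k Y) a s c i"
    using assms h by (simp add: entry_sp_embed)
qed (intro sp_embed_carrier mult_carrier_mat [OF sp_embed_carrier sp_embed_carrier] mult_carrier_mat [OF assms] assms)+

lemma sp_embed_bracket:
  assumes "X \<in> carrier_mat (2 * m) (2 * m)" "Y \<in> carrier_mat (2 * m) (2 * m)"
  shows "sp_embed m k (X * Y - Y * X) = sp_embed m k X * sp_embed m k Y - sp_embed m k Y * sp_embed m k X"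
proof -
  have eq: "A - B = A + (-1) \<cdot>\<^sub>m B" if "A \<in> carrier_mat n n" "B \<in> carrier_mat n n" for n and A B :: "complex mat"
    using that by (intro eq_matI) auto
  have XY: "X * Y \<in> carrier_mat (2 * m) (2 * m)" "Y * X \<in> carrier_mat (2 * m) (2 * m)"
    using assms by auto
  show ?thesis
    unfolding eq [OF XY]
      eq [OF mult_carrier_mat [OF sp_embed_carrier [OF assms(1)] sp_embed_carrier [OF assms(2)]]
        mult_carrier_mat [OF sp_embed_carrier [OF assms(2)] sp_embed_carrier [OF assms(1)]]]
      sp_embed_add [OF XY(1) smult_carrier_mat [OF XY(2)]] sp_embed_smult [OF XY(2)]
      sp_embed_mult [OF assms] sp_embed_mult [OF assms(2,1)] ..
qed

lemma sp_part_sp_embed: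
  assumes "X \<in> carrier_mat (2 * m) (2 * m)"
  shows "sp_part m k (sp_embed m k X) = X"
  using assms by (intro eq_matI) (auto simp: sp_part_def entry_sp_embed)

definition lift_mat :: "nat \<Rightarrow> complex mat \<Rightarrow> complex vec \<Rightarrow> complex vec" where
  "lift_mat m X u = vec (2 * m + 1) (\<lambda>a. if a < 2 * m then \<Sum>c<2 * m. X $$ (a, c) * u $ c else 0)"

text \<open>Both terms are double sums over pairs of indices; by the symplectic relations,
  exchanging the two indices turns one summand into the negative of the other.\<close>

lemma sympl_form_invariant:
  assumes "X \<in> carrier (sp m)"
  shows "sympl_form m (lift_mat m X u) v + sympl_form m u (lift_mat m X v) = 0"
proof -
  have rel: "X $$ (m + i, m + j) = - X $$ (j, i)" "X $$ (i, m + j) = X $$ (j, m + i)"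
    "X $$ (m + i, j) = X $$ (m + j, i)" if "i < m" "j < m" for i j
    using assms that by (auto simp: carrier_sp_iff)
  have l: "lift_mat m X u $ a = (\<Sum>d<m. X $$ (a, d) * u $ d + X $$ (a, m + d) * u $ (m + d))" if "a < 2 * m" for a u
    using that by (simp add: lift_mat_def sum_double)
  define t where "t i d = (X $$ (i, d) * u $ d + X $$ (i, m + d) * u $ (m + d)) * v $ (m + i) -
      (X $$ (m + i, d) * u $ d + X $$ (m + i, m + d) * u $ (m + d)) * v $ i" for i d
  have 1: "sympl_form m (lift_mat m X u) v = (\<Sum>i<m. \<Sum>d<m. t i d)"
    unfolding sympl_form_def t_def
    by (intro sum.cong refl) (simp add: l sum_distrib_right sum_subtractf sum.distrib distrib_right)
  have "sympl_form m u (lift_mat m X v) = (\<Sum>i<m. \<Sum>d<m.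
      u $ i * (X $$ (m + i, d) * v $ d + X $$ (m + i, m + d) * v $ (m + d)) -
      u $ (m + i) * (X $$ (i, d) * v $ d + X $$ (i, m + d) * v $ (m + d)))"
    unfolding sympl_form_def
    by (intro sum.cong refl) (simp add: l sum_distrib_left sum_subtractf sum.distrib distrib_left)
  also have "\<dots> = (\<Sum>i<m. \<Sum>d<m. - t d i)"
  proof (intro sum.cong refl)
    fix i d assume "i \<in> {..<m}" "d \<in> {..<m}"
    then have id: "i < m" "d < m" by auto
    show "u $ i * (X $$ (m + i, d) * v $ d + X $$ (m + i, m + d) * v $ (m + d)) -
      u $ (m + i) * (X $$ (i, d) * v $ d + X $$ (i, m + d) * v $ (m + d)) = - t d i"
      unfolding t_def rel(1) [OF id] rel(1) [OF id(2,1)] rel(2) [OF id] rel(3) [OF id]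
      by (simp add: algebra_simps)
  qed
  also have "\<dots> = (\<Sum>d<m. \<Sum>i<m. - t d i)"
    by (rule sum.swap)
  also have "\<dots> = - sympl_form m (lift_mat m X u) v"
    unfolding 1 by (simp add: sum_negf)
  finally show ?thesis by simp
qed

text \<open>Applying \<open>X\<close> to each coefficient and killing z is a derivation: the left
  side of the Leibniz rule vanishes because brackets are central, the right side because the form is
  invariant.\<close>

lemma sp_embed_Der:
  assumes X: "X \<in> carrier (sp m)"
  obtains \<rho> where "\<rho> \<in> derivations (heisenberg_current m k)" "hc_matrix m k \<rho> = sp_embed m k X"
proof -
  let ?L = "heisenberg_current m k"
  define \<rho> :: "(nat \<Rightarrow> complex vec) \<Rightarrow> nat \<Rightarrow> complex vec" where "\<rho> x = (\<lambda>j. lift_mat m X (x j))" for x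
  note simps = truncated_current_simps heisenberg_simps
  have car: "x j \<in> carrier_vec (2 * m + 1)" if "x \<in> carrier ?L" for x j
    using that by (cases "j \<le> k") (auto simp: simps)
  have "\<rho> \<in> derivations ?L"
  proof (rule derivationsI)
    fix x assume x: "x \<in> carrier ?L"
    have "lift_mat m X (0\<^sub>v (2 * m + 1)) = 0\<^sub>v (2 * m + 1)"
      by (intro eq_vecI) (auto simp: lift_mat_def)
    then show "\<rho> x \<in> carrier ?L"
      using x by (auto simp: simps \<rho>_def) (auto simp: lift_mat_def)
    show "\<rho> (c \<odot>\<^bsub>?L\<^esub> x) = c \<odot>\<^bsub>?L\<^esub> \<rho> x" for c
      by (auto simp: simps \<rho>_def lift_mat_def sum_distrib_left mult.left_commute fun_eq_iff
          carrier_vecD [OF car [OF x]] intro!: eq_vecI)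
    fix y assume y: "y \<in> carrier ?L"
    show "\<rho> (x \<oplus>\<^bsub>?L\<^esub> y) = \<rho> x \<oplus>\<^bsub>?L\<^esub> \<rho> y"
      by (auto simp: simps \<rho>_def lift_mat_def sum.distrib distrib_left fun_eq_iff
          carrier_vecD [OF car [OF x]] carrier_vecD [OF car [OF y]] intro!: eq_vecI)
    have "(\<Sum>i\<le>j. sympl_form m (\<rho> x i) (y (j - i))) + (\<Sum>i\<le>j. sympl_form m (x i) (\<rho> y (j - i))) = 0" for j
      by (simp only: sum.distrib [symmetric] \<rho>_def sympl_form_invariant [OF X] sum.neutral_const)
    moreover have "lift_mat m X (c \<cdot>\<^sub>v unit_vec (2 * m + 1) (2 * m)) = 0\<^sub>v (2 * m + 1)"
      "lift_mat m X (0\<^sub>v (2 * m + 1)) = 0\<^sub>v (2 * m + 1)" for c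
      by (auto simp: lift_mat_def intro!: eq_vecI)
    ultimately show "\<rho> (lie_bracket ?L x y) = lie_bracket ?L (\<rho> x) y \<oplus>\<^bsub>?L\<^esub> lie_bracket ?L x (\<rho> y)"
      by (auto simp: heisenberg_current_bracket simps \<rho>_def fun_eq_iff add_smult_distrib_vec [symmetric])
  qed
  moreover have "hc_matrix m k \<rho> = sp_embed m k X"
  proof (rule mat_eq_entI [of _ m k])
    show "sp_embed m k X \<in> carrier_mat (hc_dim m k) (hc_dim m k)"
      using X by (intro sp_embed_carrier) (simp add: carrier_sp_iff)
    fix a s c i assume h: "a < 2 * m + 1" "s \<le> k" "c < 2 * m + 1" "i \<le> k"
    have "\<rho> (hc_elem m c i) s $ a =
        (if a < 2 * m then \<Sum>d<2 * m. if d = c then if s = i then X $$ (a, d) else 0 else 0 else 0)"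
      using h by (auto simp: \<rho>_def lift_mat_def hc_elem_def if_distrib [of "(*) _"] cong: if_cong)
    then show "entry k (hc_matrix m k \<rho>) a s c i = entry k (sp_embed m k X) a s c i"
      using X h by (simp add: entry_hc_matrix entry_sp_embed carrier_sp_iff)
  qed simp
  ultimately show ?thesis by (rule that)
qed

context
  fixes m k :: nat and M
  assumes mk: "0 < m" "0 < k" and M: "M \<in> carrier (Der_hc m k)"
begin

interpretation D: hc_derivation_entries m k "entry k M"
  by (rule Der_hc_entries [OF mk M])

text \<open>The vector field vanishes at the origin, so these entries never lower the degree in t.
  Entries from e and f to the center are excluded: the Leibniz relations leave them
  arbitrary.\<close>

lemma entry_column_zero:
  assumes "a < 2 * m \<or> b = 2 * m" "a < 2 * m + 1" "b < 2 * m + 1" "j \<le> k" "s \<le> k" "s < j"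
  shows "entry k M a s b j = 0"
proof (cases "b = 2 * m")
  case True
  then show ?thesis
    using assms D.center_out [of a s j] D.center_entry_eq [of j s]
    by (cases "a = 2 * m") (auto simp: D.center_entry_def)
next
  case False
  then show ?thesis
    using assms D.entry_eq [of a b j s] by auto
qed

lemma entry_block_zero:
  assumes "a < 2 * m" "s \<le> k" "i \<le> k"
  shows "entry k M a s (2 * m) i = 0"
  using assms D.center_out by auto

lemma sp_part_sp: "sp_part m k M \<in> carrier (sp m)"
  using D.sp_relations [where s = 0]
  by (auto simp: carrier_sp_iff sp_part_def D.center_entry_def)

end

section \<open>The constant term as a Lie algebra homomorphism onto the symplectic algebra\<close>

lemma sp_part_add:
  assumes "A \<in> carrier_mat (hc_dim m k) (hc_dim m k)" "B \<in> carrier_mat (hc_dim m k) (hc_dim m k)"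
  shows "sp_part m k (A + B) = sp_part m k A + sp_part m k B"
  using assms by (intro eq_matI) (auto simp: sp_part_def entry_add [of _ m] add_divide_distrib)

lemma sp_part_smult:
  assumes "A \<in> carrier_mat (hc_dim m k) (hc_dim m k)"
  shows "sp_part m k (c \<cdot>\<^sub>m A) = c \<cdot>\<^sub>m sp_part m k A"
  using assms by (intro eq_matI) (auto simp: sp_part_def entry_smult [of _ m] right_diff_distrib)

lemma Der_hc_carrier_mat: "A \<in> carrier (Der_hc m k) \<Longrightarrow> A \<in> carrier_mat (hc_dim m k) (hc_dim m k)"
  using Der_hc_closed(1) [of m k] by (auto simp: lin_closed_def)

text \<open>Intermediate indices of positive degree drop out by triangularity in t, and nothing
  passes through the center because the center maps into itself.\<close>

lemma entry_mult_00:
  assumes mk: "0 < m" "0 < k" and AB: "A \<in> carrier (Der_hc m k)" "B \<in> carrier (Der_hc m k)"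
  shows "a < 2 * m \<Longrightarrow> c < 2 * m \<Longrightarrow>
      entry k (A * B) a 0 c 0 = (\<Sum>b<2 * m. entry k A a 0 b 0 * entry k B b 0 c 0)"
    and "entry k (A * B) (2 * m) 0 (2 * m) 0 = entry k A (2 * m) 0 (2 * m) 0 * entry k B (2 * m) 0 (2 * m) 0"
proof -
  note zA = entry_column_zero [OF mk AB(1)] entry_block_zero [OF mk AB(1)]
    and zB = entry_column_zero [OF mk AB(2)] entry_block_zero [OF mk AB(2)]
  note mult = entry_mult [OF Der_hc_carrier_mat [OF AB(1)] Der_hc_carrier_mat [OF AB(2)]]
  have sum0: "(\<Sum>j\<le>k. f j) = f 0" if "\<And>j. 0 < j \<Longrightarrow> j \<le> k \<Longrightarrow> f j = 0" for f :: "nat \<Rightarrow> complex"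
    using that by (subst sum.remove [of _ 0]) auto
  show "entry k (A * B) a 0 c 0 = (\<Sum>b<2 * m. entry k A a 0 b 0 * entry k B b 0 c 0)"
    if "a < 2 * m" "c < 2 * m"
  proof -
    have "entry k (A * B) a 0 c 0 = (\<Sum>b<2 * m + 1. \<Sum>j\<le>k. entry k A a 0 b j * entry k B b j c 0)"
      using that by (intro mult) auto
    also have "\<dots> = (\<Sum>b<2 * m + 1. entry k A a 0 b 0 * entry k B b 0 c 0)"
      using that by (intro sum.cong refl sum0) (simp add: zA(1))
    finally show ?thesis using that by (simp add: zA(2))
  qed
  have "entry k (A * B) (2 * m) 0 (2 * m) 0 =
      (\<Sum>b<2 * m + 1. \<Sum>j\<le>k. entry k A (2 * m) 0 b j * entry k B b j (2 * m) 0)"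
    by (intro mult) auto
  also have "\<dots> = (\<Sum>j\<le>k. entry k A (2 * m) 0 (2 * m) j * entry k B (2 * m) j (2 * m) 0)"
    by (simp add: zB(2))
  also have "\<dots> = entry k A (2 * m) 0 (2 * m) 0 * entry k B (2 * m) 0 (2 * m) 0"
    by (intro sum0) (simp add: zA(1))
  finally show "entry k (A * B) (2 * m) 0 (2 * m) 0 = entry k A (2 * m) 0 (2 * m) 0 * entry k B (2 * m) 0 (2 * m) 0" .
qed

text \<open>Subtracting scalars from two matrices does not change their commutator, and the constant
  terms on the center are numbers, so their commutator contributes nothing.\<close>

lemma sp_part_bracket:
  assumes mk: "0 < m" "0 < k" and AB: "A \<in> carrier (Der_hc m k)" "B \<in> carrier (Der_hc m k)"
  shows "sp_part m k (A * B - B * A) = sp_part m k A * sp_part m k B - sp_part m k B * sp_part m k A"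
proof (rule eq_matI)
  have dim: "dim_row (sp_part m k C) = 2 * m" "dim_col (sp_part m k C) = 2 * m" for C
    by (auto simp: sp_part_def)
  have entry: "entry k (A * B - B * A) a 0 c 0 = entry k (A * B) a 0 c 0 - entry k (B * A) a 0 c 0"
    if "a < 2 * m + 1" "c < 2 * m + 1" for a c
    using that by (intro entry_minus [OF mult_carrier_mat [OF AB(2,1) [THEN Der_hc_carrier_mat]]]) auto
  fix a c assume "a < dim_row (sp_part m k A * sp_part m k B - sp_part m k B * sp_part m k A)"
    "c < dim_col (sp_part m k A * sp_part m k B - sp_part m k B * sp_part m k A)"
  then have ac: "a < 2 * m" "c < 2 * m" by (auto simp: dim)
  have prod: "(sp_part m k C * sp_part m k C') $$ (a, c) =
      (\<Sum>b<2 * m. entry k C a 0 b 0 * entry k C' b 0 c 0)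
      - entry k C a 0 c 0 * (entry k C' (2 * m) 0 (2 * m) 0 / 2) - entry k C (2 * m) 0 (2 * m) 0 / 2 * entry k C' a 0 c 0
      + (if a = c then entry k C (2 * m) 0 (2 * m) 0 / 2 * (entry k C' (2 * m) 0 (2 * m) 0 / 2) else 0)" for C C'
  proof -
    define x y where "x = entry k C (2 * m) 0 (2 * m) 0 / 2" and "y = entry k C' (2 * m) 0 (2 * m) 0 / 2"
    have "(sp_part m k C * sp_part m k C') $$ (a, c) = (\<Sum>b<2 * m.
        (entry k C a 0 b 0 - (if a = b then x else 0)) * (entry k C' b 0 c 0 - (if b = c then y else 0)))"
      unfolding x_def y_def using ac by (simp add: sp_part_def scalar_prod_def atLeast0LessThan)
    also have "\<dots> = (\<Sum>b<2 * m. entry k C a 0 b 0 * entry k C' b 0 c 0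
        - (if b = c then entry k C a 0 b 0 * y else 0) - (if b = a then x * entry k C' b 0 c 0 else 0)
        + (if b = c then if a = c then x * y else 0 else 0))"
      by (intro sum.cong refl) (auto simp: algebra_simps)
    also have "\<dots> = (\<Sum>b<2 * m. entry k C a 0 b 0 * entry k C' b 0 c 0)
        - entry k C a 0 c 0 * y - x * entry k C' a 0 c 0 + (if a = c then x * y else 0)"
      using ac by (simp add: sum.distrib sum_subtractf)
    finally show ?thesis by (simp only: x_def y_def)
  qed
  have "sp_part m k (A * B - B * A) $$ (a, c) = entry k (A * B) a 0 c 0 - entry k (B * A) a 0 c 0"
    using ac by (simp add: sp_part_def entry entry_mult_00(2) [OF mk AB] entry_mult_00(2) [OF mk AB(2,1)])
  also have "\<dots> = (sp_part m k A * sp_part m k B) $$ (a, c) - (sp_part m k B * sp_part m k A) $$ (a, c)"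
    using ac unfolding prod by (simp add: entry_mult_00(1) [OF mk AB] entry_mult_00(1) [OF mk AB(2,1)])
  finally show "sp_part m k (A * B - B * A) $$ (a, c) =
      (sp_part m k A * sp_part m k B - sp_part m k B * sp_part m k A) $$ (a, c)"
    using ac by (simp add: dim)
qed (auto simp: sp_part_def)

lemma sp_projection_Der_hc:
  assumes mk: "0 < m" "0 < k"
  shows "sp_projection (hc_dim m k) m (carrier (Der_hc m k)) (sp_part m k)"
proof
  fix X assume X: "X \<in> carrier (sp m)"
  then obtain \<rho> where "\<rho> \<in> derivations (heisenberg_current m k)" "hc_matrix m k \<rho> = sp_embed m k X"
    by (rule sp_embed_Der)
  then have "sp_embed m k X \<in> carrier (Der_hc m k)"
    by (metis carrier_Der_hc imageI)
  moreover have "sp_part m k (sp_embed m k X) = X"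
    using X by (intro sp_part_sp_embed) (simp add: carrier_sp_iff)
  ultimately show "\<exists>A\<in>carrier (Der_hc m k). sp_part m k A = X" ..
qed (use Der_hc_closed sp_part_sp [OF mk] sp_part_bracket [OF mk] in
  \<open>auto intro!: sp_part_add sp_part_smult dest: Der_hc_carrier_mat\<close>)

text \<open>Ordering the basis by this height makes the kernel of \<open>sp_part\<close> triangular: the maps from the
  \<open>e\<close> and \<open>f\<close> coordinates to the center are arbitrary, so the whole center has to come last.\<close>

definition height :: "nat \<Rightarrow> nat \<Rightarrow> nat \<Rightarrow> nat" where
  "height m k n = (if n div (k + 1) < 2 * m then n mod (k + 1) else (k + 1) + n mod (k + 1))"

text \<open>The filtration by height: members move every basis vector up by at least
  \<open>d\<close>. It is multiplicative by \<open>raising_mult\<close>, and zero once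
  \<open>d\<close> exceeds all heights.\<close>

definition raising :: "nat \<Rightarrow> (nat \<Rightarrow> nat) \<Rightarrow> nat \<Rightarrow> complex mat set" where
  "raising n h d = {A \<in> carrier_mat n n. \<forall>r<n. \<forall>c<n. A $$ (r, c) \<noteq> 0 \<longrightarrow> h c + d \<le> h r}"

lemma lin_closed_raising: "lin_closed n (raising n h d)"
  unfolding lin_closed_def
proof (intro conjI ballI allI)
  fix A B assume AB: "A \<in> raising n h d" "B \<in> raising n h d"
  have "h c + d \<le> h r" if "r < n" "c < n" "(A + B) $$ (r, c) \<noteq> 0" for r c
  proof -
    have "A $$ (r, c) \<noteq> 0 \<or> B $$ (r, c) \<noteq> 0"
      using that AB by (auto simp: raising_def)
    then show ?thesis using AB that(1,2) unfolding raising_def by blast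
  qed
  then show "A + B \<in> raising n h d"
    using AB by (simp add: raising_def)
qed (auto simp: raising_def)

lemma raising_mult:
  assumes "A \<in> raising n h d" "B \<in> raising n h e"
  shows "A * B \<in> raising n h (d + e)"
proof -
  have AB: "A \<in> carrier_mat n n" "B \<in> carrier_mat n n"
    using assms by (auto simp: raising_def)
  have "h c + (d + e) \<le> h r" if rc: "r < n" "c < n" and nz: "(A * B) $$ (r, c) \<noteq> 0" for r c
  proof -
    have "(A * B) $$ (r, c) = (\<Sum>l<n. A $$ (r, l) * B $$ (l, c))"
      using AB rc by (simp add: scalar_prod_def atLeast0LessThan)
    then obtain l where l: "l < n" "A $$ (r, l) * B $$ (l, c) \<noteq> 0"
      using nz by (metis (no_types, lifting) lessThan_iff sum.neutral)
    then have "h l + d \<le> h r" "h c + e \<le> h l"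
      using assms rc by (auto simp: raising_def)
    then show ?thesis by simp
  qed
  then show ?thesis
    using AB by (auto simp: raising_def)
qed

lemma raising_bracket:
  assumes "A \<in> raising n h d" "B \<in> raising n h e"
  shows "A * B - B * A \<in> raising n h (d + e)"
proof -
  have "A * B + (-1) \<cdot>\<^sub>m (B * A) \<in> raising n h (d + e)"
    using raising_mult [OF assms] raising_mult [OF assms(2,1)] lin_closed_raising [of n h "d + e"]
    by (simp add: lin_closed_def add.commute)
  moreover have "A * B + (-1) \<cdot>\<^sub>m (B * A) = A * B - B * A"
    using assms by (intro eq_matI) (auto simp: raising_def)
  ultimately show ?thesis by simp
qed

text \<open>Different indices may share a height, but the hypotheses forbid entries between them.
  Within a height both matrices are thus diagonal, and diagonal entries cancel in the
  commutator.\<close>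

lemma triangular_bracket:
  assumes "A \<in> carrier_mat n n" "B \<in> carrier_mat n n"
    and tri: "\<And>r c. r < n \<Longrightarrow> c < n \<Longrightarrow> r \<noteq> c \<Longrightarrow> A $$ (r, c) \<noteq> 0 \<Longrightarrow> h c < h r"
      "\<And>r c. r < n \<Longrightarrow> c < n \<Longrightarrow> r \<noteq> c \<Longrightarrow> B $$ (r, c) \<noteq> 0 \<Longrightarrow> h c < (h r :: nat)"
  shows "A * B - B * A \<in> raising n h 1"
proof -
  have prod: "(C * C') $$ (r, c) = (if r = c then C $$ (r, r) * C' $$ (r, r) else 0)"
    if C: "C \<in> carrier_mat n n" "C' \<in> carrier_mat n n"
      "\<And>r c. r < n \<Longrightarrow> c < n \<Longrightarrow> r \<noteq> c \<Longrightarrow> C $$ (r, c) \<noteq> 0 \<Longrightarrow> h c < h r"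
      "\<And>r c. r < n \<Longrightarrow> c < n \<Longrightarrow> r \<noteq> c \<Longrightarrow> C' $$ (r, c) \<noteq> 0 \<Longrightarrow> h c < (h r :: nat)"
      and rc: "r < n" "c < n" "h r \<le> h c" for r c and C C' :: "complex mat"
  proof -
    have "(C * C') $$ (r, c) = (\<Sum>l<n. C $$ (r, l) * C' $$ (l, c))"
      using C(1,2) rc by (simp add: scalar_prod_def atLeast0LessThan)
    also have "\<dots> = (\<Sum>l<n. if l = r then if r = c then C $$ (r, r) * C' $$ (r, r) else 0 else 0)"
    proof (intro sum.cong refl)
      fix l assume "l \<in> {..<n}"
      then have l: "l < n" by simp
      show "C $$ (r, l) * C' $$ (l, c) = (if l = r then if r = c then C $$ (r, r) * C' $$ (r, r) else 0 else 0)"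
      proof (cases "C $$ (r, l) * C' $$ (l, c) = 0")
        case False
        then have "C $$ (r, l) \<noteq> 0" "C' $$ (l, c) \<noteq> 0" by simp_all
        then have "r = l \<or> h l < h r" "l = c \<or> h c < h l"
          using C(3) [OF rc(1) l] C(4) [OF l rc(2)] by blast+
        with rc(3) have "l = r" "r = c" by auto
        then show ?thesis by simp
      qed auto
    qed
    finally show ?thesis using rc by simp
  qed
  have "h c + 1 \<le> h r" if rc: "r < n" "c < n" and nz: "(A * B - B * A) $$ (r, c) \<noteq> 0" for r c
  proof (rule ccontr)
    assume "\<not> h c + 1 \<le> h r"
    then have "h r \<le> h c" by simp
    from prod [OF assms rc this] prod [OF assms(2,1) tri(2,1) rc this] nz assms(1,2) rc
    show False by (cases "r = c") (auto simp: mult.commute)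
  qed
  then show ?thesis
    using assms(1,2) by (auto simp: raising_def)
qed

text \<open>Among e and f, an entry that keeps the degree equals one of degree 0 when its indices
  differ, and those vanish in the kernel. On the diagonal nothing is claimed: p(0) and the multiples
  of q_1 remain there.\<close>

lemma kernel_triangular:
  assumes mk: "0 < m" "0 < k" and M: "M \<in> carrier (Der_hc m k)"
    and ker: "sp_part m k M = 0\<^sub>m (2 * m) (2 * m)"
    and rc: "r < hc_dim m k" "c < hc_dim m k" "r \<noteq> c" "M $$ (r, c) \<noteq> 0"
  shows "height m k c < height m k r"
proof -
  interpret D: hc_derivation_entries m k "entry k M"
    by (rule Der_hc_entries [OF mk M])
  obtain a s where r: "a < 2 * m + 1" "s \<le> k" "r = a * (k + 1) + s"
    using rc(1) unfolding hc_dim_def by (rule block_indexE)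
  obtain b i where c: "b < 2 * m + 1" "i \<le> k" "c = b * (k + 1) + i"
    using rc(2) unfolding hc_dim_def by (rule block_indexE)
  have nz: "entry k M a s b i \<noteq> 0"
    using rc(4) unfolding r c entry_def .
  have h: "height m k r = (if a < 2 * m then s else k + 1 + s)" "height m k c = (if b < 2 * m then i else k + 1 + i)"
    unfolding r(3) c(3) height_def by (simp_all only: block_index_div_mod [OF r(2)] block_index_div_mod [OF c(2)])
  show ?thesis
  proof (cases "a < 2 * m")
    case True
    then have b: "b < 2 * m" using nz entry_block_zero [OF mk M True r(2) c(2)] c(1) by (cases "b = 2 * m") auto
    have i_le_s: "i \<le> s" using entry_column_zero [OF mk M _ r(1) c(1,2) r(2)] True nz by (meson not_le)
    have "a = b" if "i = s"
    proof (rule ccontr)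
      assume "a \<noteq> b"
      have "entry k M a 0 b 0 = 0"
        using arg_cong [OF ker, of "\<lambda>X. X $$ (a, b)"] True b \<open>a \<noteq> b\<close> by (simp add: sp_part_def)
      then show False
        using nz D.entry_eq [OF True b c(2) r(2)] that \<open>a \<noteq> b\<close> by simp
    qed
    then have "i < s" using i_le_s rc(3) r(3) c(3) by (cases "i = s") auto
    then show ?thesis using True b h by simp
  next
    case False
    then have a: "a = 2 * m" using r(1) by simp
    show ?thesis
    proof (cases "b < 2 * m")
      case False
      then have b: "b = 2 * m" using c(1) by simp
      have "i \<le> s" using entry_column_zero [OF mk M _ r(1) c(1,2) r(2)] b nz by (meson not_le)
      then have "i < s" using rc(3) r(3) c(3) a b by (cases "i = s") auto
      then show ?thesis using a b h by simp
    \<comment> \<open>From e or f into the center: the offset \<open>k + 1\<close> places every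
      central vector above all the others.\<close>
    qed (use a h c in simp)
  qed
qed

text \<open>The first derived algebra of the kernel raises the height by 1, and each further one
  raises it by one more, until the bounded range of heights is exhausted.\<close>

lemma kernel_solvable:
  assumes mk: "0 < m" "0 < k"
  shows "lie_solvable (Der_hc m k) {A \<in> carrier (Der_hc m k). sp_part m k A = 0\<^sub>m (2 * m) (2 * m)}"
proof -
  interpret P: sp_projection "hc_dim m k" m "carrier (Der_hc m k)" "sp_part m k"
    by (rule sp_projection_Der_hc [OF mk])
  let ?n = "hc_dim m k" and ?T = "carrier (Der_hc m k)" and ?h = "height m k"
  have L: "(gl ?n)\<lparr>carrier := ?T\<rparr> = Der_hc m k"
    by (simp add: Der_hc_def)
  have lc: "lin_closed ?n (?T \<inter> raising ?n ?h d)" for d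
    using P.lin_closed lin_closed_raising [of ?n ?h d] by (auto simp: lin_closed_def)
  have derived: "lie_derived (Der_hc m k) U \<subseteq> ?T \<inter> raising ?n ?h d \<and> lin_closed ?n (lie_derived (Der_hc m k) U)"
    if U: "U \<subseteq> ?T" "\<And>A B. A \<in> U \<Longrightarrow> B \<in> U \<Longrightarrow> A * B - B * A \<in> raising ?n ?h d" for U d
  proof -
    have "A * B - B * A \<in> ?T" if "A \<in> U" "B \<in> U" for A B
      using that U(1) P.bracket_closed by blast
    note lie_derived_subset [OF P.lin_closed U(1) this lc] lie_derived_lin_closed [OF P.lin_closed U(1) this]
    then show ?thesis
      unfolding L using U(2) \<open>\<And>A B. A \<in> U \<Longrightarrow> B \<in> U \<Longrightarrow> A * B - B * A \<in> ?T\<close> by auto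
  qed
  have it: "(lie_derived (Der_hc m k) ^^ Suc j) P.kernel \<subseteq> ?T \<inter> raising ?n ?h (Suc j) \<and>
      lin_closed ?n ((lie_derived (Der_hc m k) ^^ Suc j) P.kernel)" for j
  proof (induction j)
    case 0
    have "lie_derived (Der_hc m k) P.kernel \<subseteq> ?T \<inter> raising ?n ?h 1 \<and>
        lin_closed ?n (lie_derived (Der_hc m k) P.kernel)"
    proof (rule derived)
      fix A B assume "A \<in> P.kernel" "B \<in> P.kernel"
      then have AB: "A \<in> ?T" "sp_part m k A = 0\<^sub>m (2 * m) (2 * m)" "B \<in> ?T" "sp_part m k B = 0\<^sub>m (2 * m) (2 * m)"
        by (auto simp: P.kernel_def)
      show "A * B - B * A \<in> raising ?n ?h 1"
        by (rule triangular_bracket [OF P.carrier_T [OF AB(1)] P.carrier_T [OF AB(3)]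
              kernel_triangular [OF mk AB(1,2)] kernel_triangular [OF mk AB(3,4)]])
    qed (auto simp: P.kernel_def)
    then show ?case by simp
  next
    case (Suc j)
    have "lie_derived (Der_hc m k) ((lie_derived (Der_hc m k) ^^ Suc j) P.kernel) \<subseteq> ?T \<inter> raising ?n ?h (Suc (Suc j)) \<and>
        lin_closed ?n (lie_derived (Der_hc m k) ((lie_derived (Der_hc m k) ^^ Suc j) P.kernel))"
    proof (rule derived)
      fix A B assume "A \<in> (lie_derived (Der_hc m k) ^^ Suc j) P.kernel" "B \<in> (lie_derived (Der_hc m k) ^^ Suc j) P.kernel"
      then have A: "A \<in> raising ?n ?h (Suc j)" and "B \<in> raising ?n ?h (Suc j)"
        using Suc by blast+
      \<comment> \<open>Weakening one factor to 1 already suffices: the bracket then gains exactly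
        one unit of height.\<close>
      then have "B \<in> raising ?n ?h 1"
        unfolding raising_def by fastforce
      note AB = A this
      show "A * B - B * A \<in> raising ?n ?h (Suc (Suc j))"
        using raising_bracket [OF AB] by simp
    qed (use Suc in blast)
    then show ?case by simp
  qed
  \<comment> \<open>Heights run from 0 to \<open>2 * k + 1\<close>, so no nonzero entry can raise
    them by \<open>2 * k + 3\<close>.\<close>
  have "raising ?n ?h (Suc (2 * k + 2)) \<subseteq> {0\<^sub>m ?n ?n}"
  proof
    fix A assume A: "A \<in> raising ?n ?h (Suc (2 * k + 2))"
    have "?h r < 2 * k + 2" if "r < ?n" for r
      using hc_coord_index(2) [OF that] unfolding height_def
      by (cases "r div (k + 1) < 2 * m"; simp only: if_True if_False; linarith)
    then have "A $$ (r, c) = 0" if "r < ?n" "c < ?n" for r c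
      using A that by (fastforce simp: raising_def)
    then show "A \<in> {0\<^sub>m ?n ?n}"
      using A by (auto simp: raising_def)
  qed
  with it [of "2 * k + 2"] have "(lie_derived (Der_hc m k) ^^ Suc (2 * k + 2)) P.kernel = {0\<^sub>m ?n ?n}"
    unfolding lin_closed_def by blast
  then have "lie_solvable (Der_hc m k) P.kernel"
    unfolding lie_solvable_def by (intro exI [of _ "Suc (2 * k + 2)"]) (simp add: Der_hc_def gl_simps)
  then show ?thesis by (simp only: P.kernel_def)
qed

lemma levi_factor_Der_hc:
  assumes mk: "0 < m" "0 < k"
  shows "levi_factor (Der_hc m k) (sp_embed m k ` carrier (sp m))"
proof -
  interpret P: sp_projection "hc_dim m k" m "carrier (Der_hc m k)" "sp_part m k"
    by (rule sp_projection_Der_hc [OF mk])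
  have L: "P.lie = Der_hc m k"
    unfolding P.lie_def by (simp add: Der_hc_def)
  have "sp_embed m k X \<in> carrier (Der_hc m k)" if "X \<in> carrier (sp m)" for X
    using that by (rule sp_embed_Der [of X m k]) (metis carrier_Der_hc imageI)
  then have "levi_factor P.lie (sp_embed m k ` carrier (sp m))"
    using kernel_solvable [OF mk] unfolding P.kernel_def [symmetric]
    by (intro P.levi_factor_section) (auto simp: L carrier_sp_iff sp_part_sp_embed sp_embed_add sp_embed_smult sp_embed_bracket)
  then show ?thesis by (simp only: L)
qed

section \<open>The block form\<close>

definition submat_at :: "'a mat \<Rightarrow> nat \<Rightarrow> nat \<Rightarrow> nat \<Rightarrow> nat \<Rightarrow> 'a mat" where
  "submat_at M r0 c0 nr nc = mat nr nc (\<lambda>(r, c). M $$ (r0 + r, c0 + c))"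

lemma block_mat_3x3_split:
  fixes M :: "'a::zero mat"
  assumes "M \<in> carrier_mat (n + n + l) (n + n + l)"
  shows "M = block_mat_3x3
    (submat_at M 0 0 n n) (submat_at M 0 n n n) (submat_at M 0 (n + n) n l)
    (submat_at M n 0 n n) (submat_at M n n n n) (submat_at M n (n + n) n l)
    (submat_at M (n + n) 0 l n) (submat_at M (n + n) n l n) (submat_at M (n + n) (n + n) l l)"
  using assms by (intro eq_matI) (auto simp: block_mat_3x3_def append_rows_def submat_at_def)

lemma mat_eq_blockI:
  assumes "A \<in> carrier_mat (n1 * (k + 1)) (n2 * (k + 1))" "B \<in> carrier_mat (n1 * (k + 1)) (n2 * (k + 1))"
    and "\<And>a s c i. a < n1 \<Longrightarrow> s \<le> k \<Longrightarrow> c < n2 \<Longrightarrow> i \<le> k \<Longrightarrow>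
      A $$ (a * (k + 1) + s, c * (k + 1) + i) = B $$ (a * (k + 1) + s, c * (k + 1) + i)"
  shows "A = B"
proof (rule eq_matI)
  fix r c assume "r < dim_row B" "c < dim_col B"
  then have rc: "r < n1 * (k + 1)" "c < n2 * (k + 1)"
    using assms(2) by auto
  obtain a s where 1: "a < n1" "s \<le> k" "r = a * (k + 1) + s"
    using rc(1) by (rule block_indexE)
  obtain b i where 2: "b < n2" "i \<le> k" "c = b * (k + 1) + i"
    using rc(2) by (rule block_indexE)
  show "A $$ (r, c) = B $$ (r, c)"
    unfolding 1 2 by (rule assms(3) [OF 1(1,2) 2(1,2)])
qed (use assms in auto)

lemma submat_at_index:
  assumes "a < n1" "s \<le> k" "c < n2" "i \<le> k"
  shows "submat_at M (a0 * (k + 1)) (c0 * (k + 1)) (n1 * (k + 1)) (n2 * (k + 1)) $$ (a * (k + 1) + s, c * (k + 1) + i) =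
    entry k M (a0 + a) s (c0 + c) i"
  unfolding submat_at_def entry_def add_mult_distrib [of a0 a] add_mult_distrib [of c0 c]
  by (subst index_mat) (simp_all only: block_index_less [OF assms(1,2)] block_index_less [OF assms(3,4)] split add.assoc)

lemma kronecker_index:
  assumes "A \<in> carrier_mat n1 n2" "B \<in> carrier_mat (k + 1) (k + 1)"
    and "a < n1" "s \<le> k" "c < n2" "i \<le> k"
  shows "kronecker A B $$ (a * (k + 1) + s, c * (k + 1) + i) = A $$ (a, c) * B $$ (s, i)"
proof -
  have dim: "dim_row A = n1" "dim_col A = n2" "dim_row B = k + 1" "dim_col B = k + 1"
    using assms(1,2) by auto
  show ?thesis
    unfolding kronecker_def dim
    by (subst index_mat) (simp_all only: block_index_less [OF assms(3,4)] block_index_less [OF assms(5,6)] split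
      block_index_div_mod [OF assms(4)] block_index_div_mod [OF assms(6)])
qed

lemma kronecker_carrier:
  "A \<in> carrier_mat n1 n2 \<Longrightarrow> B \<in> carrier_mat n3 n4 \<Longrightarrow> kronecker A B \<in> carrier_mat (n1 * n3) (n2 * n4)"
  by (auto simp: kronecker_def)

text \<open>\<open>P a c t\<close> is the value on the subdiagonal \<open>t\<close> of a block; the
  offsets \<open>a0\<close> and \<open>c0\<close> choose one of the four quadrants of the e, f
  part.\<close>

definition toeplitz_blocks ::
    "nat \<Rightarrow> nat \<Rightarrow> (nat \<Rightarrow> nat \<Rightarrow> nat \<Rightarrow> complex) \<Rightarrow> nat \<Rightarrow> nat \<Rightarrow> complex mat" where
  "toeplitz_blocks m k P a0 c0 = mat (m * (k + 1)) (m * (k + 1)) (\<lambda>(r, c).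
     if c mod (k + 1) \<le> r mod (k + 1)
     then P (a0 + r div (k + 1)) (c0 + c div (k + 1)) (r mod (k + 1) - c mod (k + 1)) else 0)"

lemma toeplitz_blocks_carrier [simp]:
  "toeplitz_blocks m k P a0 c0 \<in> carrier_mat (m * (k + 1)) (m * (k + 1))"
  by (simp add: toeplitz_blocks_def)

lemma toeplitz_blocks_index:
  assumes "a < m" "s \<le> k" "c < m" "i \<le> k"
  shows "toeplitz_blocks m k P a0 c0 $$ (a * (k + 1) + s, c * (k + 1) + i) =
    (if i \<le> s then P (a0 + a) (c0 + c) (s - i) else 0)"
  unfolding toeplitz_blocks_def
  by (subst index_mat) (simp_all only: block_index_less [OF assms(1,2)] block_index_less [OF assms(3,4)] split
    block_index_div_mod [OF assms(2)] block_index_div_mod [OF assms(4)])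

lemma mat_block_toeplitz_blocks:
  assumes "a < m" "c < m"
  shows "mat_block (k + 1) (toeplitz_blocks m k P a0 c0) a c =
    mat (k + 1) (k + 1) (\<lambda>(s, i). if i \<le> s then P (a0 + a) (c0 + c) (s - i) else 0)"
proof (rule eq_matI)
  fix s i assume "s < dim_row (mat (k + 1) (k + 1) (\<lambda>(s, i). if i \<le> s then P (a0 + a) (c0 + c) (s - i) else 0))"
    "i < dim_col (mat (k + 1) (k + 1) (\<lambda>(s, i). if i \<le> s then P (a0 + a) (c0 + c) (s - i) else 0))"
  then have si: "s \<le> k" "i \<le> k" by auto
  show "mat_block (k + 1) (toeplitz_blocks m k P a0 c0) a c $$ (s, i) =
      mat (k + 1) (k + 1) (\<lambda>(s, i). if i \<le> s then P (a0 + a) (c0 + c) (s - i) else 0) $$ (s, i)"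
    using toeplitz_blocks_index [OF assms(1) si(1) assms(2) si(2), of P a0 c0] si
    by (simp add: mat_block_def)
qed (auto simp: mat_block_def)

text \<open>The coefficient of degree \<open>t\<close> of the part linear over the truncated
  polynomials, with p removed from the diagonal; at \<open>t = 0\<close> it is
  \<open>sp_part\<close>.\<close>

definition sp_coeff :: "nat \<Rightarrow> nat \<Rightarrow> complex mat \<Rightarrow> nat \<Rightarrow> nat \<Rightarrow> nat \<Rightarrow> complex" where
  "sp_coeff m k M a c t = entry k M a t c 0 - (if a = c then entry k M (2 * m) t (2 * m) 0 / 2 else 0)"

definition scaling_poly :: "nat \<Rightarrow> nat \<Rightarrow> complex mat \<Rightarrow> complex poly" where
  "scaling_poly m k M = (\<Sum>i\<le>k. monom (entry k M (2 * m) i (2 * m) 0 / 2) i)"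

text \<open>The positive coefficients are those of \<open>vector_field\<close>. The constant one is
  set to 0, matching the vanishing at the origin instead of the default value produced by truncated
  subtraction.\<close>

definition field_poly :: "nat \<Rightarrow> nat \<Rightarrow> complex mat \<Rightarrow> complex poly" where
  "field_poly m k M = (\<Sum>i\<le>k. monom (if i = 0 then 0
     else entry k M (2 * m) i (2 * m) 1 - entry k M (2 * m) (i - 1) (2 * m) 0) i)"

lemma coeff_sum_monom: "coeff (\<Sum>i\<le>k. monom (f i) i) n = (if n \<le> k then f n else 0)"
  by (simp add: coeff_sum)

lemma degree_sum_monom: "degree (\<Sum>i\<le>k. monom (f i) i) \<le> k"
  by (intro degree_le) (simp add: coeff_sum_monom)

text \<open>The blocks are numbered as in the paper: \<open>A\<^sub>1, A\<^sub>2\<close> form the upper and \<open>A\<^sub>4, A\<^sub>3\<close> the lower row.\<close>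

definition row_shift :: "nat \<Rightarrow> nat \<Rightarrow> nat" where
  "row_shift m r = (if r \<in> {3, 4} then m else 0)"

definition col_shift :: "nat \<Rightarrow> nat \<Rightarrow> nat" where
  "col_shift m r = (if r \<in> {2, 3} then m else 0)"

context
  fixes m k :: nat and M
  assumes mk: "0 < m" "0 < k" and M: "M \<in> carrier (Der_hc m k)"
begin

interpretation D: hc_derivation_entries m k "entry k M"
  by (rule Der_hc_entries [OF mk M])

text \<open>The half of delta(1) taken away in \<open>sp_coeff\<close> returns as
  \<open>R_mat\<close> on the diagonal blocks; on the center it occurs twice.\<close>

lemma entry_decomposition:
  assumes "a < 2 * m" "c < 2 * m" "s \<le> k" "i \<le> k"
  shows "entry k M a s c i = (if i \<le> s then sp_coeff m k M a c (s - i) else 0) +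
    (if a = c then R_mat k (scaling_poly m k M) $$ (s, i) + Rbar_mat k (field_poly m k M) $$ (s, i) else 0)"
  using assms D.entry_eq [of a c i s]
  by (auto simp: sp_coeff_def R_mat_def Rbar_mat_def scaling_poly_def field_poly_def coeff_sum_monom
      D.vector_field_def D.center_entry_def)

lemma entry_center_decomposition:
  assumes "s \<le> k" "i \<le> k"
  shows "entry k M (2 * m) s (2 * m) i =
    2 * R_mat k (scaling_poly m k M) $$ (s, i) + Rbar_mat k (field_poly m k M) $$ (s, i)"
  using assms D.center_entry_eq [of i s]
  by (auto simp: R_mat_def Rbar_mat_def scaling_poly_def field_poly_def coeff_sum_monom
      D.vector_field_def D.center_entry_def)

lemma sp_coeff_relations:
  assumes "a < m" "b < m" "t \<le> k"
  shows "sp_coeff m k M (m + a) (m + b) t = - sp_coeff m k M b a t"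
    and "sp_coeff m k M a (m + b) t = sp_coeff m k M b (m + a) t"
    and "sp_coeff m k M (m + a) b t = sp_coeff m k M (m + b) a t"
  using D.sp_relations [OF assms] assms by (auto simp: sp_coeff_def D.center_entry_def)

lemma block_form:
  defines "R1 \<equiv> kronecker (1\<^sub>m m) (R_mat k (scaling_poly m k M))"
    and "R2 \<equiv> kronecker (1\<^sub>m m) (Rbar_mat k (field_poly m k M))"
    and "A \<equiv> \<lambda>r. toeplitz_blocks m k (sp_coeff m k M) (row_shift m r) (col_shift m r)"
  shows "M = block_mat_3x3
    (A 1 + R1 + R2) (A 2) (0\<^sub>m (m * (k + 1)) (k + 1))
    (A 4) (A 3 + R1 + R2) (0\<^sub>m (m * (k + 1)) (k + 1))
    (submat_at M (2 * m * (k + 1)) 0 (k + 1) (m * (k + 1)))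
    (submat_at M (2 * m * (k + 1)) (m * (k + 1)) (k + 1) (m * (k + 1)))
    (2 \<cdot>\<^sub>m R_mat k (scaling_poly m k M) + Rbar_mat k (field_poly m k M))"
proof -
  \<comment> \<open>Sizes and offsets count blocks of length \<open>k + 1\<close>; the center is one
    such block, so \<open>submat_at_index\<close> applies to all nine parts.\<close>
  let ?S = "\<lambda>a0 c0 n1 n2. submat_at M (a0 * (k + 1)) (c0 * (k + 1)) (n1 * (k + 1)) (n2 * (k + 1))"
  have S_carrier: "?S a0 c0 n1 n2 \<in> carrier_mat (n1 * (k + 1)) (n2 * (k + 1))" for a0 c0 n1 n2
    by (simp add: submat_at_def)
  have R: "R_mat k p \<in> carrier_mat (k + 1) (k + 1)" "Rbar_mat k p \<in> carrier_mat (k + 1) (k + 1)" for p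
    by (auto simp: R_mat_def Rbar_mat_def)
  have R12: "R1 \<in> carrier_mat (m * (k + 1)) (m * (k + 1))" "R2 \<in> carrier_mat (m * (k + 1)) (m * (k + 1))"
    unfolding R1_def R2_def by (intro kronecker_carrier R one_carrier_mat)+
  have R12_index: "R1 $$ (a * (k + 1) + s, c * (k + 1) + i) = (if a = c then R_mat k (scaling_poly m k M) $$ (s, i) else 0)"
    "R2 $$ (a * (k + 1) + s, c * (k + 1) + i) = (if a = c then Rbar_mat k (field_poly m k M) $$ (s, i) else 0)"
    if "a < m" "s \<le> k" "c < m" "i \<le> k" for a s c i
    using that unfolding R1_def R2_def
    by (simp_all only: kronecker_index [OF one_carrier_mat R(1)] kronecker_index [OF one_carrier_mat R(2)]) auto
  have add_index: "(T + R1 + R2) $$ (a * (k + 1) + s, c * (k + 1) + i) = T $$ (a * (k + 1) + s, c * (k + 1) + i) +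
      (if a = c then R_mat k (scaling_poly m k M) $$ (s, i) + Rbar_mat k (field_poly m k M) $$ (s, i) else 0)"
    if "a < m" "s \<le> k" "c < m" "i \<le> k" for T a s c i
  proof -
    have "a * (k + 1) + s < m * (k + 1)" "c * (k + 1) + i < m * (k + 1)"
      using that block_index_less by auto
    then have "(T + R1 + R2) $$ (a * (k + 1) + s, c * (k + 1) + i) = T $$ (a * (k + 1) + s, c * (k + 1) + i) +
        R1 $$ (a * (k + 1) + s, c * (k + 1) + i) + R2 $$ (a * (k + 1) + s, c * (k + 1) + i)"
      using R12 by (subst index_add_mat; simp add: index_add_mat)
    then show ?thesis
      unfolding R12_index [OF that] by simp
  qed
  have diag: "?S a0 a0 m m = toeplitz_blocks m k (sp_coeff m k M) a0 a0 + R1 + R2" if "a0 \<le> m" for a0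
    by (rule mat_eq_blockI [OF S_carrier])
      (use R12 that in \<open>auto simp only: submat_at_index add_index toeplitz_blocks_index entry_decomposition
        intro!: add_carrier_mat\<close>, auto simp: entry_decomposition)
  have off: "?S a0 c0 m m = toeplitz_blocks m k (sp_coeff m k M) a0 c0" if "a0 = m \<and> c0 = 0 \<or> a0 = 0 \<and> c0 = m" for a0 c0
    by (rule mat_eq_blockI [OF S_carrier toeplitz_blocks_carrier])
      (use that in \<open>auto simp only: submat_at_index toeplitz_blocks_index\<close>, auto simp: entry_decomposition)
  have zero: "?S a0 (2 * m) m 1 = 0\<^sub>m (m * (k + 1)) (1 * (k + 1))" if "a0 \<le> m" for a0
  proof (rule mat_eq_blockI [OF S_carrier])
    fix a s c i assume h: "a < m" "s \<le> k" "c < (1::nat)" "i \<le> k"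
    then have "0\<^sub>m (m * (k + 1)) (1 * (k + 1)) $$ (a * (k + 1) + s, c * (k + 1) + i) = (0::complex)"
      by (intro index_zero_mat(1) block_index_less)
    then show "?S a0 (2 * m) m 1 $$ (a * (k + 1) + s, c * (k + 1) + i) =
        0\<^sub>m (m * (k + 1)) (1 * (k + 1)) $$ (a * (k + 1) + s, c * (k + 1) + i)"
      unfolding submat_at_index [OF h] using h that entry_block_zero [OF mk M, of "a0 + a" s i] by simp
  qed simp
  have center: "?S (2 * m) (2 * m) 1 1 = 2 \<cdot>\<^sub>m R_mat k (scaling_poly m k M) + Rbar_mat k (field_poly m k M)"
  proof (rule mat_eq_blockI [OF S_carrier])
    fix a s c i assume h: "a < (1::nat)" "s \<le> k" "c < (1::nat)" "i \<le> k"
    then show "?S (2 * m) (2 * m) 1 1 $$ (a * (k + 1) + s, c * (k + 1) + i) =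
        (2 \<cdot>\<^sub>m R_mat k (scaling_poly m k M) + Rbar_mat k (field_poly m k M)) $$ (a * (k + 1) + s, c * (k + 1) + i)"
      unfolding submat_at_index [OF h] using R(1) [of "scaling_poly m k M"] R(2) [of "field_poly m k M"]
      by (simp add: entry_center_decomposition)
  qed (use R in auto)
  have dim: "M \<in> carrier_mat (m * (k + 1) + m * (k + 1) + 1 * (k + 1)) (m * (k + 1) + m * (k + 1) + 1 * (k + 1))"
    using Der_hc_carrier_mat [OF M] by (simp only: hc_dim_def add_mult_distrib mult_2)
  have mm: "m * (k + 1) + m * (k + 1) = 2 * m * (k + 1)" and z: "0 = 0 * (k + 1)"
    by simp_all
  have "M = block_mat_3x3 (?S 0 0 m m) (?S 0 m m m) (?S 0 (2 * m) m 1) (?S m 0 m m) (?S m m m m) (?S m (2 * m) m 1)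
      (?S (2 * m) 0 1 m) (?S (2 * m) m 1 m) (?S (2 * m) (2 * m) 1 1)"
    using block_mat_3x3_split [OF dim] unfolding mm by (simp only: mult_zero_left)
  then show ?thesis
    unfolding diag [OF le0] diag [OF order_refl] zero [OF le0] zero [OF order_refl] center
      off [OF disjI2 [OF conjI [OF refl refl]]] off [OF disjI1 [OF conjI [OF refl refl]]] A_def row_shift_def col_shift_def
    by simp
qed

text \<open>Keeping only \<open>t = 0\<close> leaves the diagonal of each Toeplitz block, a scalar
  given by an entry of \<open>sp_part\<close>; this is the Kronecker product with the
  identity.\<close>

lemma
  defines "D \<equiv> \<lambda>r. toeplitz_blocks m k (\<lambda>a c t. if t = 0 then sp_coeff m k M a c t else 0) (row_shift m r) (col_shift m r)"
  shows levi_blocks_kronecker: "four_block_mat (D 1) (D 2) (D 4) (D 3) = kronecker (sp_part m k M) (1\<^sub>m (k + 1))"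
    and levi_block_eq: "levi_block m k (D 1) (D 2) (D 3) (D 4) = sp_embed m k (sp_part m k M)"
proof -
  have D: "D r \<in> carrier_mat (m * (k + 1)) (m * (k + 1))" for r
    unfolding D_def by (rule toeplitz_blocks_carrier)
  have X: "sp_part m k M \<in> carrier_mat (2 * m) (2 * m)"
    by (simp add: sp_part_def)
  have D_index: "D r $$ (a * (k + 1) + s, c * (k + 1) + i) =
      (if s = i then sp_part m k M $$ (row_shift m r + a, col_shift m r + c) else 0)"
    if "a < m" "s \<le> k" "c < m" "i \<le> k" for r a s c i
    using that unfolding D_def toeplitz_blocks_index [OF that]
    by (auto simp: sp_part_def sp_coeff_def row_shift_def col_shift_def)
  show 1: "four_block_mat (D 1) (D 2) (D 4) (D 3) = kronecker (sp_part m k M) (1\<^sub>m (k + 1))"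
  proof (rule mat_eq_blockI)
    have "four_block_mat (D 1) (D 2) (D 4) (D 3) \<in> carrier_mat (m * (k + 1) + m * (k + 1)) (m * (k + 1) + m * (k + 1))"
      by (intro four_block_carrier_mat D)
    then show "four_block_mat (D 1) (D 2) (D 4) (D 3) \<in> carrier_mat (2 * m * (k + 1)) (2 * m * (k + 1))"
      by (simp only: mult_2 add_mult_distrib)
    show "kronecker (sp_part m k M) (1\<^sub>m (k + 1)) \<in> carrier_mat (2 * m * (k + 1)) (2 * m * (k + 1))"
      by (intro kronecker_carrier X one_carrier_mat)
    fix a s c i assume h: "a < 2 * m" "s \<le> k" "c < 2 * m" "i \<le> k"
    have dims: "dim_row (D r) = m * (k + 1)" "dim_col (D r) = m * (k + 1)" for r
      using D by auto
    have less: "a * (k + 1) + s < m * (k + 1) + m * (k + 1)" "c * (k + 1) + i < m * (k + 1) + m * (k + 1)"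
      using block_index_less [OF h(1,2)] block_index_less [OF h(3,4)] by (simp_all only: mult_2 add_mult_distrib)
    have iff: "a * (k + 1) + s < m * (k + 1) \<longleftrightarrow> a < m" if "s \<le> k" for a s
    proof
      show "a < m" if "a * (k + 1) + s < m * (k + 1)"
        using that mult_le_mono1 [of m a "k + 1"] by (meson leD leI trans_le_add1)
    qed (rule block_index_less [OF _ that])
    have diff: "a * (k + 1) + s - m * (k + 1) = (a - m) * (k + 1) + s" if "\<not> a < m" for a s
      using that mult_le_mono1 [of m a "k + 1"] by (simp add: diff_mult_distrib)
    have "four_block_mat (D 1) (D 2) (D 4) (D 3) $$ (a * (k + 1) + s, c * (k + 1) + i) =
        (if a < m then if c < m then D 1 $$ (a * (k + 1) + s, c * (k + 1) + i)
          else D 2 $$ (a * (k + 1) + s, (c - m) * (k + 1) + i)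
        else if c < m then D 4 $$ ((a - m) * (k + 1) + s, c * (k + 1) + i)
          else D 3 $$ ((a - m) * (k + 1) + s, (c - m) * (k + 1) + i))"
      using less
      by (subst index_mat_four_block; cases "a < m"; cases "c < m";
          simp_all only: dims iff [OF h(2)] iff [OF h(4)] diff if_True if_False simp_thms)
    also have "\<dots> = (if s = i then sp_part m k M $$ (a, c) else 0)"
    proof -
      have "a - m < m" "c - m < m" using h by auto
      then show ?thesis
        using h by (cases "a < m"; cases "c < m")
          (simp_all only: D_index if_True if_False, simp_all add: row_shift_def col_shift_def)
    qed
    also have "\<dots> = kronecker (sp_part m k M) (1\<^sub>m (k + 1)) $$ (a * (k + 1) + s, c * (k + 1) + i)"
      unfolding kronecker_index [OF X one_carrier_mat h] using h by simp
    finally show "four_block_mat (D 1) (D 2) (D 4) (D 3) $$ (a * (k + 1) + s, c * (k + 1) + i) =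
        kronecker (sp_part m k M) (1\<^sub>m (k + 1)) $$ (a * (k + 1) + s, c * (k + 1) + i)" .
  qed
  have z1: "0\<^sub>m n l @\<^sub>r 0\<^sub>m n l = (0\<^sub>m (n + n) l :: complex mat)" for n l
    by (intro eq_matI) (auto simp: append_rows_def)
  have z2: "four_block_mat (0\<^sub>m l n) (0\<^sub>m l n) (0\<^sub>m 0 n) (0\<^sub>m 0 n) = (0\<^sub>m l (n + n) :: complex mat)" for n l
    by (intro eq_matI) auto
  show "levi_block m k (D 1) (D 2) (D 3) (D 4) = sp_embed m k (sp_part m k M)"
    unfolding levi_block_def block_mat_3x3_def 1 z1 sp_embed_def index_zero_mat(3) z2 by (simp only: mult_2 add_mult_distrib)
qed

end

section \<open>Assembly of the block form and the Levi factor\<close>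

lemma sp_simps:
  "add (sp m) = (+)" "smult (sp m) = (\<cdot>\<^sub>m)" "lie_bracket (sp m) = (\<lambda>A B. A * B - B * A)"
  by (simp_all add: sp_def gl_simps)

theorem theorem4p1:
  fixes m k :: nat
  assumes "0 < m" and "0 < k"
  shows "\<exists>(p :: ((nat \<Rightarrow> complex vec) \<Rightarrow> (nat \<Rightarrow> complex vec)) \<Rightarrow> complex poly) q A S T B D.
    (\<forall>\<rho> \<in> derivations (heisenberg_current m k).
       degree (p \<rho>) \<le> k \<and> degree (q \<rho>) \<le> k \<and>
       S \<rho> \<in> carrier_mat (k + 1) (m * (k + 1)) \<and>
       T \<rho> \<in> carrier_mat (k + 1) (m * (k + 1)) \<and>
       (\<forall>r\<in>{1, 2, 3, 4 :: nat}. A r \<rho> \<in> carrier_mat (m * (k + 1)) (m * (k + 1))) \<and>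
       (let R1 = kronecker (1\<^sub>m m) (R_mat k (p \<rho>));
            R2 = kronecker (1\<^sub>m m) (Rbar_mat k (q \<rho>))
        in hc_matrix m k \<rho> = block_mat_3x3
             (A 1 \<rho> + R1 + R2) (A 2 \<rho>)             (0\<^sub>m (m * (k + 1)) (k + 1))
             (A 4 \<rho>)           (A 3 \<rho> + R1 + R2)   (0\<^sub>m (m * (k + 1)) (k + 1))
             (S \<rho>)             (T \<rho>)               (2 \<cdot>\<^sub>m R_mat k (p \<rho>) + Rbar_mat k (q \<rho>))) \<and>
       (\<forall>i<m. \<forall>j<m.
          (\<forall>r\<in>{1, 2, 3, 4}. lower_triangular_toeplitz (k + 1) (mat_block (k + 1) (A r \<rho>) i j)) \<and>
          mat_block (k + 1) (A 3 \<rho>) i j = - mat_block (k + 1) (A 1 \<rho>) j i \<and>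
          mat_block (k + 1) (A 2 \<rho>) i j = mat_block (k + 1) (A 2 \<rho>) j i \<and>
          mat_block (k + 1) (A 4 \<rho>) i j = mat_block (k + 1) (A 4 \<rho>) j i) \<and>
       (\<forall>r\<in>{1, 2, 3, 4}.
          B r \<rho> \<in> carrier_mat (m * (k + 1)) (m * (k + 1)) \<and>
          D r \<rho> \<in> carrier_mat (m * (k + 1)) (m * (k + 1)) \<and>
          (\<forall>i<m. \<forall>j<m.
             mat_block (k + 1) (A r \<rho>) i j =
               mat_block (k + 1) (B r \<rho>) i j + mat_block (k + 1) (D r \<rho>) i j \<and>
             (\<exists>c. mat_block (k + 1) (D r \<rho>) i j = c \<cdot>\<^sub>m 1\<^sub>m (k + 1)) \<and>
             (\<forall>l\<le>k. mat_block (k + 1) (B r \<rho>) i j $$ (l, l) = 0))) \<and>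
       (\<exists>X \<in> carrier (sp m).
          four_block_mat (D 1 \<rho>) (D 2 \<rho>) (D 4 \<rho>) (D 3 \<rho>) = kronecker X (1\<^sub>m (k + 1)))) \<and>
    (let \<LL> = {levi_block m k (D 1 \<rho>) (D 2 \<rho>) (D 3 \<rho>) (D 4 \<rho>) | \<rho>.
                \<rho> \<in> derivations (heisenberg_current m k)}
     in levi_factor (Der_hc m k) \<LL> \<and>
        (let \<phi> = (\<lambda>X. four_block_mat (kronecker X (1\<^sub>m (k + 1))) (0\<^sub>m (2 * m * (k + 1)) (k + 1))
                         (0\<^sub>m (k + 1) (2 * m * (k + 1))) (0\<^sub>m (k + 1) (k + 1)))
         in \<phi> \<in> lie_hom (sp m) (gl (hc_dim m k)) \<and> \<phi> ` carrier (sp m) = \<LL>))"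
proof -
  let ?D = "derivations (heisenberg_current m k)" and ?H = "hc_matrix m k"
  \<comment> \<open>The predicate selects subdiagonals: all of them give A, the positive ones give B
    with zero diagonal, and degree 0 gives D.\<close>
  define blocks where "blocks P r \<rho> = toeplitz_blocks m k (\<lambda>a c t. if P t then sp_coeff m k (?H \<rho>) a c t else 0)
    (row_shift m r) (col_shift m r)" for P r \<rho>
  define p where "p \<rho> = scaling_poly m k (?H \<rho>)" for \<rho>
  define q where "q \<rho> = field_poly m k (?H \<rho>)" for \<rho>
  define S where "S \<rho> = submat_at (?H \<rho>) (2 * m * (k + 1)) 0 (k + 1) (m * (k + 1))" for \<rho>
  define T where "T \<rho> = submat_at (?H \<rho>) (2 * m * (k + 1)) (m * (k + 1)) (k + 1) (m * (k + 1))" for \<rho>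
  define A where "A = blocks (\<lambda>t. True)"
  define B where "B = blocks (\<lambda>t. t \<noteq> 0)"
  define D where "D = blocks (\<lambda>t. t = 0)"
  have Der: "?H \<rho> \<in> carrier (Der_hc m k)" if "\<rho> \<in> ?D" for \<rho>
    using that by (simp add: carrier_Der_hc)
  have blocks_carrier: "blocks P r \<rho> \<in> carrier_mat (m * (k + 1)) (m * (k + 1))" for P r \<rho>
    unfolding blocks_def by (rule toeplitz_blocks_carrier)
  have block: "mat_block (k + 1) (blocks P r \<rho>) i j = mat (k + 1) (k + 1) (\<lambda>(s, t). if t \<le> s then
      (if P (s - t) then sp_coeff m k (?H \<rho>) (row_shift m r + i) (col_shift m r + j) (s - t) else 0) else 0)"
    if "i < m" "j < m" for P r \<rho> i j
    unfolding blocks_def by (rule mat_block_toeplitz_blocks [OF that])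
  have A_eq: "A r \<rho> = toeplitz_blocks m k (sp_coeff m k (?H \<rho>)) (row_shift m r) (col_shift m r)" for r \<rho>
    by (simp add: A_def blocks_def)
  have form: "let R1 = kronecker (1\<^sub>m m) (R_mat k (p \<rho>)); R2 = kronecker (1\<^sub>m m) (Rbar_mat k (q \<rho>))
      in ?H \<rho> = block_mat_3x3
        (A 1 \<rho> + R1 + R2) (A 2 \<rho>) (0\<^sub>m (m * (k + 1)) (k + 1))
        (A 4 \<rho>) (A 3 \<rho> + R1 + R2) (0\<^sub>m (m * (k + 1)) (k + 1))
        (S \<rho>) (T \<rho>) (2 \<cdot>\<^sub>m R_mat k (p \<rho>) + Rbar_mat k (q \<rho>))" if "\<rho> \<in> ?D" for \<rho>
    unfolding Let_def A_eq p_def q_def S_def T_def by (rule block_form [OF assms Der [OF that]])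
  have relations: "lower_triangular_toeplitz (k + 1) (mat_block (k + 1) (A r \<rho>) i j)"
    "mat_block (k + 1) (A 3 \<rho>) i j = - mat_block (k + 1) (A 1 \<rho>) j i"
    "mat_block (k + 1) (A 2 \<rho>) i j = mat_block (k + 1) (A 2 \<rho>) j i"
    "mat_block (k + 1) (A 4 \<rho>) i j = mat_block (k + 1) (A 4 \<rho>) j i"
    if "\<rho> \<in> ?D" "i < m" "j < m" for \<rho> i j r
  proof -
    note rel = sp_coeff_relations [OF assms Der [OF that(1)]]
    show "lower_triangular_toeplitz (k + 1) (mat_block (k + 1) (A r \<rho>) i j)"
      unfolding lower_triangular_toeplitz_def A_eq mat_block_toeplitz_blocks [OF that(2,3)]
      by (rule exI [of _ "sp_coeff m k (?H \<rho>) (row_shift m r + i) (col_shift m r + j)"], rule refl)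
    show "mat_block (k + 1) (A 3 \<rho>) i j = - mat_block (k + 1) (A 1 \<rho>) j i"
      "mat_block (k + 1) (A 2 \<rho>) i j = mat_block (k + 1) (A 2 \<rho>) j i"
      "mat_block (k + 1) (A 4 \<rho>) i j = mat_block (k + 1) (A 4 \<rho>) j i"
      unfolding A_eq mat_block_toeplitz_blocks [OF that(2,3)] mat_block_toeplitz_blocks [OF that(3,2)]
      using that(2,3)
      by (auto simp: row_shift_def col_shift_def rel(1) rel(2) [of i j] rel(3) [of i j] intro!: eq_matI)
  qed
  have split: "mat_block (k + 1) (A r \<rho>) i j = mat_block (k + 1) (B r \<rho>) i j + mat_block (k + 1) (D r \<rho>) i j"
    "\<exists>c. mat_block (k + 1) (D r \<rho>) i j = c \<cdot>\<^sub>m 1\<^sub>m (k + 1)"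
    "\<forall>l\<le>k. mat_block (k + 1) (B r \<rho>) i j $$ (l, l) = 0"
    if "i < m" "j < m" for \<rho> i j r
  proof -
    show "mat_block (k + 1) (A r \<rho>) i j = mat_block (k + 1) (B r \<rho>) i j + mat_block (k + 1) (D r \<rho>) i j"
      unfolding A_def B_def D_def block [OF that] by (intro eq_matI) auto
    show "\<exists>c. mat_block (k + 1) (D r \<rho>) i j = c \<cdot>\<^sub>m 1\<^sub>m (k + 1)"
      unfolding D_def block [OF that]
      by (intro exI [of _ "sp_coeff m k (?H \<rho>) (row_shift m r + i) (col_shift m r + j) 0"] eq_matI) auto
    show "\<forall>l\<le>k. mat_block (k + 1) (B r \<rho>) i j $$ (l, l) = 0"
      unfolding B_def block [OF that] by auto
  qed
  have kron: "four_block_mat (D 1 \<rho>) (D 2 \<rho>) (D 4 \<rho>) (D 3 \<rho>) = kronecker (sp_part m k (?H \<rho>)) (1\<^sub>m (k + 1))"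
    and levi: "levi_block m k (D 1 \<rho>) (D 2 \<rho>) (D 3 \<rho>) (D 4 \<rho>) = sp_embed m k (sp_part m k (?H \<rho>))"
    if "\<rho> \<in> ?D" for \<rho>
    unfolding D_def blocks_def
    by (rule levi_blocks_kronecker [OF assms Der [OF that]], rule levi_block_eq [OF assms Der [OF that]])
  \<comment> \<open>One inclusion holds because every \<open>sp_part\<close> is symplectic, the
    other because each \<open>X\<close> is the \<open>sp_part\<close> of the derivation that
    realizes \<open>sp_embed m k X\<close>.\<close>
  have L: "{levi_block m k (D 1 \<rho>) (D 2 \<rho>) (D 3 \<rho>) (D 4 \<rho>) | \<rho>. \<rho> \<in> ?D} = sp_embed m k ` carrier (sp m)"
    (is "?L = _")
  proof (intro equalityI subsetI)
    fix Y assume "Y \<in> ?L"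
    then obtain \<rho> where \<rho>: "\<rho> \<in> ?D" "Y = sp_embed m k (sp_part m k (?H \<rho>))"
      using levi by blast
    then show "Y \<in> sp_embed m k ` carrier (sp m)"
      using sp_part_sp [OF assms Der [OF \<rho>(1)]] by blast
  next
    fix Y assume "Y \<in> sp_embed m k ` carrier (sp m)"
    then obtain X where X: "X \<in> carrier (sp m)" "Y = sp_embed m k X" by blast
    obtain \<rho> where \<rho>: "\<rho> \<in> ?D" "?H \<rho> = sp_embed m k X"
      using X(1) by (rule sp_embed_Der)
    have "sp_part m k (?H \<rho>) = X"
      unfolding \<rho>(2) using X(1) by (intro sp_part_sp_embed) (simp add: carrier_sp_iff)
    then have "Y = levi_block m k (D 1 \<rho>) (D 2 \<rho>) (D 3 \<rho>) (D 4 \<rho>)"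
      unfolding levi [OF \<rho>(1)] X(2) by simp
    with \<rho>(1) show "Y \<in> ?L" by blast
  qed
  have hom: "sp_embed m k \<in> lie_hom (sp m) (gl (hc_dim m k))"
    by (auto simp: lie_hom_def LinearCombinations.module_hom_def sp_simps gl_simps carrier_sp_iff sp_embed_carrier
        sp_embed_add sp_embed_smult sp_embed_bracket)
  have embed: "(\<lambda>X. four_block_mat (kronecker X (1\<^sub>m (k + 1))) (0\<^sub>m (2 * m * (k + 1)) (k + 1))
      (0\<^sub>m (k + 1) (2 * m * (k + 1))) (0\<^sub>m (k + 1) (k + 1))) = sp_embed m k"
    by (simp add: sp_embed_def fun_eq_iff)
  show ?thesis
    unfolding embed
  proof (rule exI [of _ p], rule exI [of _ q], rule exI [of _ A], rule exI [of _ S], rule exI [of _ T],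
      rule exI [of _ B], rule exI [of _ D], intro conjI ballI)
    show "let \<LL> = ?L in levi_factor (Der_hc m k) \<LL> \<and> (let \<phi> = sp_embed m k
        in \<phi> \<in> lie_hom (sp m) (gl (hc_dim m k)) \<and> \<phi> ` carrier (sp m) = \<LL>)"
      unfolding L Let_def using levi_factor_Der_hc [OF assms] hom by blast
    fix \<rho> assume \<rho>: "\<rho> \<in> ?D"
    show "degree (p \<rho>) \<le> k" "degree (q \<rho>) \<le> k"
      unfolding p_def q_def scaling_poly_def field_poly_def by (rule degree_sum_monom)+
    show "S \<rho> \<in> carrier_mat (k + 1) (m * (k + 1))" "T \<rho> \<in> carrier_mat (k + 1) (m * (k + 1))"
      unfolding S_def T_def submat_at_def by (rule mat_carrier)+
    show "A r \<rho> \<in> carrier_mat (m * (k + 1)) (m * (k + 1))" "B r \<rho> \<in> carrier_mat (m * (k + 1)) (m * (k + 1))"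
      "D r \<rho> \<in> carrier_mat (m * (k + 1)) (m * (k + 1))" for r
      unfolding A_def B_def D_def by (rule blocks_carrier)+
    show "let R1 = kronecker (1\<^sub>m m) (R_mat k (p \<rho>)); R2 = kronecker (1\<^sub>m m) (Rbar_mat k (q \<rho>))
      in ?H \<rho> = block_mat_3x3
        (A 1 \<rho> + R1 + R2) (A 2 \<rho>) (0\<^sub>m (m * (k + 1)) (k + 1))
        (A 4 \<rho>) (A 3 \<rho> + R1 + R2) (0\<^sub>m (m * (k + 1)) (k + 1))
        (S \<rho>) (T \<rho>) (2 \<cdot>\<^sub>m R_mat k (p \<rho>) + Rbar_mat k (q \<rho>))"
      by (rule form [OF \<rho>])
    show "\<forall>i<m. \<forall>j<m.
          (\<forall>r\<in>{1, 2, 3, 4}. lower_triangular_toeplitz (k + 1) (mat_block (k + 1) (A r \<rho>) i j)) \<and>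
          mat_block (k + 1) (A 3 \<rho>) i j = - mat_block (k + 1) (A 1 \<rho>) j i \<and>
          mat_block (k + 1) (A 2 \<rho>) i j = mat_block (k + 1) (A 2 \<rho>) j i \<and>
          mat_block (k + 1) (A 4 \<rho>) i j = mat_block (k + 1) (A 4 \<rho>) j i"
      using relations [OF \<rho>] by blast
    show "\<forall>i<m. \<forall>j<m.
             mat_block (k + 1) (A r \<rho>) i j =
               mat_block (k + 1) (B r \<rho>) i j + mat_block (k + 1) (D r \<rho>) i j \<and>
             (\<exists>c. mat_block (k + 1) (D r \<rho>) i j = c \<cdot>\<^sub>m 1\<^sub>m (k + 1)) \<and>
             (\<forall>l\<le>k. mat_block (k + 1) (B r \<rho>) i j $$ (l, l) = 0)" for r
      using split by blast
    show "\<exists>X \<in> carrier (sp m).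
        four_block_mat (D 1 \<rho>) (D 2 \<rho>) (D 4 \<rho>) (D 3 \<rho>) = kronecker X (1\<^sub>m (k + 1))"
      using sp_part_sp [OF assms Der [OF \<rho>]] kron [OF \<rho>] by blast
  qed
qed

end
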